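(* Let $q$ be a fixed odd prime power, and let $\sigma\in(1/2,1)$ and $b\in(0,1)$ be fixed. Put \[ \alpha_q(b)=\frac{2\mathcal{Z}(2)}{\ln q}\ln\left(\frac{(1+b)^2}{1+b^2}\right),\qquad \beta_q(b)=q\,\alpha_q(b),\qquad \beta_q(\sigma,b)=b\,\mathcal{Z}(2-\sigma)\,(\beta_q(b))^{\sigma-1}. \] Then, for every sufficiently large integer $\mathbf{N}$, there exists a polynomial $P\in\mathcal{P}_{\mathbf{N}}$ such that \[ \ln L(\sigma,\chi_P)\geq(\beta_q(\sigma,b)+o(1))\,\frac{(\log|P|)^{1-\sigma}}{(\log\log|P|)^{\sigma}}. \] Furthermore, for every $\xi$ with $0<\xi<\frac{1}{\alpha_q(b)}$, define \[ \tau_{\xi,\mathbf{N}}:=\beta_q(\sigma,b)\left(1-\xi\alpha_q(b)\right)^{1-\sigma}\mathbf{N}^{1-\sigma}(\log\mathbf{N})^{-\sigma} \] and \[ \Phi_{\mathbf{N}}(\sigma,\xi):=\frac{1}{\#\mathcal{P}_{\mathbf{N}}}\,\#\left\{P\in\mathcal{P}_{\mathbf{N}}:\ \ln L(\sigma,\chi_P)\geq\tau_{\xi,\mathbf{N}}\right\}. \] Then, for sufficiently large $\mathbf{N}$, \[ \Phi_{\mathbf{N}}(\sigma,\xi)\geq |P|^{-\frac12(1-\xi\alpha_q(b))+o(1)}, \] where $|P|=q^{\mathbf{N}}$ is the common norm of all $P\in\mathcal{P}_{\mathbf{N}}$.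
   Context: $\ln$ is the natural logarithm and $\log$ is the logarithm to base $q$ (so $\log|P|=\mathbf{N}$ and $\log\log|P|=\log\mathbf{N}$ for $P\in\mathcal{P}_{\mathbf{N}}$). $\mathbb{F}_q$ is the finite field with $q$ elements ($q$ an odd prime power). $\mathcal{M}$ denotes the set of monic polynomials in $\mathbb{F}_q[t]$, and $\mathcal{P}_n$ the set of monic irreducible polynomials of degree $n$ in $\mathbb{F}_q[t]$. For nonzero $A\in\mathbb{F}_q[t]$, $|A|=q^{\deg A}$. The zeta function is $\mathcal{Z}(s)=\sum_{A\in\mathcal{M}}|A|^{-s}=\frac{1}{1-q^{1-s}}$. For a monic irreducible polynomial $P$, $\chi_P(A)=\left(\frac{A}{P}\right)$ is the quadratic residue symbol: it equals $1$ if $P\nmid A$ and $A$ is a square modulo $P$, $-1$ if $P\nmid A$ and $A$ is not a square modulo $P$, and $0$ if $P\mid A$. The $L$-function is $L(s,\chi_P)=\sum_{A\in\mathcal{M}}\chi_P(A)|A|^{-s}$ for $\Re(s)>1$, extended to all $s\in\mathbb{C}$ by analytic continuation (it is a polynomial in $q^{-s}$); it is real and positive at real $s=\sigma\in(1/2,1)$. The $o(1)$ terms tend to $0$ as $\mathbf{N}\to\infty$ with $q,\sigma,b,\xi$ fixed. *)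

theory Defs
  imports
    "HOL-Complex_Analysis.Complex_Analysis"
    "HOL-Computational_Algebra.Computational_Algebra"
    "HOL-Number_Theory.Cong"
begin

text \<open>
  Throughout, \<open>\<F>\<^sub>q\<close> is a type \<open>'a :: {finite, field}\<close> with \<open>q = CARD('a)\<close>, and
  \<open>\<F>\<^sub>q[t]\<close> is \<open>'a poly\<close>. Quantities that depend on \<open>'a\<close> without having an argument
  that mentions it take an \<open>'a itself\<close> argument.
\<close>

text \<open>Only meant for nonzero \<open>A\<close>; at \<open>0\<close> it has the value \<open>1\<close>, which is never used.\<close>

definition pnorm :: "'a::{finite,field} poly \<Rightarrow> real" where
  "pnorm A = real CARD('a) ^ degree A"

definition monic_irreducibles :: "nat \<Rightarrow> 'a::{finite,field} poly set" where
  "monic_irreducibles n = {P. lead_coeff P = 1 \<and> irreducible P \<and> degree P = n}"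

text \<open>Restricted to real arguments; the series converges for \<open>s > 1\<close>.\<close>

definition zeta_poly :: "'a::{finite,field} itself \<Rightarrow> real \<Rightarrow> real" where
  "zeta_poly _ s = (\<Sum>\<^sub>\<infinity>A\<in>{A::'a poly. lead_coeff A = 1}. pnorm A powr (-s))"

definition quad_char :: "'a::{finite,field} poly \<Rightarrow> 'a poly \<Rightarrow> int" where
  "quad_char P A =
     (if P dvd A then 0
      else if \<exists>B. [B\<^sup>2 = A] (mod P) then 1
      else -1)"

text \<open>
  The entire continuation of the Dirichlet series. It is unique by the identity theorem;
  for odd \<open>q\<close> and monic irreducible \<open>P\<close> it exists, because the sum of \<open>quad_char P A\<close>
  over the monic \<open>A\<close> of degree \<open>n\<close> vanishes for \<open>n \<ge> degree P\<close>, so that the series is a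
  polynomial in \<open>q powr (-s)\<close>.
\<close>

definition quad_L :: "'a::{finite,field} poly \<Rightarrow> complex \<Rightarrow> complex" where
  "quad_L P =
     (THE f. f holomorphic_on UNIV \<and>
        (\<forall>s. Re s > 1 \<longrightarrow>
           f s = (\<Sum>\<^sub>\<infinity>A\<in>{A. lead_coeff A = 1}.
                    of_int (quad_char P A) * of_real (pnorm A) powr (-s))))"

text \<open>At a real point of \<open>(1/2, 1)\<close> the value of \<open>quad_L P\<close> is a positive real number,
  so that taking the real part loses nothing.\<close>

definition ln_quad_L :: "real \<Rightarrow> 'a::{finite,field} poly \<Rightarrow> real" where
  "ln_quad_L \<sigma> P = ln (Re (quad_L P (of_real \<sigma>)))"

definition alpha :: "'a::{finite,field} itself \<Rightarrow> real \<Rightarrow> real" where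
  "alpha T b = 2 * zeta_poly T 2 / ln (real CARD('a)) * ln ((1 + b)\<^sup>2 / (1 + b\<^sup>2))"

definition beta0 :: "'a::{finite,field} itself \<Rightarrow> real \<Rightarrow> real" where
  "beta0 T b = real CARD('a) * alpha T b"

definition beta :: "'a::{finite,field} itself \<Rightarrow> real \<Rightarrow> real \<Rightarrow> real" where
  "beta T \<sigma> b = b * zeta_poly T (2 - \<sigma>) * beta0 T b powr (\<sigma> - 1)"

definition tau :: "'a::{finite,field} itself \<Rightarrow> real \<Rightarrow> real \<Rightarrow> real \<Rightarrow> nat \<Rightarrow> real" where
  "tau T \<sigma> b \<xi> N =
     beta T \<sigma> b * (1 - \<xi> * alpha T b) powr (1 - \<sigma>)
       * real N powr (1 - \<sigma>) * log (real CARD('a)) (real N) powr (-\<sigma>)"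

definition Phi :: "'a::{finite,field} itself \<Rightarrow> real \<Rightarrow> real \<Rightarrow> real \<Rightarrow> nat \<Rightarrow> real" where
  "Phi T \<sigma> b \<xi> N =
     real (card {P \<in> monic_irreducibles N :: 'a poly set. ln_quad_L \<sigma> P \<ge> tau T \<sigma> b \<xi> N})
       / real (card (monic_irreducibles N :: 'a poly set))"

end

theory Submission
  imports
    "HOL-Algebra.Algebraic_Closure_Type"
    "HOL-Number_Theory.Residues"
    "HOL-Real_Asymp.Real_Asymp"
    Defs
begin

text \<open>
  The theorem is proved by the resonance method. Put \<open>c = 2b/(1 + b\<^sup>2)\<close> and weight each prime \<open>P\<close> of degree
  \<open>N\<close> by \<open>W(P) = \<Prod>\<^sub>Q (1 + c \<chi>\<^sub>P(Q))\<close>, where \<open>Q\<close> runs through the primes of degree at most \<open>y\<close> and \<open>y\<close> is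
  the largest integer for which there are at most \<open>Z(2) N (1 - \<xi>\<alpha>)/\<alpha>\<close> of them. The Riemann
  hypothesis for \<open>L(s, \<chi>\<^sub>f)\<close> makes the sums \<open>\<Sum>\<^sub>P \<chi>\<^sub>P(f)\<close> over the primes of degree \<open>N\<close> as small as
  \<open>q\<^bsup>N/2\<^esup>\<close> up to a power of \<open>N\<close> when \<open>f\<close> is squarefree and nonconstant, so that \<open>W\<close> has mean close
  to \<open>1\<close> and \<open>W(P) \<chi>\<^sub>P(Q)\<close> has mean close to \<open>c\<close>. It also gives a truncated formula for
  \<open>ln L(\<sigma>, \<chi>\<^sub>P)\<close> as a sum over primes, and the weighted mean of that sum is about
  \<open>c \<Sum>\<^sub>Q |Q|\<^bsup>-\<sigma>\<^esup>\<close>. As \<open>c > b\<close>, this exceeds \<open>\<tau>\<close> by a constant factor, and since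
  \<open>W \<le> ((1 + b)\<^sup>2/(1 + b\<^sup>2))\<^sup>k\<close> for \<open>k\<close> primes \<open>Q\<close>, many \<open>P\<close> must have a large
  value. For small \<open>\<xi>\<close> the constant factor also absorbs \<open>(1 - \<xi>\<alpha>)\<^bsup>1-\<sigma>\<^esup>\<close>, which gives the first assertion.

  The Riemann hypothesis is proved by Stepanov's method in Bombieri's form: for \<open>Q = q\<^bsup>2m\<^esup>\<close>, the primes
  that divide \<open>x\<^sup>Q - x\<close> and at which \<open>f\<close> has a given character value all divide one explicit polynomial of
  degree \<open>Q/2 + O(\<surd>Q)\<close>.
\<close>

section \<open>Finite fields and quadratic reciprocity\<close>

text \<open>Two obstacles shape the proof. The sums over P have a fixed argument and a varying
  modulus, whereas an L-function controls a fixed modulus; quadratic reciprocity exchanges the two,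
  with a sign that depends on degrees only. Stepanov's count reaches only large even exponents, with
  a weak constant; but this locates the reciprocal roots of the L-polynomial, and their location
  gives a sharp bound for every exponent.

  The constants come from one balance: error terms of size (1 + c)^k q^(N/2), up to powers of N,
  against a main term q^N/N. As 1 + c = (1 + b)^2/(1 + b^2), the bound on k says exactly that (1 +
  c)^k \<le> q^((1/2 - \<delta>)N) with \<delta> = \<xi>\<alpha>/2. The errors keep a factor
  q^(-\<delta>N), half of which pays for a formula for ln L truncated at degree about \<delta>N/2,
  and the same maximal weight q^((1/2 - \<delta>)N) gives the exponent in the bound for \<Phi>. The
  factor q in \<beta>_q(b) = q \<alpha>_q(b) is the price of an integral cutoff y: the number of
  primes of degree at most y may fall short of the allowed k by a factor close to q.\<close>

lemma mult_closed_power_card: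
  fixes K :: "'b::idom set"
  assumes "finite K" "0 \<in> K" "\<And>x y. x \<in> K \<Longrightarrow> y \<in> K \<Longrightarrow> x * y \<in> K" "z \<in> K"
  shows "z ^ card K = z"
proof (cases "z = 0")
  case True
  then show ?thesis using assms by (metis card_gt_0_iff empty_iff zero_power)
next
  case False
  let ?K = "K - {0}"
  have inj: "inj_on ((*) z) ?K" using False by (auto intro: inj_onI)
  have "(*) z ` ?K \<subseteq> ?K" using assms False by auto
  then have im: "(*) z ` ?K = ?K"
    using inj assms(1) by (simp add: endo_inj_surj)
  have "(\<Prod>x\<in>?K. x) = (\<Prod>x\<in>(*) z ` ?K. x)" by (simp add: im)
  also have "\<dots> = (\<Prod>x\<in>?K. z * x)" using inj by (simp add: prod.reindex)
  also have "\<dots> = z ^ card ?K * (\<Prod>x\<in>?K. x)" by (simp add: prod.distrib)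
  finally have "z ^ card ?K = 1" using assms(1) by simp
  then have "z ^ Suc (card ?K) = z" by simp
  moreover have "Suc (card ?K) = card K" using assms(1,2) by (rule card_Suc_Diff1)
  ultimately show ?thesis by simp
qed

lemma finite_field_power_card: "(x::'a::{finite,field}) ^ CARD('a) = x"
  by (rule mult_closed_power_card) auto

lemma card_field_ge2: "CARD('a::{finite,field}) \<ge> 2"
proof -
  have "card {0::'a, 1} \<le> CARD('a)" by (rule card_mono) auto
  then show ?thesis by simp
qed

text \<open>Both sides of the additivity are monic polynomials of degree \<open>q\<close> in one of the
  summands, and they agree on the \<open>q\<close> elements of the image of \<open>\<F>\<^sub>q\<close>, because
  \<open>Z\<^sup>q - Z = \<Prod>\<^sub>a (Z - a)\<close> is invariant under translation by \<open>\<F>\<^sub>q\<close>.\<close>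

lemma frobenius_add:
  fixes \<iota> :: "'a::{finite,field} \<Rightarrow> 'b::idom" and x y :: 'b
  assumes inj: "inj \<iota>" and add: "\<And>x y. \<iota> (x + y) = \<iota> x + \<iota> y"
    and mult: "\<And>x y. \<iota> (x * y) = \<iota> x * \<iota> y" and one: "\<iota> 1 = 1"
  shows "(x + y) ^ CARD('a) = x ^ CARD('a) + y ^ CARD('a)"
proof -
  let ?q = "CARD('a)"
  have q: "?q \<ge> 2" by (rule card_field_ge2)
  have pow: "\<iota> (a ^ n) = \<iota> a ^ n" for a n by (induction n) (auto simp: mult one)
  have fixed: "\<iota> a ^ ?q = \<iota> a" for a
    by (metis pow finite_field_power_card)
  have diff: "\<iota> (a - b) = \<iota> a - \<iota> b" for a b
    by (metis add diff_add_cancel add_diff_cancel)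
  have card: "card (range \<iota>) = ?q" using inj by (simp add: card_image)
  have "monom 1 ?q - monom 1 1 = (\<Prod>a\<in>UNIV. [:- \<iota> a, 1:])" (is "?F = ?G")
  proof (rule poly_eqI_degree_lead_coeff[where A = "range \<iota>" and n = ?q])
    show "poly ?F x = poly ?G x" if x: "x \<in> range \<iota>" for x
    proof -
      obtain a where a: "x = \<iota> a" using x by auto
      have "poly ?G x = (\<Prod>a\<in>UNIV. x - \<iota> a)" by (simp add: poly_prod)
      also have "\<dots> = 0" by (rule prod_zero) (use a in auto)
      finally show ?thesis using a fixed by (simp add: poly_monom)
    qed
    show "degree ?F \<le> ?q" using q by (intro degree_diff_le) (auto simp: degree_monom_le degree_monom_eq)
    have "degree ?G = ?q" by (subst degree_prod_eq_sum_degree) auto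
    then show "degree ?G \<le> ?q" by simp
    have "lead_coeff ?G = 1" by (simp add: lead_coeff_prod)
    then show "coeff ?F ?q = coeff ?G ?q" using q \<open>degree ?G = ?q\<close> by simp
  qed (simp add: card)
  then have F: "z ^ ?q - z = (\<Prod>a\<in>UNIV. z - \<iota> a)" for z
  proof -
    assume "?F = ?G"
    then have "poly ?F z = poly ?G z" by simp
    then show ?thesis by (simp add: poly_prod poly_monom)
  qed
  have shift: "(\<iota> a + y) ^ ?q = \<iota> a + y ^ ?q" for a
  proof -
    have "(\<iota> a + y) ^ ?q - (\<iota> a + y) = (\<Prod>c\<in>UNIV. \<iota> a + y - \<iota> c)" by (rule F)
    also have "\<dots> = (\<Prod>c\<in>UNIV. y - \<iota> (c - a))" by (simp add: diff algebra_simps)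
    also have "\<dots> = (\<Prod>c\<in>UNIV. y - \<iota> c)"
      by (rule prod.reindex_bij_witness[of _ "\<lambda>c. c + a" "\<lambda>c. c - a"]) auto
    also have "\<dots> = y ^ ?q - y" by (simp add: F)
    finally show ?thesis by (simp add: algebra_simps)
  qed
  have "[:y, 1:] ^ ?q = monom 1 ?q + [:y ^ ?q:]" (is "?A = ?B")
  proof (rule poly_eqI_degree_lead_coeff[where A = "range \<iota>" and n = ?q])
    show "poly ?A x = poly ?B x" if x: "x \<in> range \<iota>" for x
      using x shift fixed by (auto simp: poly_monom algebra_simps)
    have dA: "degree ?A = ?q" by (simp add: degree_power_eq)
    then show "degree ?A \<le> ?q" by simp
    show "degree ?B \<le> ?q" by (intro degree_add_le) (auto simp: degree_monom_le)
    have "lead_coeff ?A = 1" by (simp add: lead_coeff_power)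
    then show "coeff ?A ?q = coeff ?B ?q" using q dA by (simp add: coeff_pCons split: nat.split)
  qed (simp add: card)
  then have "poly ?A x = poly ?B x" by simp
  then show ?thesis by (simp add: poly_monom algebra_simps)
qed

lemma frobenius_sum:
  fixes \<iota> :: "'a::{finite,field} \<Rightarrow> 'b::idom" and f :: "'c \<Rightarrow> 'b"
  assumes "inj \<iota>" "\<And>x y. \<iota> (x + y) = \<iota> x + \<iota> y" "\<And>x y. \<iota> (x * y) = \<iota> x * \<iota> y" "\<iota> 1 = 1"
  shows "(\<Sum>i\<in>I. f i) ^ CARD('a) = (\<Sum>i\<in>I. f i ^ CARD('a))"
proof (induction I rule: infinite_finite_induct)
  case (insert i I)
  then show ?case by (simp add: frobenius_add[OF assms])
qed (use card_field_ge2[where 'a='a] in \<open>auto simp: power_0_left simp del: zero_less_card_finite\<close>)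

text \<open>The q-th power is additive and fixes the coefficients, so it acts on the variable alone.
  Iterated, this makes f^M a polynomial in x^M, on which the nonvanishing in Stepanov's method
  rests.\<close>

lemma poly_power_card:
  fixes f :: "'a::{finite,field} poly"
  shows "f ^ CARD('a) = pcompose f (monom 1 CARD('a))"
proof -
  have "f ^ CARD('a) = (\<Sum>i\<le>degree f. monom (coeff f i) i) ^ CARD('a)"
    by (simp add: poly_as_sum_of_monoms)
  also have "\<dots> = (\<Sum>i\<le>degree f. monom (coeff f i) i ^ CARD('a))"
    by (rule frobenius_sum[where \<iota> = "\<lambda>c. [:c:]"]) (auto intro: injI)
  also have "\<dots> = (\<Sum>i\<le>degree f. monom (coeff f i) (i * CARD('a)))"
    by (simp add: monom_power finite_field_power_card mult.commute)
  also have "\<dots> = (\<Sum>i\<le>degree f. smult (coeff f i) (monom 1 CARD('a) ^ i))"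
    by (simp add: monom_power smult_monom mult.commute)
  also have "\<dots> = pcompose f (monom 1 CARD('a))"
    by (simp add: pcompose_altdef poly_altdef  degree_map_poly coeff_map_poly)
  finally show ?thesis .
qed

lemma poly_power_card_power:
  fixes f :: "'a::{finite,field} poly"
  shows "f ^ (CARD('a) ^ m) = pcompose f (monom 1 (CARD('a) ^ m))"
proof (induction m)
  case (Suc m)
  have "f ^ (CARD('a) ^ Suc m) = (f ^ (CARD('a) ^ m)) ^ CARD('a)"
    by (simp add: power_mult[symmetric] mult.commute)
  also have "\<dots> = pcompose (f ^ (CARD('a) ^ m)) (monom 1 CARD('a))" by (rule poly_power_card)
  also have "\<dots> = pcompose f (pcompose (monom 1 (CARD('a) ^ m)) (monom 1 CARD('a)))"
    by (simp add: Suc pcompose_assoc)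
  also have "pcompose (monom 1 (CARD('a) ^ m)) (monom 1 CARD('a)) = (monom 1 (CARD('a) ^ Suc m) :: 'a poly)"
    by (metis poly_power_card monom_power power_one mult.commute power_Suc)
  finally show ?case .
qed (simp add: monom_altdef)

lemma two_neq_0:
  assumes "odd CARD('a::{finite,field})"
  shows "(2::'a) \<noteq> 0"
proof
  assume "(2::'a) = 0"
  then have "of_nat 2 = (0::'a)" by simp
  then have "CHAR('a) dvd 2" by (simp only: of_nat_eq_0_iff_char_dvd)
  moreover have "CHAR('a) \<noteq> 1" by simp
  ultimately have "CHAR('a) = 2" using prime_nat_iff[of 2] by auto
  then show False using CHAR_dvd_CARD[where 'a='a] assms by simp
qed

text \<open>The count is by sets of exponents because Stepanov's method restricts the base-M digits
  of exponents and not only degrees.\<close>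

lemma card_poly_support:
  assumes "finite I"
  shows "finite {p::'a::{finite,field} poly. \<forall>k. k \<notin> I \<longrightarrow> coeff p k = 0}"
    and "card {p::'a poly. \<forall>k. k \<notin> I \<longrightarrow> coeff p k = 0} = CARD('a) ^ card I"
proof -
  have "finite {p::'a poly. \<forall>k. k \<notin> I \<longrightarrow> coeff p k = 0} \<and>
    card {p::'a poly. \<forall>k. k \<notin> I \<longrightarrow> coeff p k = 0} = CARD('a) ^ card I"
    using assms
  proof (induction I)
    case empty
    have "{p::'a poly. \<forall>k. k \<notin> {} \<longrightarrow> coeff p k = 0} = {0}" by (auto intro: poly_eqI)
    then show ?case by simp
  next
    case (insert i I)
    let ?V = "\<lambda>I. {p::'a poly. \<forall>k. k \<notin> I \<longrightarrow> coeff p k = 0}"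
    have "bij_betw (\<lambda>(c, p). monom c i + p) (UNIV \<times> ?V I) (?V (insert i I))"
      by (rule bij_betw_byWitness[where f' = "\<lambda>p. (coeff p i, p - monom (coeff p i) i)"])
         (use insert in \<open>auto simp: poly_eq_iff\<close>)
    from bij_betw_finite[OF this] bij_betw_same_card[OF this] insert show ?case
      by (auto simp: card_cartesian_product finite_cartesian_product)
  qed
  then show "finite {p::'a poly. \<forall>k. k \<notin> I \<longrightarrow> coeff p k = 0}"
    and "card {p::'a poly. \<forall>k. k \<notin> I \<longrightarrow> coeff p k = 0} = CARD('a) ^ card I" by auto
qed

lemma card_poly_degree_less:
  assumes "d > 0"
  shows "finite {p::'a::{finite,field} poly. degree p < d}"
    and "card {p::'a poly. degree p < d} = CARD('a) ^ d"
proof -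
  have eq: "{p::'a poly. degree p < d} = {p. \<forall>k. k \<notin> {..<d} \<longrightarrow> coeff p k = 0}"
  proof (intro equalityI subsetI CollectI)
    fix p :: "'a poly" assume "p \<in> {p. \<forall>k. k \<notin> {..<d} \<longrightarrow> coeff p k = 0}"
    then show "degree p < d" using assms by (auto intro!: degree_lessI)
  qed (auto intro: coeff_eq_0)
  show "finite {p::'a poly. degree p < d}" "card {p::'a poly. degree p < d} = CARD('a) ^ d"
    unfolding eq using card_poly_support[of "{..<d}", where 'a='a] by auto
qed

section \<open>Residue fields inside the algebraic closure\<close>

definition ac_eval :: "'a::field alg_closure \<Rightarrow> 'a poly \<Rightarrow> 'a alg_closure" where
  "ac_eval \<theta> A = poly (map_poly to_ac A) \<theta>"

lemma map_poly_to_ac_mult: "map_poly to_ac (A * B) = map_poly to_ac A * map_poly to_ac B"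
  by (rule poly_eqI) (simp add: coeff_map_poly coeff_mult to_ac_sum)

lemma map_poly_to_ac_add: "map_poly to_ac (A + B) = map_poly to_ac A + map_poly to_ac B"
  by (rule poly_eqI) (simp add: coeff_map_poly)

lemma map_poly_to_ac_diff: "map_poly to_ac (A - B) = map_poly to_ac A - map_poly to_ac B"
  by (rule poly_eqI) (simp add: coeff_map_poly)

lemma ac_eval_mult [simp]: "ac_eval \<theta> (A * B) = ac_eval \<theta> A * ac_eval \<theta> B"
  by (simp add: ac_eval_def map_poly_to_ac_mult)

lemma ac_eval_add [simp]: "ac_eval \<theta> (A + B) = ac_eval \<theta> A + ac_eval \<theta> B"
  by (simp add: ac_eval_def map_poly_to_ac_add)

lemma ac_eval_diff [simp]: "ac_eval \<theta> (A - B) = ac_eval \<theta> A - ac_eval \<theta> B"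
  by (simp add: ac_eval_def map_poly_to_ac_diff)

lemma ac_eval_const [simp]: "ac_eval \<theta> [:c:] = to_ac c"
  by (simp add: ac_eval_def map_poly_pCons)

lemma ac_eval_0 [simp]: "ac_eval \<theta> 0 = 0"
  by (simp add: ac_eval_def)

lemma ac_eval_1 [simp]: "ac_eval \<theta> 1 = 1"
  using ac_eval_const[of \<theta> 1] by (simp add: one_pCons)

lemma ac_eval_power [simp]: "ac_eval \<theta> (A ^ n) = ac_eval \<theta> A ^ n"
  by (induction n) auto

lemma ac_eval_X [simp]: "ac_eval \<theta> (monom 1 n) = \<theta> ^ n"
  by (simp add: ac_eval_def map_poly_monom poly_monom)

text \<open>The polynomials that vanish at \<theta> are the multiples of one of least degree,
  \<open>B\<close>. It divides the irreducible \<open>P\<close> and is no unit, so it is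
  \<open>P\<close> up to a unit.\<close>

lemma ac_eval_eq_0_iff:
  assumes P: "irreducible P" and root: "ac_eval \<theta> P = 0"
  shows "ac_eval \<theta> A = 0 \<longleftrightarrow> P dvd A"
proof
  assume A: "ac_eval \<theta> A = 0"
  have P0: "P \<noteq> 0" using P by (auto simp: irreducible_def)
  define B where "B = (ARG_MIN degree B. B \<noteq> 0 \<and> ac_eval \<theta> B = 0)"
  have B: "B \<noteq> 0 \<and> ac_eval \<theta> B = 0"
    unfolding B_def by (rule arg_min_natI[where k = P]) (use P0 root in auto)
  have min: "degree B \<le> degree C" if "C \<noteq> 0" "ac_eval \<theta> C = 0" for C
    unfolding B_def by (rule arg_min_nat_le) (use that in auto)
  have dvd: "B dvd C" if C: "ac_eval \<theta> C = 0" for C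
  proof -
    have "ac_eval \<theta> (C mod B) = ac_eval \<theta> (C - C div B * B)" by (simp add: minus_div_mult_eq_mod)
    also have "\<dots> = 0" using B C by simp
    finally have "ac_eval \<theta> (C mod B) = 0" .
    then have "C mod B = 0" using min[of "C mod B"] degree_mod_less[of B C] B by force
    then show ?thesis by auto
  qed
  from dvd[OF root] obtain C where C: "P = B * C" by auto
  have "\<not> is_unit B"
  proof
    assume "is_unit B"
    then obtain c where "B = [:c:]" "c \<noteq> 0"
      by (metis B is_unit_polyE pCons_0_0 degree_0)
    then show False using B by simp
  qed
  then have "is_unit C" using P C by (metis irreducibleD)
  then have "P dvd B" using C by simp
  then show "P dvd A" using dvd[OF A] by (rule dvd_trans)
next
  assume "P dvd A"
  then show "ac_eval \<theta> A = 0" using root by auto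
qed

text \<open>A residue modulo \<open>P\<close> is represented by its value at this root. The residue
  fields of all primes thus lie in one field, where roots of different primes can be subtracted, as
  reciprocity requires.\<close>

definition poly_root :: "'a::field poly \<Rightarrow> 'a alg_closure" where
  "poly_root P = (SOME \<theta>. ac_eval \<theta> P = 0)"

lemma irreducible_degree_pos: "irreducible (P::'a::field poly) \<Longrightarrow> degree P > 0"
  by (metis bot_nat_0.not_eq_extremum irreducible_def is_unit_iff_degree)

lemma ac_eval_poly_root:
  assumes "irreducible P"
  shows "ac_eval (poly_root P) P = 0"
proof -
  have "degree (map_poly to_ac P) > 0"
    using irreducible_degree_pos[OF assms] by (simp add: degree_map_poly)
  from alg_closed_imp_poly_has_root[OF this] have "\<exists>\<theta>. ac_eval \<theta> P = 0"
    by (simp add: ac_eval_def)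
  then show ?thesis unfolding poly_root_def by (rule someI_ex)
qed

lemma ac_eval_poly_root_iff: "irreducible P \<Longrightarrow> ac_eval (poly_root P) A = 0 \<longleftrightarrow> P dvd A"
  by (rule ac_eval_eq_0_iff[OF _ ac_eval_poly_root])

lemma ac_eval_poly_root_eq_iff:
  "irreducible P \<Longrightarrow> ac_eval (poly_root P) A = ac_eval (poly_root P) B \<longleftrightarrow> P dvd A - B"
  using ac_eval_poly_root_iff[of P "A - B"] by simp

lemma card_range_ac_eval:
  fixes P :: "'a::{finite,field} poly"
  assumes P: "irreducible P"
  shows "finite (range (ac_eval (poly_root P)))"
    and "card (range (ac_eval (poly_root P))) = CARD('a) ^ degree P"
proof -
  let ?ev = "ac_eval (poly_root P)"
  have d: "degree P > 0" using P by (rule irreducible_degree_pos)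
  have "range ?ev = ?ev ` {A. degree A < degree P}"
  proof (intro equalityI subsetI)
    fix z assume "z \<in> range ?ev"
    then obtain A where A: "z = ?ev A" by auto
    have "?ev A = ?ev (A mod P)"
      using P by (subst ac_eval_poly_root_eq_iff) (auto simp: minus_mod_eq_div_mult)
    moreover have "degree (A mod P) < degree P" using d degree_mod_less[of P A] by force
    ultimately show "z \<in> ?ev ` {A. degree A < degree P}" using A by auto
  qed auto
  moreover have "inj_on ?ev {A. degree A < degree P}"
  proof (rule inj_onI)
    fix A B assume AB: "A \<in> {A. degree A < degree P}" "B \<in> {A. degree A < degree P}" "?ev A = ?ev B"
    then have "P dvd A - B" using P by (simp add: ac_eval_poly_root_eq_iff)
    moreover have "degree (A - B) < degree P" using AB by (auto intro: degree_diff_less)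
    ultimately show "A = B" using dvd_imp_degree_le[of P "A - B"] by force
  qed
  ultimately show "finite (range ?ev)" "card (range ?ev) = CARD('a) ^ degree P"
    using card_poly_degree_less[OF d, where 'a='a] by (auto simp: card_image)
qed

lemma ac_eval_power_card:
  fixes P :: "'a::{finite,field} poly"
  assumes P: "irreducible P"
  shows "ac_eval (poly_root P) A ^ (CARD('a) ^ degree P) = ac_eval (poly_root P) A"
  unfolding card_range_ac_eval(2)[OF P, symmetric]
proof (rule mult_closed_power_card)
  show "0 \<in> range (ac_eval (poly_root P))" by (metis ac_eval_0 rangeI)
  fix x y assume "x \<in> range (ac_eval (poly_root P))" "y \<in> range (ac_eval (poly_root P))"
  then show "x * y \<in> range (ac_eval (poly_root P))" by (auto simp flip: ac_eval_mult)
qed (use card_range_ac_eval[OF P] in auto)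

lemma power_card_fixed_bound:
  assumes "n > 1"
  shows "finite {z::'b::idom. z ^ n = z}" "card {z::'b. z ^ n = z} \<le> n"
proof -
  let ?p = "monom 1 n - monom 1 1 :: 'b poly"
  have "coeff ?p n = 1" using assms by simp
  then have "?p \<noteq> 0" by (metis coeff_0 zero_neq_one)
  moreover have "{z::'b. z ^ n = z} = {z. poly ?p z = 0}" by (simp add: poly_monom)
  moreover have "degree ?p \<le> n" using assms by (intro degree_diff_le) (auto simp: degree_monom_eq)
  ultimately show "finite {z::'b. z ^ n = z}" "card {z::'b. z ^ n = z} \<le> n"
    using poly_roots_finite[of ?p] card_poly_roots_bound[of ?p] by auto
qed

text \<open>The residues supply q^d solutions of z^(q^d) = z, where d = deg P, and the equation has
  no more. This recognises which elements of the closure are residues.\<close>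

lemma range_ac_eval:
  fixes P :: "'a::{finite,field} poly"
  assumes P: "irreducible P"
  shows "range (ac_eval (poly_root P)) = {z. z ^ (CARD('a) ^ degree P) = z}"
proof (rule card_seteq)
  have gt: "CARD('a) ^ degree P > 1"
    using card_field_ge2[where 'a='a] irreducible_degree_pos[OF P] by (intro one_less_power) auto
  show "finite {z::'a alg_closure. z ^ (CARD('a) ^ degree P) = z}"
    by (rule power_card_fixed_bound[OF gt])
  show "range (ac_eval (poly_root P)) \<subseteq> {z. z ^ (CARD('a) ^ degree P) = z}"
    using ac_eval_power_card[OF P] by auto
  show "card {z::'a alg_closure. z ^ (CARD('a) ^ degree P) = z} \<le> card (range (ac_eval (poly_root P)))"
    unfolding card_range_ac_eval(2)[OF P] by (rule power_card_fixed_bound[OF gt])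
qed

section \<open>The quadratic character\<close>

lemma odd_card_power_half:
  assumes "odd q" "q > (1::nat)" "d > 0"
  shows "2 * ((q ^ d - 1) div 2) = q ^ d - 1" "(q ^ d - 1) div 2 > 0"
    "(q ^ d - 1) div 2 = (q - 1) div 2 * (\<Sum>i<d. q ^ i)"
proof -
  have "even (q ^ d - 1)" using assms by simp
  then show *: "2 * ((q ^ d - 1) div 2) = q ^ d - 1" by simp
  have "q ^ d > 1" using assms by (intro one_less_power) auto
  then show "(q ^ d - 1) div 2 > 0" using * by linarith
  \<comment> \<open>The geometric sum is the exponent of the norm from the field with q^d elements
    to the field with q; it will turn Euler's criterion into a product over conjugates.\<close>
  have "(q - 1) * (\<Sum>i<d. q ^ i) + 1 = q ^ d"
  proof (induction d)
    case (Suc d)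
    have "(q - 1) * (\<Sum>i<Suc d. q ^ i) + 1 = (q - 1) * q ^ d + q ^ d"
      using Suc by (simp add: distrib_left)
    also have "\<dots> = q ^ Suc d" using assms by (simp add: diff_mult_distrib)
    finally show ?case .
  qed simp
  then have "(q - 1) * (\<Sum>i<d. q ^ i) = q ^ d - 1" by simp
  moreover have "even (q - 1)" using assms by simp
  ultimately show "(q ^ d - 1) div 2 = (q - 1) div 2 * (\<Sum>i<d. q ^ i)"
    by (metis dvd_div_mult)
qed

text \<open>Euler's criterion is an identity in the algebraic closure; in characteristic other than
  2 the three symbol values stay distinct there, so identities can be carried back to the
  integers.\<close>

lemma of_int_eq_zero_one_minus_one:
  assumes "(2::'b::idom) \<noteq> 0" "a \<in> {-1, 0, 1}" "b \<in> {-1, 0, 1}" "of_int a = (of_int b :: 'b)"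
  shows "a = b"
proof -
  have "(1::'b) \<noteq> -1" using assms(1) by (simp add: eq_neg_iff_add_eq_0)
  then have "(-1::'b) \<noteq> 1" by metis
  then show ?thesis using assms \<open>1 \<noteq> -1\<close> by (elim insertE) simp_all
qed

lemma quad_char_range: "quad_char P A \<in> {-1, 0, 1}"
  by (simp add: quad_char_def)

lemma quad_char_eq_0_iff: "quad_char P A = 0 \<longleftrightarrow> P dvd A"
  by (simp add: quad_char_def)

lemma quad_char_cong:
  assumes "P dvd A - B"
  shows "quad_char P A = quad_char P B"
proof -
  have AB: "[A = B] (mod P)" using assms by (simp add: cong_iff_dvd_diff)
  then show ?thesis unfolding quad_char_def
    using cong_dvd_iff[OF AB] cong_trans[OF _ AB] cong_trans[OF _ cong_sym[OF AB]] by auto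
qed

context
  fixes P :: "'a::{finite,field} poly"
  assumes odd: "odd CARD('a)" and P: "irreducible P"
begin

text \<open>The power of a nonzero residue is 1 or -1. If it is 1, a square root \<open>s\<close>
  taken in the closure satisfies s^Q = s and is therefore itself a residue.\<close>

lemma euler_criterion:
  "of_int (quad_char P A) = ac_eval (poly_root P) A ^ ((CARD('a) ^ degree P - 1) div 2)"
proof -
  let ?Q = "CARD('a) ^ degree P" and ?ev = "ac_eval (poly_root P)"
  let ?z = "?ev A" and ?h = "(CARD('a) ^ degree P - 1) div 2"
  have q: "CARD('a) > 1" using card_field_ge2[where 'a='a] by simp
  have h: "2 * ?h = ?Q - 1" "?h > 0"
    using odd_card_power_half[OF odd q irreducible_degree_pos[OF P]] by auto
  have Q: "?Q = Suc (2 * ?h)" using h by simp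
  have one: "w ^ (2 * ?h) = 1" if "w ^ ?Q = w" "w \<noteq> 0" for w :: "'a alg_closure"
  proof -
    have "w * w ^ (2 * ?h) = w * 1" using that Q by (metis mult.right_neutral power_Suc)
    then show ?thesis using that by (simp only: mult_cancel_left) auto
  qed
  show ?thesis
  proof (cases "P dvd A")
    case True
    then show ?thesis using P h by (simp add: quad_char_def ac_eval_poly_root_iff zero_power)
  next
    case False
    then have z: "?z \<noteq> 0" using P by (simp add: ac_eval_poly_root_iff)
    have "?z ^ (2 * ?h) = 1" by (rule one) (use ac_eval_power_card[OF P] z in auto)
    then have "(?z ^ ?h)\<^sup>2 = 1" by (simp add: power_mult[symmetric] mult.commute)
    then have pm: "?z ^ ?h = 1 \<or> ?z ^ ?h = -1" by (simp add: power2_eq_1_iff)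
    have "(\<exists>B. [B\<^sup>2 = A] (mod P)) \<longleftrightarrow> ?z ^ ?h = 1"
    proof
      assume "\<exists>B. [B\<^sup>2 = A] (mod P)"
      then obtain B where "P dvd B\<^sup>2 - A" by (auto simp: cong_iff_dvd_diff)
      then have B: "?ev B ^ 2 = ?z" using P by (metis ac_eval_poly_root_eq_iff ac_eval_power)
      then have "?ev B \<noteq> 0" using z by auto
      then have "?ev B ^ (2 * ?h) = 1" by (intro one) (use ac_eval_power_card[OF P] in auto)
      then show "?z ^ ?h = 1" using B by (simp add: power_mult)
    next
      assume zh: "?z ^ ?h = 1"
      obtain s where s: "s ^ 2 = ?z" using nth_root_exists[of 2 ?z] by auto
      have "s ^ ?Q = s * (s ^ 2) ^ ?h" by (subst Q) (simp add: power_mult)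
      then have "s ^ ?Q = s" using s zh by simp
      then have "s \<in> range ?ev" using range_ac_eval[OF P] by simp
      then obtain B where "s = ?ev B" by auto
      then have "?ev (B\<^sup>2) = ?ev A" using s by simp
      then have "P dvd B\<^sup>2 - A" using P by (simp only: ac_eval_poly_root_eq_iff)
      then show "\<exists>B. [B\<^sup>2 = A] (mod P)" by (auto simp: cong_iff_dvd_diff)
    qed
    then show ?thesis using False pm by (auto simp: quad_char_def)
  qed
qed

lemma quad_char_mult: "quad_char P (A * B) = quad_char P A * quad_char P B"
proof (rule of_int_eq_zero_one_minus_one)
  have "to_ac (2::'a) \<noteq> 0" using two_neq_0[OF odd] by (simp only: to_ac_eq_0_iff) simp
  then show "(2::'a alg_closure) \<noteq> 0" by simp
  show "(of_int (quad_char P (A * B)) :: 'a alg_closure) = of_int (quad_char P A * quad_char P B)"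
    by (simp add: euler_criterion power_mult_distrib)
  show "quad_char P A * quad_char P B \<in> {-1, 0, 1}"
    using quad_char_range[of P A] quad_char_range[of P B] by auto
qed (rule quad_char_range)

lemma quad_char_1 [simp]: "quad_char P 1 = 1"
proof -
  have "\<exists>B. [B\<^sup>2 = 1] (mod P)" by (rule exI[of _ 1]) simp
  moreover have "\<not> P dvd 1" using P by (simp add: irreducible_def)
  ultimately show ?thesis by (simp add: quad_char_def)
qed

lemma quad_char_prod: "quad_char P (\<Prod>x\<in>I. f x) = (\<Prod>x\<in>I. quad_char P (f x))"
  by (induction I rule: infinite_finite_induct) (auto simp: quad_char_mult)

end

lemma dvd_X_power_card_minus_X:
  fixes P :: "'a::{finite,field} poly"
  assumes "irreducible P" "degree P dvd n"
  shows "P dvd monom 1 (CARD('a) ^ n) - monom 1 1"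
proof -
  let ?t = "poly_root P" and ?Q = "CARD('a) ^ degree P"
  have t: "?t ^ ?Q = ?t"
    using ac_eval_power_card[OF assms(1), of "monom 1 1"] by (simp add: ac_eval_X)
  obtain k where k: "n = degree P * k" using assms(2) by auto
  have "?t ^ (?Q ^ k) = ?t"
  proof (induction k)
    case (Suc k)
    have "?t ^ (?Q ^ Suc k) = (?t ^ ?Q) ^ (?Q ^ k)" by (simp add: power_mult[symmetric])
    then show ?case using Suc t by simp
  qed simp
  then show ?thesis using assms(1) k by (simp add: ac_eval_X power_mult flip: ac_eval_poly_root_eq_iff)
qed

section \<open>Conjugate roots and quadratic reciprocity\<close>

lemma ac_eval_power_conj:
  fixes A :: "'a::{finite,field} poly"
  shows "ac_eval \<theta> A ^ (CARD('a) ^ i) = ac_eval (\<theta> ^ (CARD('a) ^ i)) A"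
proof -
  have "ac_eval \<theta> A ^ (CARD('a) ^ i) = ac_eval \<theta> (pcompose A (monom 1 (CARD('a) ^ i)))"
    by (simp flip: ac_eval_power poly_power_card_power)
  also have "\<dots> = ac_eval (\<theta> ^ (CARD('a) ^ i)) A"
    by (induction A) (simp_all add: pcompose_pCons ac_eval_def map_poly_to_ac_mult map_poly_to_ac_add
      map_poly_pCons poly_monom map_poly_monom)
  finally show ?thesis .
qed

text \<open>If two conjugates coincided, the root would be fixed by the q^k-th power for some k <
  deg P, and with it all q^(deg P) residues, which are too many solutions of z^(q^k) = z.\<close>

lemma conjugates_inj:
  fixes P :: "'a::{finite,field} poly"
  assumes P: "irreducible P"
  shows "inj_on (\<lambda>i. poly_root P ^ (CARD('a) ^ i)) {..<degree P}"
proof -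
  let ?t = "poly_root P" and ?q = "CARD('a)" and ?d = "degree P"
  have False if ij: "i < j" "j < ?d" "?t ^ (?q ^ i) = ?t ^ (?q ^ j)" for i j
  proof -
    \<comment> \<open>Raising both sides to the power q^(d - j) turns the right one into the root
      itself.\<close>
    define k where "k = ?d - j + i"
    have k: "0 < k" "k < ?d" using ij by (auto simp: k_def)
    have td: "?t ^ (?q ^ ?d) = ?t"
      using ac_eval_power_card[OF P, of "monom 1 1"] by (simp add: ac_eval_X)
    have "(?t ^ (?q ^ j)) ^ (?q ^ (?d - j)) = ?t ^ (?q ^ ?d)"
      using ij by (simp add: power_mult[symmetric] power_add[symmetric])
    moreover have "(?t ^ (?q ^ i)) ^ (?q ^ (?d - j)) = ?t ^ (?q ^ k)"
      by (simp add: power_mult[symmetric] power_add[symmetric] k_def add.commute)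
    ultimately have tk: "?t ^ (?q ^ k) = ?t" using ij(3) td by simp
    have "range (ac_eval ?t) \<subseteq> {z. z ^ (?q ^ k) = z}"
      using ac_eval_power_conj[of ?t _ k] tk by auto
    moreover have gt: "?q ^ k > 1" using card_field_ge2[where 'a='a] k by (intro one_less_power) auto
    ultimately have "card (range (ac_eval ?t)) \<le> card {z::'a alg_closure. z ^ (?q ^ k) = z}"
      by (intro card_mono power_card_fixed_bound)
    also have "\<dots> \<le> ?q ^ k" by (rule power_card_fixed_bound(2)[OF gt])
    finally have "?q ^ ?d \<le> ?q ^ k" unfolding card_range_ac_eval(2)[OF P] .
    then show False using k card_field_ge2[where 'a='a] by (simp add: power_increasing_iff)
  qed
  then show ?thesis by (intro linorder_inj_onI) auto
qed

lemma irreducible_splits: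
  fixes P :: "'a::{finite,field} poly"
  assumes P: "irreducible P" and monic: "lead_coeff P = 1"
  shows "map_poly to_ac P = (\<Prod>i<degree P. [:- (poly_root P ^ (CARD('a) ^ i)), 1:])" (is "?L = ?R")
proof (rule poly_eqI_degree_lead_coeff[where n = "degree P" and A = "(\<lambda>i. poly_root P ^ (CARD('a) ^ i)) ` {..<degree P}"])
  show "degree P \<le> card ((\<lambda>i. poly_root P ^ (CARD('a) ^ i)) ` {..<degree P})"
    using conjugates_inj[OF P] by (simp add: card_image)
  show "degree ?L \<le> degree P" by (simp add: degree_map_poly)
  have dR: "degree ?R = degree P" by (subst degree_prod_eq_sum_degree) auto
  then show "degree ?R \<le> degree P" by simp
  have "lead_coeff ?R = 1" by (simp add: lead_coeff_prod)
  then show "coeff ?L (degree P) = coeff ?R (degree P)"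
    using dR monic by (simp add: coeff_map_poly)
  fix x assume "x \<in> (\<lambda>i. poly_root P ^ (CARD('a) ^ i)) ` {..<degree P}"
  then obtain i where i: "i < degree P" "x = poly_root P ^ (CARD('a) ^ i)" by auto
  have "poly ?L x = ac_eval (poly_root P) P ^ (CARD('a) ^ i)"
    by (simp add: ac_eval_power_conj i(2)) (simp add: ac_eval_def)
  then have "poly ?L x = 0" using ac_eval_poly_root[OF P] by simp
  moreover have "poly ?R x = 0" using i by (auto simp: poly_prod)
  ultimately show "poly ?L x = poly ?R x" by simp
qed

text \<open>Each symbol is the (q - 1)/2-th power of a resultant, the product of all differences
  between a root of one prime and a root of the other. Exchanging the primes negates each of the deg
  P deg R factors.\<close>

theorem quadratic_reciprocity_poly:
  fixes P R :: "'a::{finite,field} poly"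
  assumes odd: "odd CARD('a)"
    and P: "irreducible P" "lead_coeff P = 1" and R: "irreducible R" "lead_coeff R = 1"
  shows "quad_char P R = (-1) ^ ((CARD('a) - 1) div 2 * degree P * degree R) * quad_char R P"
proof (rule of_int_eq_zero_one_minus_one)
  have "to_ac (2::'a) \<noteq> 0" using two_neq_0[OF odd] by (simp only: to_ac_eq_0_iff) simp
  then show "(2::'a alg_closure) \<noteq> 0" by simp
  show "quad_char P R \<in> {-1, 0, 1}" by (rule quad_char_range)
  show "(-1) ^ ((CARD('a) - 1) div 2 * degree P * degree R) * quad_char R P \<in> {-1, 0, 1}"
    using quad_char_range[of R P] by (auto simp: minus_one_power_iff)
  let ?h = "(CARD('a) - 1) div 2" and ?q = "CARD('a)"
  have q: "?q > 1" using card_field_ge2[where 'a='a] by simp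
  let ?t = "\<lambda>P i. poly_root P ^ (?q ^ i) :: 'a alg_closure"
  have main: "of_int (quad_char P R) = (\<Prod>i<degree P. \<Prod>j<degree R. ?t P i - ?t R j) ^ ?h"
    if P: "irreducible P" "lead_coeff P = 1" and R: "irreducible R" "lead_coeff R = 1"
    for P R :: "'a poly"
  proof -
    let ?z = "ac_eval (poly_root P) R"
    have "of_int (quad_char P R) = ?z ^ (?h * (\<Sum>i<degree P. ?q ^ i))"
      using euler_criterion[OF odd P(1)] odd_card_power_half(3)[OF odd q irreducible_degree_pos[OF P(1)]]
      by simp
    also have "\<dots> = (\<Prod>i<degree P. ?z ^ (?q ^ i)) ^ ?h"
      by (simp add: power_sum power_mult mult.commute)
    also have "(\<Prod>i<degree P. ?z ^ (?q ^ i)) = (\<Prod>i<degree P. \<Prod>j<degree R. ?t P i - ?t R j)"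
      by (simp add: ac_eval_power_conj) (simp add: ac_eval_def irreducible_splits[OF R] poly_prod)
    finally show ?thesis .
  qed
  have "(\<Prod>i<degree P. \<Prod>j<degree R. ?t P i - ?t R j) = (\<Prod>j<degree R. \<Prod>i<degree P. - (?t R j - ?t P i))"
    by (subst prod.swap) simp
  also have "\<dots> = (\<Prod>j<degree R. \<Prod>i<degree P. (-1) * (?t R j - ?t P i))" by simp
  also have "\<dots> = (-1) ^ (degree P * degree R) * (\<Prod>j<degree R. \<Prod>i<degree P. ?t R j - ?t P i)"
    by (simp only: prod.distrib) (simp add: power_mult)
  finally show "(of_int (quad_char P R) :: 'a alg_closure) =
      of_int ((-1) ^ (?h * degree P * degree R) * quad_char R P)"
    by (simp add: main[OF P R] main[OF R P] power_mult_distrib)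
       (simp add: power_mult[symmetric] mult_ac)
qed

section \<open>Stepanov's auxiliary polynomial\<close>

lemma monic_irreducible_dvd_eq:
  fixes P R :: "'a::field poly"
  assumes P: "irreducible P" "lead_coeff P = 1" and R: "irreducible R" "lead_coeff R = 1"
    and "P dvd R"
  shows "P = R"
proof -
  obtain C where C: "R = P * C" using assms(5) by auto
  have "\<not> is_unit P" using P by (simp add: irreducible_def)
  then have "is_unit C" using R C by (metis irreducibleD)
  then obtain c where c: "C = [:c:]" by (auto elim: is_unit_polyE)
  then have "lead_coeff R = lead_coeff P * c" using C lead_coeff_mult[of P C] by simp
  then have "c = 1" using P R by simp
  then show ?thesis using C c by simp
qed

lemma monic_irreducible_dvd_prod:
  fixes P :: "'a::field poly"
  assumes "finite T" and "\<And>R. R \<in> T \<Longrightarrow> irreducible R \<and> lead_coeff R = 1"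
    and P: "irreducible P" "lead_coeff P = 1" and "P dvd \<Prod>T"
  shows "P \<in> T"
proof -
  have "prime_elem P" using P by (rule_tac field_poly_irreducible_imp_prime)
  have "\<exists>R\<in>T. P dvd R"
    using assms(1,5)
  proof (induction T)
    case empty
    then show ?case using P by (simp add: irreducible_def)
  next
    case (insert R T)
    then show ?case using \<open>prime_elem P\<close> by (auto simp: prime_elem_dvd_mult_iff)
  qed
  then obtain R where "R \<in> T" "P dvd R" by auto
  then show ?thesis using monic_irreducible_dvd_eq[OF P] assms(2) by blast
qed

lemma prod_monic_irreducibles_dvd:
  fixes H :: "'a::field poly"
  assumes "finite T" and "\<And>R. R \<in> T \<Longrightarrow> irreducible R \<and> lead_coeff R = 1 \<and> R dvd H"
  shows "\<Prod>T dvd H"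
  using assms
proof (induction T)
  case (insert P T)
  then obtain C where C: "H = \<Prod>T * C" by (metis dvdE insertCI)
  have P: "irreducible P" "lead_coeff P = 1" "P dvd H" using insert.prems by auto
  have "\<not> P dvd \<Prod>T"
    using monic_irreducible_dvd_prod[OF insert.hyps(1) _ P(1,2)] insert by blast
  moreover have "prime_elem P" using P(1) by (rule field_poly_irreducible_imp_prime)
  ultimately have "P dvd C" using P(3) C by (metis prime_elem_dvd_mult_iff)
  then show ?case using insert C by (simp add: mult.commute mult_dvd_mono)
qed simp

text \<open>Distinct monic primes are coprime, so their product divides \<open>H\<close>. Through
  this a count of primes becomes the degree of one auxiliary polynomial.\<close>

lemma sum_degree_le:
  fixes H :: "'a::field poly"
  assumes "finite T" and "\<And>R. R \<in> T \<Longrightarrow> irreducible R \<and> lead_coeff R = 1 \<and> R dvd H" and "H \<noteq> 0"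
  shows "(\<Sum>R\<in>T. degree R) \<le> degree H"
proof -
  have "R \<noteq> 0" if "R \<in> T" for R using assms(2)[OF that] by auto
  then have "(\<Sum>R\<in>T. degree R) = degree (\<Prod>T)"
    using degree_prod_eq_sum_degree[of T "\<lambda>x. x"] by simp
  also have "\<dots> \<le> degree H"
    using prod_monic_irreducibles_dvd[OF assms(1,2)] assms(3) by (rule dvd_imp_degree_le)
  finally show ?thesis .
qed

text \<open>Infinite descent: a prime factor of the squarefree product divides \<open>V\<close>,
  then also \<open>U\<close>, and cancelling it from both leaves a solution of smaller
  degree.\<close>

lemma squarefree_prod_not_square_ratio:
  fixes U V :: "'a::field poly"
  assumes T: "finite T" "\<And>R. R \<in> T \<Longrightarrow> irreducible R \<and> lead_coeff R = 1" "T \<noteq> {}"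
    and "U\<^sup>2 * \<Prod>T = V\<^sup>2"
  shows "U = 0"
  using assms(4)
proof (induction "degree U" arbitrary: U V rule: less_induct)
  case less
  obtain P where P: "P \<in> T" using T by auto
  define g where "g = \<Prod>(T - {P})"
  have f: "\<Prod>T = P * g" unfolding g_def using T P by (simp add: prod.remove)
  have irr: "irreducible P" "lead_coeff P = 1" using T P by auto
  then have pr: "prime_elem P" by (simp add: field_poly_irreducible_imp_prime)
  have P0: "P \<noteq> 0" using irr by auto
  have ng: "\<not> P dvd g"
    using monic_irreducible_dvd_prod[of "T - {P}" P] T irr unfolding g_def by blast
  have "P dvd V\<^sup>2" using less.prems f by (metis dvd_triv_left dvd_mult)
  then obtain C where C: "V = P * C" using pr by (auto simp: prime_elem_dvd_power_iff)
  have "P * (U\<^sup>2 * g) = P * (P * C\<^sup>2)"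
    using less.prems by (simp add: f C power2_eq_square algebra_simps)
  then have eq: "U\<^sup>2 * g = P * C\<^sup>2" using P0 by simp
  then have "P dvd U\<^sup>2 * g" by simp
  then have "P dvd U" using pr ng by (auto simp: prime_elem_dvd_mult_iff prime_elem_dvd_power_iff)
  then obtain B where B: "U = P * B" by auto
  have "P * (B\<^sup>2 * \<Prod>T) = P * C\<^sup>2"
    using eq by (simp add: f B power2_eq_square algebra_simps)
  then have BC: "B\<^sup>2 * \<Prod>T = C\<^sup>2" using P0 by simp
  show ?case
  proof (rule ccontr)
    assume "U \<noteq> 0"
    then have "B \<noteq> 0" using B by auto
    then have "degree B < degree U"
      using irreducible_degree_pos[OF irr(1)] P0 by (simp add: B degree_mult_eq)
    from less.hyps[OF this BC] show False using \<open>B \<noteq> 0\<close> by simp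
  qed
qed

section \<open>Polynomials in base x^M\<close>

text \<open>For \<open>Q = M\<^sup>2\<close> the map \<open>z \<mapsto> z\<^sup>M\<close> is an involution of \<open>\<F>\<^sub>Q\<close>; on exponents below \<open>Q\<close> it
  exchanges the two base-\<open>M\<close> digits.\<close>

definition swap_digits :: "nat \<Rightarrow> nat \<Rightarrow> nat" where
  "swap_digits M k = (k mod M) * M + k div M"

text \<open>For \<open>R\<close> of degree below M^2 this is congruent to R(x^M) modulo x^(M^2) -
  x.\<close>

definition swap_poly :: "nat \<Rightarrow> 'a::comm_ring_1 poly \<Rightarrow> 'a poly" where
  "swap_poly M R = (\<Sum>k<M\<^sup>2. monom (coeff R (swap_digits M k)) k)"

lemma swap_digits_less:
  assumes "k < M\<^sup>2"
  shows "swap_digits M k < M\<^sup>2" "swap_digits M (swap_digits M k) = k"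
    "swap_digits M k div M = k mod M" "swap_digits M k mod M = k div M"
proof -
  have M: "M > 0" using assms by (cases M) auto
  have d: "k div M < M" using assms by (simp add: power2_eq_square less_mult_imp_div_less)
  show 1: "swap_digits M k div M = k mod M" "swap_digits M k mod M = k div M"
    using M d by (auto simp: swap_digits_def)
  have "swap_digits M k < (k mod M) * M + M" using d by (simp add: swap_digits_def)
  also have "\<dots> = (k mod M + 1) * M" by simp
  also have "\<dots> \<le> M * M" using M by (intro mult_right_mono) (auto simp: Suc_le_eq)
  finally show "swap_digits M k < M\<^sup>2" by (simp add: power2_eq_square)
  show "swap_digits M (swap_digits M k) = k"
    using 1 unfolding swap_digits_def[of M "swap_digits M k"] by simp
qed

lemma coeff_swap_poly:
  "coeff (swap_poly M R) k = (if k < M\<^sup>2 then coeff R (swap_digits M k) else 0)"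
  by (simp add: swap_poly_def coeff_sum if_distrib[of "\<lambda>x. x * _"] sum.delta)

lemma ac_eval_sum: "ac_eval \<theta> (\<Sum>x\<in>I. f x) = (\<Sum>x\<in>I. ac_eval \<theta> (f x))"
  by (induction I rule: infinite_finite_induct) auto

lemma ac_eval_monom: "ac_eval \<theta> (monom c n) = to_ac c * \<theta> ^ n"
  by (simp add: ac_eval_def map_poly_monom poly_monom)

lemma ac_eval_swap_poly:
  fixes R :: "'a::{finite,field} poly"
  assumes t: "\<theta> ^ M\<^sup>2 = \<theta>" and R: "degree R < M\<^sup>2"
  shows "ac_eval (\<theta> ^ M) (swap_poly M R) = ac_eval \<theta> R"
proof -
  have "ac_eval (\<theta> ^ M) (swap_poly M R) =
      (\<Sum>k<M\<^sup>2. to_ac (coeff R (swap_digits M k)) * \<theta> ^ (M * k))"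
    by (simp add: swap_poly_def ac_eval_sum ac_eval_monom power_mult)
  also have "\<dots> = (\<Sum>k<M\<^sup>2. to_ac (coeff R (swap_digits M k)) * \<theta> ^ (swap_digits M k))"
  proof (rule sum.cong)
    fix k
    \<comment> \<open>Of the two summands the second contributes \<theta>^(M^2 a) = \<theta>^a with
      a = k div M, which moves the high digit to the low place.\<close>
    have "M * k = (k mod M) * M + M\<^sup>2 * (k div M)"
      by (metis (no_types, lifting) add.commute distrib_left mult.assoc mult.commute mult_div_mod_eq power2_eq_square)
    then have "\<theta> ^ (M * k) = \<theta> ^ (swap_digits M k)"
      by (simp add: swap_digits_def power_add power_mult t)
    then show "to_ac (coeff R (swap_digits M k)) * \<theta> ^ (M * k) =
        to_ac (coeff R (swap_digits M k)) * \<theta> ^ (swap_digits M k)" by simp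
  qed simp
  also have "\<dots> = (\<Sum>k<M\<^sup>2. to_ac (coeff R k) * \<theta> ^ k)"
    by (rule sum.reindex_bij_witness[of _ "swap_digits M" "swap_digits M"])
       (auto simp: swap_digits_less)
  also have "\<dots> = (\<Sum>k\<le>degree R. to_ac (coeff R k) * \<theta> ^ k)"
    using R by (intro sum.mono_neutral_right) (auto simp: coeff_eq_0)
  also have "\<dots> = ac_eval \<theta> R"
    by (simp add: ac_eval_def poly_altdef degree_map_poly coeff_map_poly)
  finally show ?thesis .
qed

text \<open>Expanding \<open>p\<close> in powers of x^M with coefficients of degree below M, the
  highest nonzero coefficient is \<open>B\<close> and its exponent is \<open>n\<close>. Equality for
  all i also says that nothing lies above it.\<close>

definition top_digit :: "nat \<Rightarrow> 'a::comm_ring_1 poly \<Rightarrow> nat \<Rightarrow> 'a poly \<Rightarrow> bool" where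
  "top_digit M p n B \<longleftrightarrow> B \<noteq> 0 \<and> degree B < M \<and> (\<forall>i. coeff p (i + n * M) = coeff B i)"

lemma top_digit_unique:
  assumes "top_digit M p n B" "top_digit M p n' B'"
  shows "n = n'" "B = B'"
proof -
  have False if "top_digit M p n B" "top_digit M p n' B'" and lt: "n < n'" for n n' B B'
  proof -
    obtain e where e: "n' = n + e" "e > 0" using less_imp_add_positive[OF lt] by auto
    have "coeff B (degree B' + e * M) = coeff p (degree B' + e * M + n * M)"
      using that(1) unfolding top_digit_def by metis
    also have "\<dots> = coeff p (degree B' + n' * M)" by (simp add: e(1) algebra_simps)
    also have "\<dots> = lead_coeff B'" using that(2) unfolding top_digit_def by metis
    finally have "coeff B (degree B' + e * M) \<noteq> 0" using that(2) by (simp add: top_digit_def)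
    from le_degree[OF this] have "e * M \<le> degree B" by simp
    moreover have "1 * M \<le> e * M" using e(2) by (intro mult_right_mono) auto
    ultimately show False using that(1) unfolding top_digit_def by linarith
  qed
  then show n: "n = n'" using assms by (metis linorder_neqE_nat)
  show "B = B'" using assms n by (intro poly_eqI) (metis top_digit_def)
qed

lemma top_digitI:
  assumes "p = B * monom 1 (n * M) + V" "B \<noteq> 0" "degree B < M" "V = 0 \<or> degree V < n * M"
  shows "top_digit M p n B"
  unfolding top_digit_def
proof (intro conjI allI)
  fix i
  have "coeff V (i + n * M) = 0" using assms(4) by (auto intro: coeff_eq_0)
  moreover have "coeff (B * monom 1 (n * M)) (i + n * M) = coeff B i"
    by (simp add: mult.commute[of B] coeff_monom_mult)
  ultimately show "coeff p (i + n * M) = coeff B i" using assms(1) by simp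
qed (use assms in auto)

text \<open>Since low digits are below \<open>A\<close>, a gap of M - A exponents separates
  consecutive blocks. The strong bound on \<open>V\<close> records this gap, which will absorb the
  cross terms of a product.\<close>

lemma small_digits_decompose:
  fixes p :: "'a::idom poly"
  assumes p: "p \<noteq> 0" and dig: "\<And>k. coeff p k \<noteq> 0 \<Longrightarrow> k mod M < A" and A: "A \<le> M"
  obtains U V n where "p = U * monom 1 (n * M) + V" "U \<noteq> 0" "degree U < A"
    "V = 0 \<or> degree V + M < n * M + A" "degree p < n * M + A"
proof -
  have M: "M > 0" using dig[of "degree p"] p A by (cases M) auto
  define n where "n = degree p div M"
  define U where "U = poly_shift (n * M) p"
  define V where "V = poly_cutoff (n * M) p"
  have cU: "coeff U i = coeff p (i + n * M)" for i by (simp add: U_def coeff_poly_shift)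
  have cV: "coeff V i = (if i < n * M then coeff p i else 0)" for i
    by (simp add: V_def coeff_poly_cutoff)
  have 1: "p = U * monom 1 (n * M) + V"
    by (rule poly_eqI) (simp add: mult.commute[of U] coeff_monom_mult cU cV)
  have dp: "degree p = n * M + degree p mod M" by (simp add: n_def)
  have lt: "degree p mod M < A" using dig[of "degree p"] p by simp
  then have 2: "degree p < n * M + A" using dp by simp
  have "coeff U (degree p mod M) = lead_coeff p" using dp by (simp add: cU add.commute)
  then have 3: "U \<noteq> 0" using p by auto
  have "coeff p (degree U + n * M) \<noteq> 0" using 3 by (simp flip: cU)
  then have "degree U + n * M \<le> degree p" by (rule le_degree)
  then have 4: "degree U < A" using 2 by simp
  have 5: "V = 0 \<or> degree V + M < n * M + A"
  proof (cases "V = 0")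
    case False
    then have "coeff V (degree V) \<noteq> 0" by simp
    then have *: "degree V < n * M" "coeff p (degree V) \<noteq> 0" by (auto simp: cV split: if_splits)
    then have "degree V mod M < A" "degree V div M < n" using dig M by (auto simp: less_mult_imp_div_less)
    moreover have "degree V = degree V div M * M + degree V mod M" by simp
    moreover have "(degree V div M + 1) * M \<le> n * M" using \<open>degree V div M < n\<close> by (intro mult_right_mono) auto
    ultimately have "degree V + M < n * M + A" by (simp only: distrib_right mult_1)
    then show ?thesis ..
  qed simp
  show ?thesis using that[OF 1 3 4 5 2] .
qed

lemma degree_sum_le_less:
  fixes p U :: "'a::idom poly"
  assumes "degree p < n * M + A" "degree U < A"
  shows "degree (p + U * monom 1 (n * M)) < n * M + A"
proof -
  have "degree (U * monom 1 (n * M)) < n * M + A"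
    using degree_mult_le[of U "monom 1 (n * M)"] degree_monom_le[of "1::'a" "n * M"] assms by linarith
  then show ?thesis using assms(1) by (rule_tac degree_add_less)
qed

text \<open>If \<open>r\<^sup>2 f = f\<^sup>M s\<^sup>2\<close> and all base-\<open>M\<close> digits of \<open>r\<close>, \<open>s\<close> in low position are small,
  then, as \<open>f\<^sup>M = f(x\<^sup>M)\<close>, comparing the leading digits gives \<open>U\<^sup>2 f = W\<^sup>2\<close>.\<close>

lemma small_digits_contradiction:
  fixes r s f :: "'a::{finite,field} poly"
  assumes M: "M = CARD('a) ^ m"
    and r: "r \<noteq> 0" "\<And>k. coeff r k \<noteq> 0 \<Longrightarrow> k mod M < A"
    and s: "\<And>k. coeff s k \<noteq> 0 \<Longrightarrow> k mod M < A'"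
    and A: "2 * A + degree f \<le> M" "2 * A' \<le> M"
    and f: "lead_coeff f = 1" "degree f > 0" and eq: "r\<^sup>2 * f = f ^ M * s\<^sup>2"
  shows "\<exists>U W. U \<noteq> 0 \<and> U\<^sup>2 * f = W\<^sup>2"
proof -
  have f0: "f \<noteq> 0" using f by auto
  have M0: "M > 0" using M by simp
  have s0: "s \<noteq> 0" using eq r f0 by auto
  let ?D = "degree f"
  obtain U V n where r': "r = U * monom 1 (n * M) + V" "U \<noteq> 0" "degree U < A"
    "V = 0 \<or> degree V + M < n * M + A" "degree r < n * M + A"
    by (rule small_digits_decompose[OF r]) (use A in auto)
  obtain W Z k where s': "s = W * monom 1 (k * M) + Z" "W \<noteq> 0" "degree W < A'"
    "Z = 0 \<or> degree Z + M < k * M + A'" "degree s < k * M + A'"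
    by (rule small_digits_decompose[OF s0 s]) (use A in auto)
  \<comment> \<open>The difference r^2 - (U x^(nM))^2 factors as V (r + U x^(nM)). After
    multiplication by f its degree is below 2nM - M + 2A + deg f, which is at most 2nM.\<close>
  have "top_digit M (r\<^sup>2 * f) (2 * n) (U\<^sup>2 * f)"
  proof (rule top_digitI)
    show "r\<^sup>2 * f = U\<^sup>2 * f * monom 1 (2 * n * M) + V * (r + U * monom 1 (n * M)) * f"
    proof -
      have "monom 1 (2 * n * M) = (monom 1 (n * M) :: 'a poly)\<^sup>2"
        by (simp add: monom_power algebra_simps)
      then show ?thesis by (simp add: r'(1) power2_eq_square algebra_simps)
    qed
    show "U\<^sup>2 * f \<noteq> 0" using r' f0 by simp
    have "degree (U\<^sup>2 * f) \<le> 2 * degree U + ?D"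
      using r' f0 by (simp add: degree_mult_eq degree_power_eq)
    then show "degree (U\<^sup>2 * f) < M" using r' A by linarith
    show "V * (r + U * monom 1 (n * M)) * f = 0 \<or> degree (V * (r + U * monom 1 (n * M)) * f) < 2 * n * M"
    proof (cases "V = 0")
      case False
      have "degree (V * (r + U * monom 1 (n * M)) * f) \<le> degree V + degree (r + U * monom 1 (n * M)) + ?D"
        using degree_mult_le[of V "r + U * monom 1 (n * M)"]
          degree_mult_le[of "V * (r + U * monom 1 (n * M))" f] by linarith
      moreover have "degree (r + U * monom 1 (n * M)) < n * M + A"
        using r' by (intro degree_sum_le_less) auto
      ultimately have "degree (V * (r + U * monom 1 (n * M)) * f) + M < n * M + A + (n * M + A) + ?D"
        using r'(4) False by linarith
      then show ?thesis using A by (intro disjI2) linarith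
    qed simp
  qed
  moreover have "top_digit M (f ^ M * s\<^sup>2) (2 * k + ?D) (W\<^sup>2)"
  proof (rule top_digitI)
    \<comment> \<open>As f^M = f(x^M) with f monic, \<open>?g\<close> only has exponents up to (deg
      f - 1) M, so the leading digit of f^M is 1.\<close>
    let ?g = "f ^ M - monom 1 (?D * M)"
    have dg: "degree ?g + M \<le> ?D * M"
    proof -
      have "?g = pcompose (f - monom 1 ?D) (monom 1 M)"
        using poly_power_card_power[of f m] poly_power_card_power[of "monom 1 ?D" m]
        by (simp add: pcompose_diff M monom_power mult.commute)
      then have "degree ?g = degree (f - monom 1 ?D) * M" by (simp add: degree_pcompose degree_monom_eq)
      moreover have "degree (f - monom 1 ?D) < ?D"
        using f degree_diff_le[of f ?D "monom 1 ?D"]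
        by (intro degree_lessI) (auto simp: coeff_eq_0 le_less split: if_splits)
      then have "(degree (f - monom 1 ?D) + 1) * M \<le> ?D * M" by (intro mult_right_mono) auto
      ultimately show ?thesis by simp
    qed
    show "f ^ M * s\<^sup>2 = W\<^sup>2 * monom 1 ((2 * k + ?D) * M) +
        (Z * (s + W * monom 1 (k * M)) * f ^ M + W\<^sup>2 * monom 1 (2 * k * M) * ?g)"
    proof -
      have "monom 1 (2 * k * M) = (monom 1 (k * M) :: 'a poly)\<^sup>2"
        by (simp add: monom_power algebra_simps)
      moreover have "monom 1 ((2 * k + ?D) * M) = (monom 1 (k * M) :: 'a poly)\<^sup>2 * monom 1 (?D * M)"
        by (simp add: monom_power mult_monom algebra_simps)
      ultimately show ?thesis by (simp add: s'(1) power2_eq_square algebra_simps)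
    qed
    show "W\<^sup>2 \<noteq> 0" using s' by simp
    show "degree (W\<^sup>2) < M" using s' A by (simp add: degree_power_eq)
    have "degree (Z * (s + W * monom 1 (k * M)) * f ^ M) < (2 * k + ?D) * M"
    proof (cases "Z = 0")
      case False
      have "degree (Z * (s + W * monom 1 (k * M)) * f ^ M) \<le> degree Z + degree (s + W * monom 1 (k * M)) + ?D * M"
        using f0 degree_mult_le[of Z "s + W * monom 1 (k * M)"]
          degree_mult_le[of "Z * (s + W * monom 1 (k * M))" "f ^ M"]
        by (simp add: degree_power_eq mult.commute)
      moreover have "degree (s + W * monom 1 (k * M)) < k * M + A'"
        using s' by (intro degree_sum_le_less) auto
      ultimately have "degree (Z * (s + W * monom 1 (k * M)) * f ^ M) + M < k * M + A' + (k * M + A') + ?D * M"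
        using s'(4) False by linarith
      then show ?thesis using A by (simp add: algebra_simps)
    qed (use f M0 in simp)
    moreover have "degree (W\<^sup>2 * monom 1 (2 * k * M) * ?g) < (2 * k + ?D) * M"
    proof -
      have "degree (W\<^sup>2 * monom 1 (2 * k * M) * ?g) \<le> 2 * degree W + 2 * k * M + degree ?g"
        using s'(2) degree_mult_le[of "W\<^sup>2" "monom 1 (2 * k * M)"] degree_monom_le[of "1::'a" "2 * k * M"]
          degree_mult_le[of "W\<^sup>2 * monom 1 (2 * k * M)" ?g]
        by (simp add: degree_power_eq)
      then have "degree (W\<^sup>2 * monom 1 (2 * k * M) * ?g) + M < 2 * A' + 2 * k * M + ?D * M"
        using dg s'(3) by linarith
      then show ?thesis using A by (simp add: algebra_simps)
    qed
    ultimately show "Z * (s + W * monom 1 (k * M)) * f ^ M + W\<^sup>2 * monom 1 (2 * k * M) * ?g = 0 \<or>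
        degree (Z * (s + W * monom 1 (k * M)) * f ^ M + W\<^sup>2 * monom 1 (2 * k * M) * ?g) < (2 * k + ?D) * M"
      by (intro disjI2 degree_add_less)
  qed
  ultimately have "U\<^sup>2 * f = W\<^sup>2" unfolding eq by (rule top_digit_unique(2))
  then show ?thesis using r'(2) by blast
qed

section \<open>The auxiliary polynomial and its degree\<close>

lemma card_div_mod:
  assumes "(M::nat) > 0" "Y \<subseteq> {..<M}" "finite U"
  shows "finite {k. k div M \<in> U \<and> k mod M \<in> Y}"
    and "card {k. k div M \<in> U \<and> k mod M \<in> Y} = card U * card Y"
proof -
  have "bij_betw (\<lambda>k. (k div M, k mod M)) {k. k div M \<in> U \<and> k mod M \<in> Y} (U \<times> Y)"
    by (rule bij_betw_byWitness[where f' = "\<lambda>(a, b). a * M + b"]) (use assms in auto)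
  moreover have "finite Y" using assms(2) finite_subset by blast
  ultimately show "finite {k. k div M \<in> U \<and> k mod M \<in> Y}"
    "card {k. k div M \<in> U \<and> k mod M \<in> Y} = card U * card Y"
    using assms(3) by (auto simp: card_cartesian_product bij_betw_finite dest: bij_betw_same_card)
qed

text \<open>Pigeonhole: \<open>R\<close> has A J free coefficients, while the unwanted coefficients
  of R w, those with low digit at least J, number only (A + D)(M - J). Two candidates share them,
  and their difference is the \<open>R\<close> sought.\<close>

lemma exists_small_digit_multiple:
  fixes w :: "'a::{finite,field} poly"
  assumes M: "M > 0" and J: "J \<le> M" and w: "degree w \<le> D * M"
    and count: "A * J > (A + D) * (M - J)"
  obtains R where "R \<noteq> 0" "\<And>k. coeff R k \<noteq> 0 \<Longrightarrow> k div M < A \<and> k mod M < J"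
    "\<And>k. coeff (R * w) k \<noteq> 0 \<Longrightarrow> k div M < A + D \<and> k mod M < J"
proof -
  define I where "I = {k. k div M \<in> {..<A} \<and> k mod M \<in> {..<J}}"
  define C where "C = {k. k div M \<in> {..<A + D} \<and> k mod M \<in> {J..<M}}"
  define S where "S = (\<lambda>I. {p::'a poly. \<forall>k. k \<notin> I \<longrightarrow> coeff p k = 0})"
  define \<phi> where "\<phi> = (\<lambda>R. \<Sum>k\<in>C. monom (coeff (R * w) k) k)"
  have fin: "finite I" "finite C" unfolding I_def C_def using J by (intro card_div_mod(1)[OF M]; auto)+
  have c\<phi>: "coeff (\<phi> R) k = (if k \<in> C then coeff (R * w) k else 0)" for R k
    using fin(2) by (simp add: \<phi>_def coeff_sum sum.delta)
  have cards: "card I = A * J" "card C = (A + D) * (M - J)"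
    unfolding I_def C_def using J by (subst card_div_mod(2)[OF M]; auto)+
  have "card (\<phi> ` S I) \<le> card (S C)"
    using card_poly_support(1)[OF fin(2)] by (intro card_mono) (auto simp: S_def c\<phi>)
  also have "\<dots> < card (S I)"
    using card_poly_support(2)[OF fin(1), where 'a='a] card_poly_support(2)[OF fin(2), where 'a='a]
      cards count card_field_ge2[where 'a='a] by (simp add: S_def power_strict_increasing_iff)
  finally have "\<not> inj_on \<phi> (S I)" by (metis card_image nat_less_le)
  then obtain R1 R2 where R12: "R1 \<in> S I" "R2 \<in> S I" "R1 \<noteq> R2" "\<phi> R1 = \<phi> R2"
    by (auto simp: inj_on_def)
  define R where "R = R1 - R2"
  have R0: "R \<noteq> 0" using R12 by (simp add: R_def)
  have RI: "k \<in> I" if "coeff R k \<noteq> 0" for k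
  proof (rule ccontr)
    assume "k \<notin> I"
    then have "coeff R1 k = 0" "coeff R2 k = 0" using R12(1,2) by (auto simp: S_def)
    then show False using that by (simp add: R_def)
  qed
  have RC: "coeff (R * w) k = 0" if "k \<in> C" for k
    using arg_cong[OF R12(4), of "\<lambda>p. coeff p k"] that by (simp add: c\<phi> R_def left_diff_distrib)
  show ?thesis
  proof (rule that[OF R0])
    fix k assume "coeff R k \<noteq> 0"
    then show "k div M < A \<and> k mod M < J" using RI[of k] by (simp add: I_def)
  next
    fix k assume k: "coeff (R * w) k \<noteq> 0"
    have "degree R div M < A" using RI[of "degree R"] R0 by (simp add: I_def)
    then have "degree R < A * M" using M by (simp add: div_less_iff_less_mult)
    moreover have "k \<le> degree R + degree w"
      using le_degree[OF k] degree_mult_le order_trans by blast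
    ultimately have "k < (A + D) * M" using w by (simp add: algebra_simps)
    then have "k div M < A + D" by (simp add: less_mult_imp_div_less)
    moreover have "k mod M < J"
      using RC[of k] k \<open>k div M < A + D\<close> M by (force simp: C_def)
    ultimately show "k div M < A + D \<and> k mod M < J" ..
  qed
qed

text \<open>Every prime in \<open>G\<close> divides one nonzero polynomial \<open>H\<close> of
  degree about M^2/2, half of what all primes of degree dividing 2m have together. It is linear in
  the M-th power of the variable in disguise: modulo x^(M^2) - x it equals R(x^M) (1 - a f^(h +
  hM)), and h + hM = (M^2 - 1)/2 is the exponent of Euler's criterion.\<close>

theorem stepanov_bound:
  fixes T G :: "'a::{finite,field} poly set"
  assumes odd: "odd CARD('a)"
    and T: "finite T" "T \<noteq> {}" "\<And>R. R \<in> T \<Longrightarrow> irreducible R \<and> lead_coeff R = 1"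
    and f: "f = \<Prod>T" and a: "a\<^sup>2 = 1"
    and M: "M = CARD('a) ^ m" and h: "M = 2 * h + 1" and large: "h \<ge> 2 * degree f"
    and G: "finite G" "\<And>P. P \<in> G \<Longrightarrow> irreducible P \<and> lead_coeff P = 1 \<and> degree P dvd 2 * m \<and>
        P dvd f ^ ((M\<^sup>2 - 1) div 2) - [:a:]"
  shows "(\<Sum>P\<in>G. degree P) \<le> (h + degree f) * M + degree f * h + h"
proof -
  define D where "D = degree f"
  have ld: "lead_coeff f = 1" unfolding f lead_coeff_prod using T by (simp add: prod.neutral)
  have D0: "D > 0"
  proof -
    obtain P where P: "P \<in> T" using T by auto
    have "R \<noteq> 0" if "R \<in> T" for R using T(3)[OF that] by auto
    then have "D = (\<Sum>R\<in>T. degree R)"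
      unfolding D_def f using degree_prod_eq_sum_degree[of T "\<lambda>x. x"] by simp
    also have "\<dots> \<ge> degree P" using T(1) P by (simp add: member_le_sum)
    finally show ?thesis using irreducible_degree_pos T(3)[OF P] by fastforce
  qed
  have h': "h \<ge> 2 * D" using large D_def by simp
  \<comment> \<open>Just above M/2: then M - J = h - D = A and A + D = h, so the pigeonhole
    inequality becomes (h - D)(h + 1 + D) > h (h - D).\<close>
  define J where "J = h + 1 + D"
  define A where "A = h - D"
  define w where "w = f ^ h"
  have f0: "f \<noteq> 0" using ld by auto
  have M0: "M > 0" using h by simp
  have dw: "degree w = D * h" using f0 by (simp add: w_def degree_power_eq D_def)
  have AD: "A + D = h" using h' by (simp add: A_def)
  obtain R where R0: "R \<noteq> 0" and R: "\<And>k. coeff R k \<noteq> 0 \<Longrightarrow> k div M < A \<and> k mod M < J"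
    and S: "\<And>k. coeff (R * w) k \<noteq> 0 \<Longrightarrow> k div M < A + D \<and> k mod M < J"
  proof (rule exists_small_digit_multiple[OF M0, where A = A and D = D and J = J and w = w])
    show "J \<le> M" using h h' by (simp add: J_def)
    show "degree w \<le> D * M" using dw h by simp
    have "(A + D) * (M - J) = (h - D) * h" using h AD by (simp add: J_def)
    also have "\<dots> < (h - D) * (h + 1 + D)" using D0 h' by (intro mult_strict_left_mono) auto
    finally show "A * J > (A + D) * (M - J)" by (simp only: A_def J_def)
  qed auto
  define r where "r = swap_poly M R"
  define s where "s = swap_poly M (R * w)"
  \<comment> \<open>At a root \<theta> of a prime in \<open>G\<close> the values of \<open>r\<close>
    and \<open>s\<close> are R(\<theta>^M) and R(\<theta>^M) f(\<theta>)^(hM), so that the value of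
    \<open>H\<close> is R(\<theta>^M) (1 - a^2) = 0.\<close>
  define H where "H = r - [:a:] * w * s"
  have hM: "h < M" using h by simp
  have small: "degree p < M\<^sup>2" if "\<And>k. coeff p k \<noteq> 0 \<Longrightarrow> k div M < B \<and> k mod M < J" "B \<le> h" for p :: "'a poly" and B
  proof (cases "p = 0")
    case False
    then have "degree p div M < M" using that(1)[of "degree p"] that(2) hM by simp
    then show ?thesis using M0 by (simp add: div_less_iff_less_mult power2_eq_square)
  qed (use M0 in simp)
  have R_deg: "degree R < M\<^sup>2" by (rule small[OF R]) (use AD in auto)
  have S_deg: "degree (R * w) < M\<^sup>2" by (rule small[OF S]) (use AD in auto)
  \<comment> \<open>The exchange of digits gives both properties wanted: the bound on high digits
    becomes one on low digits, which forces \<open>H\<close> to be nonzero, and the bound J on low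
    digits becomes the bound on the degree.\<close>
  have swap: "k mod M < B \<and> k div M < J"
    if "\<And>k. coeff p k \<noteq> 0 \<Longrightarrow> k div M < B \<and> k mod M < J" "coeff (swap_poly M p) k \<noteq> 0" for p :: "'a poly" and B k
  proof -
    have "k < M\<^sup>2" "coeff p (swap_digits M k) \<noteq> 0" using that(2) by (auto simp: coeff_swap_poly split: if_splits)
    then show ?thesis using that(1)[of "swap_digits M k"] swap_digits_less[of k M] by simp
  qed
  have rd: "k mod M < A \<and> k div M < J" if "coeff r k \<noteq> 0" for k
    using swap[OF R] that unfolding r_def by blast
  have sd: "k mod M < h \<and> k div M < J" if "coeff s k \<noteq> 0" for k
    using swap[OF S] that unfolding s_def AD by blast
  have deg: "degree p \<le> (h + D) * M + h"
    if "\<And>k. coeff p k \<noteq> 0 \<Longrightarrow> k mod M < h \<and> k div M < J" for p :: "'a poly"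
  proof (cases "p = 0")
    case False
    then have "degree p mod M < h" "degree p div M \<le> h + D"
      using that[of "degree p"] by (auto simp: J_def)
    then have "degree p div M * M + degree p mod M \<le> (h + D) * M + h"
      by (intro add_mono mult_right_mono) auto
    then show ?thesis by simp
  qed simp
  have "degree r \<le> (h + D) * M + h" by (rule deg) (use rd AD in fastforce)
  moreover have "degree ([:a:] * w * s) \<le> D * h + ((h + D) * M + h)"
  proof -
    have "degree s \<le> (h + D) * M + h" by (rule deg) (use sd in blast)
    moreover have "degree ([:a:] * w) \<le> D * h" using degree_mult_le[of "[:a:]" w] dw by simp
    ultimately show ?thesis using degree_mult_le[of "[:a:] * w" s] by linarith
  qed
  ultimately have degH: "degree H \<le> (h + D) * M + D * h + h"
    unfolding H_def by (intro degree_diff_le) auto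
  \<comment> \<open>If r = a w s, squaring and multiplying by f gives r^2 f = f^M s^2, because w^2 f
    = f^(2h + 1). Small low digits then make f a ratio of squares, although it is squarefree and
    nonconstant.\<close>
  have H0: "H \<noteq> 0"
  proof
    assume "H = 0"
    then have rs: "r = [:a:] * w * s" by (simp add: H_def)
    have "r \<noteq> 0"
    proof
      assume "r = 0"
      define k where "k = swap_digits M (degree R)"
      have "coeff r k = lead_coeff R"
        using swap_digits_less[OF R_deg] by (simp add: r_def coeff_swap_poly k_def)
      then show False using R0 \<open>r = 0\<close> by simp
    qed
    moreover have "r\<^sup>2 * f = f ^ M * s\<^sup>2"
    proof -
      have "[:a:]\<^sup>2 = 1" using a by (simp add: power2_eq_square one_pCons)
      moreover have "w\<^sup>2 * f = f ^ M" unfolding w_def h by (simp add: power_mult[symmetric] mult.commute)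
      ultimately have "([:a:]\<^sup>2 * w\<^sup>2 * s\<^sup>2) * f = f ^ M * s\<^sup>2" by (simp add: mult_ac)
      then show ?thesis by (simp only: rs power_mult_distrib)
    qed
    ultimately have "\<exists>U W. U \<noteq> 0 \<and> U\<^sup>2 * f = W\<^sup>2"
      by (intro small_digits_contradiction[OF M, of r A s h])
         (use rd sd ld D0 AD h' h in \<open>auto simp: D_def\<close>)
    then show False using squarefree_prod_not_square_ratio[OF T(1,3,2)] unfolding f by blast
  qed
  have "P dvd H" if P: "P \<in> G" for P
  proof -
    have irr: "irreducible P" using G P by blast
    let ?t = "poly_root P"
    have t: "?t ^ M\<^sup>2 = ?t"
    proof -
      have "P dvd monom 1 (CARD('a) ^ (2 * m)) - monom 1 1"
        using dvd_X_power_card_minus_X[OF irr] G P by blast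
      then have "?t ^ (CARD('a) ^ (2 * m)) = ?t"
        using irr by (simp add: ac_eval_poly_root_eq_iff[symmetric])
      then show ?thesis by (simp add: M power_mult[symmetric] mult.commute)
    qed
    have tt: "(?t ^ M) ^ M = ?t" using t by (simp add: power_mult[symmetric] power2_eq_square)
    have fr: "ac_eval ?t B ^ M = ac_eval (?t ^ M) B" for B unfolding M by (rule ac_eval_power_conj)
    have "ac_eval ?t (f ^ ((M\<^sup>2 - 1) div 2)) = ac_eval ?t [:a:]"
      using G P irr by (subst ac_eval_poly_root_eq_iff) auto
    moreover have "(M\<^sup>2 - 1) div 2 = h * M + h" by (simp add: h power2_eq_square)
    ultimately have fa: "ac_eval ?t f ^ (h * M + h) = to_ac a" by simp
    have "ac_eval ?t H ^ M = ac_eval (?t ^ M) r - to_ac a * ac_eval (?t ^ M) w * ac_eval (?t ^ M) s"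
      unfolding fr H_def by (simp only: ac_eval_diff ac_eval_mult ac_eval_const)
    also have "\<dots> = ac_eval ?t R - to_ac a * (ac_eval ?t f ^ h) ^ M * (ac_eval ?t R * ac_eval ?t f ^ h)"
      using ac_eval_swap_poly[OF t R_deg] ac_eval_swap_poly[OF t S_deg] fr[of w, symmetric]
      by (simp add: r_def s_def w_def)
    also have "\<dots> = ac_eval ?t R * (1 - to_ac a * ac_eval ?t f ^ (h * M + h))"
      by (simp add: power_add power_mult[symmetric] algebra_simps)
    also have "\<dots> = ac_eval ?t R * (1 - to_ac (a\<^sup>2))"
      by (simp add: fa power2_eq_square)
    also have "\<dots> = 0" using a by simp
    finally have "ac_eval ?t H = 0" by simp
    then show ?thesis using irr by (simp add: ac_eval_poly_root_iff)
  qed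
  then have "(\<Sum>P\<in>G. degree P) \<le> degree H"
    using G H0 by (intro sum_degree_le) auto
  then show ?thesis using degH by (simp add: D_def)
qed

section \<open>Sums over monic polynomials and over primes\<close>

definition monics :: "nat \<Rightarrow> 'a::{finite,field} poly set" where
  "monics n = {A. lead_coeff A = 1 \<and> degree A = n}"

definition coeff_sum :: "('a::{finite,field} poly \<Rightarrow> int) \<Rightarrow> nat \<Rightarrow> int" where
  "coeff_sum \<psi> n = (\<Sum>A\<in>monics n. \<psi> A)"

definition primes_dvd :: "nat \<Rightarrow> 'a::{finite,field} poly set" where
  "primes_dvd n = {P. irreducible P \<and> lead_coeff P = 1 \<and> degree P dvd n}"

definition primes_upto :: "nat \<Rightarrow> 'a::{finite,field} poly set" where
  "primes_upto n = {P. irreducible P \<and> lead_coeff P = 1 \<and> degree P \<le> n}"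

text \<open>The coefficients of the logarithmic derivative of an Euler product.\<close>

definition prime_power_sum :: "('a::{finite,field} poly \<Rightarrow> int) \<Rightarrow> nat \<Rightarrow> int" where
  "prime_power_sum \<psi> n = (\<Sum>P\<in>primes_dvd n. int (degree P) * \<psi> P ^ (n div degree P))"

lemma bij_betw_monics:
  "bij_betw (\<lambda>p. monom 1 n + p) {p. \<forall>k. k \<notin> {..<n} \<longrightarrow> coeff p k = 0} (monics n :: 'a::{finite,field} poly set)"
proof (rule bij_betw_byWitness[where f' = "\<lambda>p. p - monom 1 n"])
  show "(\<lambda>p. monom 1 n + p) ` {p. \<forall>k. k \<notin> {..<n} \<longrightarrow> coeff p k = 0} \<subseteq> (monics n :: 'a poly set)"
  proof safe
    fix p :: "'a poly" assume p: "\<forall>k. k \<notin> {..<n} \<longrightarrow> coeff p k = 0"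
    have c: "coeff (monom 1 n + p) n = 1" using p by simp
    have "degree (monom 1 n + p) \<le> n" by (rule degree_le) (use p in auto)
    moreover have "degree (monom 1 n + p) \<ge> n" by (rule le_degree) (metis c zero_neq_one)
    ultimately have dn: "degree (monom 1 n + p) = n" by simp
    show "monom 1 n + p \<in> monics n" by (simp only: monics_def mem_Collect_eq dn c)
  qed
  show "(\<lambda>p. p - monom 1 n) ` (monics n :: 'a poly set) \<subseteq> {p. \<forall>k. k \<notin> {..<n} \<longrightarrow> coeff p k = 0}"
    by (auto simp: monics_def coeff_eq_0 not_less le_less)
qed auto

lemma finite_monics [simp]: "finite (monics n :: 'a::{finite,field} poly set)"
  using bij_betw_finite[OF bij_betw_monics[of n, where 'a='a]] card_poly_support(1)[of "{..<n}", where 'a='a] by simp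

lemma card_monics: "card (monics n :: 'a::{finite,field} poly set) = CARD('a) ^ n"
  using bij_betw_same_card[OF bij_betw_monics[of n, where 'a='a]]
    card_poly_support(2)[of "{..<n}", where 'a='a] by simp

lemma monics_0: "monics 0 = {1}"
  by (auto simp: monics_def one_pCons elim!: degree_eq_zeroE)

lemma finite_primes_upto [simp]: "finite (primes_upto n :: 'a::{finite,field} poly set)"
proof -
  have "primes_upto n \<subseteq> (\<Union>k\<le>n. monics k :: 'a poly set)" by (auto simp: primes_upto_def monics_def)
  then show ?thesis by (rule finite_subset) simp
qed

lemma primes_dvd_subset: "n > 0 \<Longrightarrow> primes_dvd n \<subseteq> primes_upto n"
  by (auto simp: primes_dvd_def primes_upto_def intro: dvd_imp_le)

lemma finite_primes_dvd [simp]: "n > 0 \<Longrightarrow> finite (primes_dvd n)"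
  using primes_dvd_subset finite_primes_upto finite_subset by blast

section \<open>Prime factors and the coefficients of Euler products\<close>

lemma exists_monic_irreducible_dvd:
  fixes A :: "'a::field poly"
  assumes "degree A > 0"
  obtains P where "irreducible P" "lead_coeff P = 1" "P dvd A"
proof -
  define B where "B = (ARG_MIN degree B. B dvd A \<and> degree B > 0)"
  have B: "B dvd A \<and> degree B > 0"
    unfolding B_def by (rule arg_min_natI[where k = A]) (use assms in auto)
  have min: "degree B \<le> degree C" if "C dvd A" "degree C > 0" for C
    unfolding B_def by (rule arg_min_nat_le) (use that in auto)
  have B0: "B \<noteq> 0" using B by auto
  have "irreducible B"
  proof (rule irreducibleI)
    show "\<not> is_unit B" using B B0 by (simp add: is_unit_iff_degree)
    fix C E assume BE: "B = C * E"
    then have "C \<noteq> 0" "E \<noteq> 0" using B0 by auto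
    then have "degree B = degree C + degree E" using BE by (simp add: degree_mult_eq)
    moreover have "C dvd A" "E dvd A" using B BE by (auto dest: dvd_mult_left dvd_mult_right)
    ultimately have "degree C = 0 \<or> degree E = 0" using min by fastforce
    then show "is_unit C \<or> is_unit E" using \<open>C \<noteq> 0\<close> \<open>E \<noteq> 0\<close> by (simp add: is_unit_iff_degree)
  qed (use B0 in auto)
  define c where "c = inverse (lead_coeff B)"
  have c: "c \<noteq> 0" using B0 by (simp add: c_def)
  have "is_unit [:c:]" using c by (simp add: is_unit_pCons_iff)
  then have "irreducible ([:c:] * B)" using \<open>irreducible B\<close> irreducible_mult_unit_left by blast
  moreover have "lead_coeff ([:c:] * B) = 1" using B0 by (simp add: c_def)
  moreover have "[:c:] * B dvd A" using B by (subst mult_unit_dvd_iff'[OF \<open>is_unit [:c:]\<close>]) simp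
  ultimately show ?thesis by (rule that)
qed

lemma prime_power_dvd_mult:
  fixes P :: "'a::field poly"
  assumes "prime_elem P" "\<not> P dvd R" "P ^ j dvd R * B"
  shows "P ^ j dvd B"
  using assms(3)
proof (induction j arbitrary: B)
  case (Suc j)
  then have "P dvd R * B" by (metis dvd_mult_left power_Suc)
  then have "P dvd B" using assms by (simp add: prime_elem_dvd_mult_iff)
  then obtain B' where B': "B = P * B'" by auto
  have "P \<noteq> 0" using assms(1) by auto
  have "P * P ^ j dvd P * (R * B')" using Suc.prems B' by (simp add: mult_ac)
  then have "P ^ j dvd R * B'" using \<open>P \<noteq> 0\<close> by simp
  then show ?case using Suc.IH[of B'] B' by simp
qed simp

text \<open>The identity \<open>deg A = \<Sum>\<^bsub>D dvd A\<^esub> \<Lambda>(D)\<close>.\<close>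

lemma degree_eq_sum_prime_powers:
  fixes A :: "'a::{finite,field} poly"
  assumes "lead_coeff A = 1" "degree A \<le> N"
  shows "(\<Sum>P\<in>primes_upto N. \<Sum>j\<in>{1..N}. if P ^ j dvd A then degree P else 0) = degree A"
  using assms
proof (induction "degree A" arbitrary: A rule: less_induct)
  case less
  have irr: "irreducible P" "lead_coeff P = 1" "prime_elem P" "degree P > 0" if "P \<in> primes_upto N" for P :: "'a poly"
    using that by (auto simp: primes_upto_def field_poly_irreducible_imp_prime irreducible_degree_pos)
  show ?case
  proof (cases "degree A = 0")
    case True
    then have "A \<in> monics 0" using less.prems(1) by (simp add: monics_def)
    then have "A = 1" by (simp add: monics_0)
    have "\<not> P ^ j dvd 1" if "P \<in> primes_upto N" "j \<ge> 1" for P :: "'a poly" and j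
      using irr[OF that(1)] that(2) by (auto simp: is_unit_power_iff irreducible_def)
    then show ?thesis using \<open>A = 1\<close> by (intro trans[OF sum.neutral]) auto
  next
    case False
    obtain P0 where P0: "irreducible P0" "lead_coeff P0 = 1" "P0 dvd A"
      by (rule exists_monic_irreducible_dvd[of A]) (use False in auto)
    then obtain B where B: "A = P0 * B" by auto
    have A0: "A \<noteq> 0" using less.prems by auto
    have B1: "lead_coeff B = 1" using B P0 less.prems(1) by (simp add: lead_coeff_mult)
    have "B \<noteq> 0" "P0 \<noteq> 0" using B A0 by auto
    then have dA: "degree A = degree P0 + degree B" using B by (simp add: degree_mult_eq)
    have pos: "degree P0 > 0" using P0 by (simp add: irreducible_degree_pos)
    have P0N: "P0 \<in> primes_upto N" using P0 dA less.prems by (simp add: primes_upto_def)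
    have IH: "(\<Sum>P\<in>primes_upto N. \<Sum>j\<in>{1..N}. if P ^ j dvd B then degree P else 0) = degree B"
      using less.hyps[of B] B1 dA less.prems pos by simp
    let ?g = "\<lambda>A P. \<Sum>j\<in>{1..N}. if P ^ j dvd A then degree P else (0::nat)"
    have other: "?g A P = ?g B P" if P: "P \<in> primes_upto N - {P0}" for P
    proof -
      have "\<not> P dvd P0" using monic_irreducible_dvd_eq[of P P0] irr[of P] P P0 by auto
      then have "P ^ j dvd A \<longleftrightarrow> P ^ j dvd B" for j
        using prime_power_dvd_mult[of P P0 j B] irr(3)[of P] P B by auto
      then show ?thesis by simp
    qed
    \<comment> \<open>Dividing by \<open>P0\<close> lowers its exponent by one; the lost term j = N
      is empty because deg B < N.\<close>
    have self: "?g A P0 = degree P0 + ?g B P0"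
    proof -
      obtain N' where N': "N = Suc N'" using less.prems False by (cases N) auto
      have "\<not> P0 ^ N dvd B"
      proof
        assume "P0 ^ N dvd B"
        then have "degree (P0 ^ N) \<le> degree B" using \<open>B \<noteq> 0\<close> by (rule dvd_imp_degree_le)
        then have "N * degree P0 \<le> degree B" using \<open>P0 \<noteq> 0\<close> by (simp add: degree_power_eq)
        moreover have "N * 1 \<le> N * degree P0" using pos by (intro mult_left_mono) auto
        ultimately show False using dA less.prems pos by linarith
      qed
      then have gB: "?g B P0 = (\<Sum>j\<in>{1..N'}. if P0 ^ j dvd B then degree P0 else 0)"
        by (simp add: N')
      have "?g A P0 = (\<Sum>j\<in>{0..N'}. if P0 ^ Suc j dvd A then degree P0 else 0)"
        unfolding N' by (subst sum.shift_bounds_cl_Suc_ivl[symmetric]) simp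
      also have "\<dots> = (\<Sum>j\<in>{0..N'}. if P0 ^ j dvd B then degree P0 else 0)"
        using \<open>P0 \<noteq> 0\<close> by (simp add: B)
      also have "\<dots> = degree P0 + (\<Sum>j\<in>{1..N'}. if P0 ^ j dvd B then degree P0 else 0)"
        by (subst sum.atLeast_Suc_atMost) auto
      finally show ?thesis using gB by simp
    qed
    have "(\<Sum>P\<in>primes_upto N. ?g A P) = ?g A P0 + (\<Sum>P\<in>primes_upto N - {P0}. ?g A P)"
      using P0N by (intro sum.remove) auto
    also have "\<dots> = degree P0 + (?g B P0 + (\<Sum>P\<in>primes_upto N - {P0}. ?g B P))"
      using self other by simp
    also have "?g B P0 + (\<Sum>P\<in>primes_upto N - {P0}. ?g B P) = (\<Sum>P\<in>primes_upto N. ?g B P)"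
      using P0N by (intro sum.remove[symmetric]) auto
    finally show ?thesis using IH dA by simp
  qed
qed

lemma sum_monics_dvd:
  fixes \<psi> :: "'a::{finite,field} poly \<Rightarrow> int"
  assumes mult: "\<And>A B. \<psi> (A * B) = \<psi> A * \<psi> B" and E: "lead_coeff E = 1"
  shows "(\<Sum>A\<in>{A\<in>monics n. E dvd A}. \<psi> A) =
    (if degree E \<le> n then \<psi> E * coeff_sum \<psi> (n - degree E) else 0)"
proof (cases "degree E \<le> n")
  case True
  have "E \<noteq> 0" using E by auto
  have deg: "degree (E * B) = degree E + degree B" if "lead_coeff B = 1" for B
    using that \<open>E \<noteq> 0\<close> by (subst degree_mult_eq) auto
  have "(\<Sum>A\<in>{A\<in>monics n. E dvd A}. \<psi> A) = (\<Sum>B\<in>monics (n - degree E). \<psi> (E * B))"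
  proof (rule sum.reindex_bij_witness[of _ "\<lambda>B. E * B" "\<lambda>A. A div E"])
    fix A assume A: "A \<in> {A \<in> monics n. E dvd A}"
    then obtain B where B: "A = E * B" by auto
    have "lead_coeff B = 1" using A B E by (simp add: monics_def lead_coeff_mult)
    then show "A div E \<in> monics (n - degree E)"
      using A B \<open>E \<noteq> 0\<close> deg[of B] by (auto simp: monics_def)
  qed (use \<open>E \<noteq> 0\<close> True E deg in \<open>auto simp: monics_def lead_coeff_mult\<close>)
  then show ?thesis using True by (simp add: coeff_sum_def mult sum_distrib_left)
next
  case False
  have "{A\<in>monics n. E dvd A} = {}"
  proof -
    have "degree E \<le> degree A" if "E dvd A" "lead_coeff A = 1" for A
      using that by (intro dvd_imp_degree_le) auto
    then show ?thesis using False by (auto simp: monics_def)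
  qed
  then show ?thesis using False by (simp only:) simp
qed

text \<open>This is x L' = L (x L'/L), coefficient by coefficient, for the L-series of a completely
  multiplicative function. Inserting the identity for deg A and collecting the multiples of each P^j
  produces the convolution.\<close>

lemma coeff_sum_recurrence:
  fixes \<psi> :: "'a::{finite,field} poly \<Rightarrow> int"
  assumes mult: "\<And>A B. \<psi> (A * B) = \<psi> A * \<psi> B" and one: "\<psi> 1 = 1"
  shows "int n * coeff_sum \<psi> n = (\<Sum>k\<in>{1..n}. prime_power_sum \<psi> k * coeff_sum \<psi> (n - k))"
proof -
  have pow: "\<psi> (A ^ j) = \<psi> A ^ j" for A j by (induction j) (auto simp: mult one)
  let ?I = "primes_upto n :: 'a poly set"
  have irr: "irreducible P" "lead_coeff P = 1" "degree P > 0" if "P \<in> ?I" for P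
    using that by (auto simp: primes_upto_def irreducible_degree_pos)
  have deg: "degree (P ^ j) = j * degree P" if "P \<in> ?I" for P j
    using irr(1)[OF that] by (subst degree_power_eq) auto
  have "int n * coeff_sum \<psi> n = (\<Sum>A\<in>monics n. int (degree A) * \<psi> A)"
    by (simp add: coeff_sum_def sum_distrib_left monics_def)
  also have "\<dots> = (\<Sum>A\<in>monics n. \<Sum>P\<in>?I. \<Sum>j\<in>{1..n}. if P ^ j dvd A then int (degree P) * \<psi> A else 0)"
  proof (rule sum.cong)
    fix A :: "'a poly" assume A: "A \<in> monics n"
    have "int (degree A) = int (\<Sum>P\<in>?I. \<Sum>j\<in>{1..n}. if P ^ j dvd A then degree P else 0)"
      using A by (subst degree_eq_sum_prime_powers) (auto simp: monics_def)
    then show "int (degree A) * \<psi> A = (\<Sum>P\<in>?I. \<Sum>j\<in>{1..n}. if P ^ j dvd A then int (degree P) * \<psi> A else 0)"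
      by (simp only: of_nat_sum sum_distrib_right) (simp add: if_distrib[of int] if_distrib[of "\<lambda>x. x * _"] cong: if_cong)
  qed simp
  also have "\<dots> = (\<Sum>P\<in>?I. \<Sum>j\<in>{1..n}. \<Sum>A\<in>monics n. if P ^ j dvd A then int (degree P) * \<psi> A else 0)"
    by (subst sum.swap, rule sum.cong[OF refl], rule sum.swap)
  also have "\<dots> = (\<Sum>P\<in>?I. \<Sum>j\<in>{1..n}. int (degree P) * (\<Sum>A\<in>{A\<in>monics n. P ^ j dvd A}. \<psi> A))"
    by (auto simp: sum_distrib_left sum.inter_filter intro!: sum.cong)
  also have "\<dots> = (\<Sum>P\<in>?I. \<Sum>j\<in>{1..n}. if j * degree P \<le> n
      then int (degree P) * \<psi> P ^ j * coeff_sum \<psi> (n - j * degree P) else 0)"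
  proof (intro sum.cong refl)
    fix P :: "'a poly" and j assume P: "P \<in> ?I"
    have "lead_coeff (P ^ j) = 1" using irr[OF P] by (simp add: lead_coeff_power)
    from sum_monics_dvd[OF mult this, of n]
    show "int (degree P) * (\<Sum>A\<in>{A\<in>monics n. P ^ j dvd A}. \<psi> A) = (if j * degree P \<le> n
        then int (degree P) * \<psi> P ^ j * coeff_sum \<psi> (n - j * degree P) else 0)"
      by (simp add: pow deg[OF P])
  qed
  also have "\<dots> = (\<Sum>P\<in>?I. \<Sum>j\<in>{1..n}. \<Sum>k\<in>{1..n}. if k = j * degree P
      then int (degree P) * \<psi> P ^ j * coeff_sum \<psi> (n - k) else 0)"
  proof (intro sum.cong refl)
    fix P :: "'a poly" and j assume P: "P \<in> ?I" and j: "j \<in> {1..n}"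
    have "j * degree P \<ge> 1" using irr(3)[OF P] j by simp
    then show "(if j * degree P \<le> n
      then int (degree P) * \<psi> P ^ j * coeff_sum \<psi> (n - j * degree P) else 0) =
      (\<Sum>k\<in>{1..n}. if k = j * degree P
      then int (degree P) * \<psi> P ^ j * coeff_sum \<psi> (n - k) else 0)"
      by (simp add: sum.delta')
  qed
  also have "\<dots> = (\<Sum>P\<in>?I. \<Sum>k\<in>{1..n}. \<Sum>j\<in>{1..n}. if k = j * degree P
      then int (degree P) * \<psi> P ^ j * coeff_sum \<psi> (n - k) else 0)"
    by (rule sum.cong[OF refl], rule sum.swap)
  also have "\<dots> = (\<Sum>k\<in>{1..n}. \<Sum>P\<in>?I. \<Sum>j\<in>{1..n}. if k = j * degree P
      then int (degree P) * \<psi> P ^ j * coeff_sum \<psi> (n - k) else 0)"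
    by (rule sum.swap)
  also have "\<dots> = (\<Sum>k\<in>{1..n}. prime_power_sum \<psi> k * coeff_sum \<psi> (n - k))"
  proof (rule sum.cong[OF refl])
    fix k assume k: "k \<in> {1..n}"
    have inner: "(\<Sum>j\<in>{1..n}. if k = j * degree P
        then int (degree P) * \<psi> P ^ j * coeff_sum \<psi> (n - k) else 0) =
      (if degree P dvd k then int (degree P) * \<psi> P ^ (k div degree P) * coeff_sum \<psi> (n - k) else 0)"
      if P: "P \<in> ?I" for P
    proof (cases "degree P dvd k")
      case True
      then obtain i where i: "k = degree P * i" by auto
      have d: "degree P > 0" using irr(3)[OF P] .
      have "1 \<le> i" using i k by (cases i) auto
      moreover have "i \<le> k" unfolding i using d by simp
      ultimately have i': "i \<in> {1..n}" using k by auto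
      have "(k = j * degree P) = (j = i)" for j using i d by auto
      then have "(\<Sum>j\<in>{1..n}. if k = j * degree P
          then int (degree P) * \<psi> P ^ j * coeff_sum \<psi> (n - k) else 0) =
        int (degree P) * \<psi> P ^ i * coeff_sum \<psi> (n - k)"
        using i' by (simp only: sum.delta' finite_atLeastAtMost) simp
      moreover have "k div degree P = i" using i d by simp
      ultimately show ?thesis using True by simp
    next
      case False
      then have "k \<noteq> j * degree P" for j by (metis dvd_triv_right)
      then show ?thesis using False by simp
    qed
    have "primes_dvd k \<subseteq> ?I" using k by (auto simp: primes_dvd_def primes_upto_def dest: dvd_imp_le)
    then have "primes_dvd k = {P\<in>?I. degree P dvd k}" by (auto simp: primes_dvd_def primes_upto_def)
    then have "prime_power_sum \<psi> k * coeff_sum \<psi> (n - k) =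
      (\<Sum>P\<in>{P\<in>?I. degree P dvd k}. int (degree P) * \<psi> P ^ (k div degree P) * coeff_sum \<psi> (n - k))"
      by (simp add: prime_power_sum_def sum_distrib_right)
    also have "\<dots> = (\<Sum>P\<in>?I. if degree P dvd k then int (degree P) * \<psi> P ^ (k div degree P) * coeff_sum \<psi> (n - k) else 0)"
      by (simp add: sum.inter_filter)
    finally show "(\<Sum>P\<in>?I. \<Sum>j\<in>{1..n}. if k = j * degree P
        then int (degree P) * \<psi> P ^ j * coeff_sum \<psi> (n - k) else 0) =
        prime_power_sum \<psi> k * coeff_sum \<psi> (n - k)" using inner by simp
  qed
  finally show ?thesis .
qed

text \<open>Apply the recurrence to the constant function 1: its coefficient sums are q^n, which
  forces the power sums to be q^n as well.\<close>

lemma sum_degree_primes_dvd: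
  assumes "n > 0"
  shows "(\<Sum>P\<in>(primes_dvd n :: 'a::{finite,field} poly set). degree P) = CARD('a) ^ n"
proof -
  let ?\<psi> = "\<lambda>_::'a poly. 1 :: int"
  have c: "coeff_sum ?\<psi> n = int CARD('a) ^ n" for n
    by (simp add: coeff_sum_def card_monics)
  have "prime_power_sum ?\<psi> n = int CARD('a) ^ n"
    using assms
  proof (induction n rule: less_induct)
    case (less n)
    have "int n * int CARD('a) ^ n = (\<Sum>k\<in>{1..n}. prime_power_sum ?\<psi> k * int CARD('a) ^ (n - k))"
      using coeff_sum_recurrence[of ?\<psi> n] by (simp add: c)
    also have "\<dots> = prime_power_sum ?\<psi> n + (\<Sum>k\<in>{1..<n}. prime_power_sum ?\<psi> k * int CARD('a) ^ (n - k))"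
      using less.prems by (subst atLeastLessThanSuc_atLeastAtMost[symmetric], subst sum.atLeastLessThan_Suc) auto
    also have "(\<Sum>k\<in>{1..<n}. prime_power_sum ?\<psi> k * int CARD('a) ^ (n - k)) = (\<Sum>k\<in>{1..<n}. int CARD('a) ^ n)"
      using less.IH by (intro sum.cong) (auto simp flip: power_add)
    also have "\<dots> = (int n - 1) * int CARD('a) ^ n" using less.prems by (simp add: of_nat_diff)
    finally show ?case by (simp add: algebra_simps)
  qed
  then have "int (\<Sum>P\<in>(primes_dvd n :: 'a poly set). degree P) = int (CARD('a) ^ n)"
    by (simp add: prime_power_sum_def)
  then show ?thesis by (simp only: of_nat_eq_iff)
qed

lemma prime_power_sum_cong:
  assumes "\<And>P. P \<in> primes_dvd n \<Longrightarrow> \<psi> P ^ (n div degree P) = \<psi>' P ^ (n div degree P)"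
  shows "prime_power_sum \<psi> n = prime_power_sum \<psi>' n"
  using assms by (simp add: prime_power_sum_def)

section \<open>From Stepanov's bound to a two-sided count\<close>

definition jacobi :: "'a::{finite,field} poly set \<Rightarrow> 'a poly \<Rightarrow> int" where
  "jacobi T A = (\<Prod>R\<in>T. quad_char R A)"

lemma prod_range: "(\<And>x. x \<in> I \<Longrightarrow> g x \<in> {-1, 0, 1::int}) \<Longrightarrow> (\<Prod>x\<in>I. g x) \<in> {-1, 0, 1}"
  by (induction I rule: infinite_finite_induct) fastforce+

lemma jacobi_range: "jacobi T A \<in> {-1, 0, 1}"
  unfolding jacobi_def by (rule prod_range) (rule quad_char_range)

text \<open>The condition on positivity separates 0^0 = 1 from the other powers of 0.\<close>

lemma power_same_parity:
  assumes "c \<in> {-1, 0, 1::int}" "even i \<longleftrightarrow> even j" "i > 0 \<longleftrightarrow> j > 0"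
  shows "c ^ i = c ^ j"
  using assms by (auto simp: minus_one_power_iff power_0_left)

lemma power_range: "c \<in> {-1, 0, 1::int} \<Longrightarrow> c ^ k \<in> {-1, 0, 1}"
  by (induction k) auto

locale prime_set =
  fixes T :: "'a::{finite,field} poly set"
  assumes odd: "odd CARD('a)" and finite_T: "finite T" and T_nonempty: "T \<noteq> {}"
    and T: "\<And>R. R \<in> T \<Longrightarrow> irreducible R \<and> lead_coeff R = 1"
begin

abbreviation "f \<equiv> \<Prod>T"

lemma f_nonzero: "f \<noteq> 0"
proof -
  have "0 \<notin> T" using T[of 0] by auto
  then show ?thesis using finite_T by auto
qed

lemma degree_f: "degree f = (\<Sum>R\<in>T. degree R)"
proof -
  have "R \<noteq> 0" if "R \<in> T" for R using T[OF that] by auto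
  then show ?thesis using degree_prod_eq_sum_degree[of T "\<lambda>x. x"] by simp
qed

lemma degree_f_pos: "degree f > 0"
proof -
  obtain P where P: "P \<in> T" using T_nonempty by auto
  have "degree P \<le> degree f" unfolding degree_f using finite_T P by (simp add: member_le_sum)
  then show ?thesis using irreducible_degree_pos T[OF P] by fastforce
qed

text \<open>Euler's criterion in the field with q^n elements, which contains the residue field of P.
  Its exponent is the one for P times a sum of k = n / deg P odd numbers, so the symbol is raised to
  a power of the same parity as k.\<close>

lemma quad_char_f_power:
  assumes P: "P \<in> primes_dvd n" and n: "n > 0"
  shows "P dvd f ^ ((CARD('a) ^ n - 1) div 2) - [:of_int (quad_char P f ^ (n div degree P)):]"
proof -
  let ?q = "CARD('a)" and ?d = "degree P"
  have irr: "irreducible P" and d: "?d > 0" using P by (auto simp: primes_dvd_def irreducible_degree_pos)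
  obtain k where k: "n = ?d * k" using P by (auto simp: primes_dvd_def)
  have k0: "k > 0" using n k by (cases k) auto
  have Q: "odd (?q ^ ?d)" "?q ^ ?d > 1"
    using odd d card_field_ge2[where 'a='a] one_less_power[of "CARD('a)" ?d] by auto
  define S where "S = (\<Sum>i<k. (?q ^ ?d) ^ i)"
  have S: "(?q ^ n - 1) div 2 = (?q ^ ?d - 1) div 2 * S"
    using odd_card_power_half(3)[OF Q k0] by (simp add: k power_mult S_def)
  have "even S \<longleftrightarrow> even k"
    unfolding S_def using Q(1) by (induction k) auto
  moreover have "S > 0"
  proof -
    have "(?q ^ ?d) ^ 0 \<le> S" unfolding S_def using k0 by (intro member_le_sum) auto
    then show ?thesis by simp
  qed
  ultimately have pw: "quad_char P f ^ S = quad_char P f ^ k"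
    using k0 by (intro power_same_parity) (auto simp: quad_char_def)
  have "ac_eval (poly_root P) (f ^ ((?q ^ n - 1) div 2)) = (ac_eval (poly_root P) f ^ ((?q ^ ?d - 1) div 2)) ^ S"
    by (simp only: S ac_eval_power power_mult)
  also have "\<dots> = of_int (quad_char P f ^ S)" by (simp only: of_int_power euler_criterion[OF odd irr])
  also have "\<dots> = ac_eval (poly_root P) [:of_int (quad_char P f ^ k):]" by (simp only: pw ac_eval_const to_ac_of_int)
  finally have "ac_eval (poly_root P) (f ^ ((?q ^ n - 1) div 2)) =
      ac_eval (poly_root P) [:of_int (quad_char P f ^ k):]" .
  moreover have "n div ?d = k" using k d by simp
  ultimately show ?thesis using irr by (simp only: ac_eval_poly_root_eq_iff)
qed

text \<open>Stepanov's bound holds for the values 1 and -1 alike, and the total is known, so the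
  upper bound for one is a lower bound for the other. The exponent is even because the method needs
  the field size to be the square of M.\<close>

lemma weil_count:
  assumes h: "CARD('a) ^ m = 2 * h + 1" "h \<ge> 2 * degree f"
  shows "\<bar>prime_power_sum (\<lambda>P. quad_char P f) (2 * m)\<bar> \<le> 3 * int (degree f) * int (CARD('a) ^ m)"
    and "\<exists>P\<in>primes_dvd (2 * m). quad_char P f ^ (2 * m div degree P) = -1"
proof -
  define M where "M = CARD('a) ^ m"
  define n where "n = 2 * m"
  define D where "D = degree f"
  define \<kappa> where "\<kappa> = (\<lambda>P. quad_char P f ^ (n div degree P))"
  have D0: "D > 0" using degree_f_pos by (simp add: D_def)
  have m: "m > 0" using h D0 by (cases m) (auto simp: D_def)
  then have n: "n > 0" by (simp add: n_def)
  define N where "N = (\<lambda>a. \<Sum>P\<in>{P\<in>primes_dvd n. \<kappa> P = a}. degree P)"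
  have bound: "N a \<le> (h + D) * M + D * h + h" if a: "a\<^sup>2 = 1" for a
    unfolding N_def D_def
  proof (rule stepanov_bound[OF odd finite_T T_nonempty T refl, where a = "of_int a" and m = m])
    show "(of_int a :: 'a)\<^sup>2 = 1" using a by (metis of_int_1 of_int_power)
    show "M = CARD('a) ^ m" "M = 2 * h + 1" using h by (auto simp: M_def)
    show "2 * degree f \<le> h" using h by simp
    show "finite {P\<in>primes_dvd n. \<kappa> P = a}" using n by simp
    fix P assume P: "P \<in> {P\<in>primes_dvd n. \<kappa> P = a}"
    have "M\<^sup>2 = CARD('a) ^ n" by (simp add: M_def n_def power_mult[symmetric] mult.commute)
    moreover have "P dvd f ^ ((CARD('a) ^ n - 1) div 2) - [:of_int (\<kappa> P):]"
      using quad_char_f_power[of P n] n P unfolding \<kappa>_def by blast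
    moreover have "\<kappa> P = a" using P by blast
    ultimately have "P dvd f ^ ((M\<^sup>2 - 1) div 2) - [:of_int a:]" by (simp only:)
    then show "irreducible P \<and> lead_coeff P = 1 \<and> degree P dvd 2 * m \<and>
        P dvd f ^ ((M\<^sup>2 - 1) div 2) - [:of_int a:]" using P by (simp add: primes_dvd_def n_def)
  qed
  have N0: "N 0 \<le> D"
    unfolding N_def D_def
  proof (rule sum_degree_le)
    fix P assume "P \<in> {P\<in>primes_dvd n. \<kappa> P = 0}"
    then show "irreducible P \<and> lead_coeff P = 1 \<and> P dvd f"
      by (auto simp: primes_dvd_def quad_char_eq_0_iff \<kappa>_def)
  qed (use n f_nonzero in auto)
  have split: "(\<Sum>P\<in>primes_dvd n. g P) = (\<Sum>P\<in>{P\<in>primes_dvd n. \<kappa> P = 1}. g P) +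
      (\<Sum>P\<in>{P\<in>primes_dvd n. \<kappa> P = -1}. g P) + (\<Sum>P\<in>{P\<in>primes_dvd n. \<kappa> P = 0}. g P)"
    for g :: "'a poly \<Rightarrow> 'b::comm_monoid_add"
  proof -
    have range: "\<kappa> P \<in> {-1, 0, 1}" for P unfolding \<kappa>_def by (rule power_range) (rule quad_char_range)
    have "primes_dvd n = ({P\<in>primes_dvd n. \<kappa> P = 1} \<union> {P\<in>primes_dvd n. \<kappa> P = -1}) \<union> {P\<in>primes_dvd n. \<kappa> P = 0}"
      using range by auto
    then have "(\<Sum>P\<in>primes_dvd n. g P) = sum g (({P\<in>primes_dvd n. \<kappa> P = 1} \<union> {P\<in>primes_dvd n. \<kappa> P = -1}) \<union> {P\<in>primes_dvd n. \<kappa> P = 0})"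
      by (rule arg_cong)
    also have "\<dots> = sum g ({P\<in>primes_dvd n. \<kappa> P = 1} \<union> {P\<in>primes_dvd n. \<kappa> P = -1}) + (\<Sum>P\<in>{P\<in>primes_dvd n. \<kappa> P = 0}. g P)"
      using n by (intro sum.union_disjoint) auto
    also have "sum g ({P\<in>primes_dvd n. \<kappa> P = 1} \<union> {P\<in>primes_dvd n. \<kappa> P = -1}) =
       (\<Sum>P\<in>{P\<in>primes_dvd n. \<kappa> P = 1}. g P) + (\<Sum>P\<in>{P\<in>primes_dvd n. \<kappa> P = -1}. g P)"
      using n by (intro sum.union_disjoint) auto
    finally show ?thesis .
  qed
  have total: "N 1 + N (-1) + N 0 = M * M"
    using sum_degree_primes_dvd[OF n, where 'a='a] split[of degree]
    by (simp add: N_def M_def n_def power_add[symmetric] mult_2)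
  have S: "prime_power_sum (\<lambda>P. quad_char P f) (2 * m) = int (N 1) - int (N (-1))"
    unfolding prime_power_sum_def n_def[symmetric] split by (simp add: N_def sum_negf flip: \<kappa>_def[THEN fun_cong])
  have M: "M = 2 * h + 1" using h by (simp add: M_def)
  \<comment> \<open>Since N(1) - N(-1) = 2 N(1) + N(0) - M^2, and likewise with 1 and -1 exchanged,
    this makes the difference less than 3 D M in absolute value.\<close>
  have key: "2 * ((h + D) * M + D * h + h) + D + 1 = M * M + 3 * D * M"
    by (simp add: M algebra_simps)
  show "\<bar>prime_power_sum (\<lambda>P. quad_char P f) (2 * m)\<bar> \<le> 3 * int (degree f) * int (CARD('a) ^ m)"
  proof -
    have "N 1 \<le> N (-1) + 3 * D * M" "N (-1) \<le> N 1 + 3 * D * M"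
      using bound[of 1] bound[of "-1"] N0 total key by simp_all
    then have "\<bar>int (N 1) - int (N (-1))\<bar> \<le> int (3 * D * M)" by linarith
    then show ?thesis unfolding S by (simp add: D_def M_def)
  qed
  \<comment> \<open>Otherwise the value 1 alone would account for all of M^2 except at most D, but
    it can have only about half; this gives M \<le> 4 D, against M = 2h + 1 and h \<ge> 2 D.\<close>
  have "N (-1) > 0"
  proof (rule ccontr)
    assume "\<not> N (-1) > 0"
    then have "M * M \<le> (h + D) * M + D * h + h + D" using total N0 bound[of 1] by simp
    then have "2 * (M * M) \<le> 2 * ((h + D) * M + D * h + h + D)" by simp
    then have "M * M \<le> 3 * D * M + D" using key by simp
    also have "\<dots> \<le> 3 * D * M + 1 * (D * M)" using M by simp
    also have "\<dots> = (4 * D) * M" by simp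
    finally have "M * M \<le> (4 * D) * M" .
    moreover have "M > 0" using M by simp
    ultimately have "M \<le> 4 * D" by (metis mult_le_cancel2)
    then show False using M h by (simp add: D_def)
  qed
  then have "{P\<in>primes_dvd n. \<kappa> P = -1} \<noteq> {}" unfolding N_def by (metis less_irrefl sum.empty)
  then show "\<exists>P\<in>primes_dvd (2 * m). quad_char P f ^ (2 * m div degree P) = -1"
    by (auto simp: n_def \<kappa>_def)
qed

end

section \<open>Jacobi symbols\<close>

context prime_set
begin

lemma jacobi_mult: "jacobi T (A * B) = jacobi T A * jacobi T B"
  unfolding jacobi_def using quad_char_mult[OF odd] T by (simp add: prod.distrib)

lemma jacobi_1: "jacobi T 1 = 1"
  unfolding jacobi_def using quad_char_1[OF odd] T by simp

lemma jacobi_cong: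
  assumes "f dvd A - B"
  shows "jacobi T A = jacobi T B"
  unfolding jacobi_def
proof (rule prod.cong)
  fix R assume "R \<in> T"
  then have "R dvd f" using finite_T by (metis dvd_prodI)
  then show "quad_char R A = quad_char R B" using assms by (intro quad_char_cong) (rule dvd_trans)
qed simp

lemma jacobi_reciprocity:
  assumes P: "irreducible P" "lead_coeff P = 1"
  shows "jacobi T P = (-1) ^ ((CARD('a) - 1) div 2 * degree P * degree f) * quad_char P f"
proof -
  let ?s = "\<lambda>R. (-1) ^ ((CARD('a) - 1) div 2 * degree P * degree R) :: int"
  have "quad_char P f = (\<Prod>R\<in>T. quad_char P R)" by (rule quad_char_prod[OF odd P(1)])
  also have "\<dots> = (\<Prod>R\<in>T. ?s R * quad_char R P)"
    using quadratic_reciprocity_poly[OF odd P] T by (intro prod.cong) auto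
  also have "\<dots> = ?s f * jacobi T P"
    unfolding prod.distrib jacobi_def degree_f by (simp add: power_sum sum_distrib_left)
  finally have "?s f * quad_char P f = (?s f * ?s f) * jacobi T P" by simp
  also have "?s f * ?s f = 1" by (simp add: power_mult_distrib[symmetric])
  finally show ?thesis by simp
qed

text \<open>The reciprocity sign, raised to n / deg P, gets an exponent divisible by deg P (n / deg
  P) = n and disappears for even n.\<close>

lemma prime_power_sum_jacobi:
  assumes "n > 0" "even n"
  shows "prime_power_sum (jacobi T) n = prime_power_sum (\<lambda>P. quad_char P f) n"
proof (rule prime_power_sum_cong)
  fix P :: "'a poly" assume P: "P \<in> primes_dvd n"
  then have irr: "irreducible P" "lead_coeff P = 1" and dvd: "degree P dvd n"
    by (auto simp: primes_dvd_def)
  have "jacobi T P ^ (n div degree P) =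
    ((-1) ^ ((CARD('a) - 1) div 2 * degree P * degree f)) ^ (n div degree P) * quad_char P f ^ (n div degree P)"
    unfolding jacobi_reciprocity[OF irr] by (rule power_mult_distrib)
  also have "((-1) ^ ((CARD('a) - 1) div 2 * degree P * degree f)) ^ (n div degree P) =
     (-1::int) ^ ((CARD('a) - 1) div 2 * degree f * (degree P * (n div degree P)))"
    by (simp only: power_mult[symmetric] mult_ac)
  also have "\<dots> = 1" using assms dvd by simp
  finally show "jacobi T P ^ (n div degree P) = quad_char P f ^ (n div degree P)" by simp
qed

lemma exists_large:
  "\<exists>m0>0. \<forall>m\<ge>m0. \<exists>h. CARD('a) ^ m = 2 * h + 1 \<and> h \<ge> 2 * degree f"
proof (rule exI[of _ "4 * degree f + 1"], intro conjI allI impI)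
  fix m assume m: "m \<ge> 4 * degree f + 1"
  have "odd (CARD('a) ^ m)" using odd by simp
  then obtain h where h: "CARD('a) ^ m = 2 * h + 1" by (elim oddE)
  have "m < 2 ^ m" by (rule less_exp)
  also have "\<dots> \<le> CARD('a) ^ m" using card_field_ge2[where 'a='a] by (intro power_mono) auto
  finally have "4 * degree f + 1 < 2 * h + 1" using m h by simp
  then show "\<exists>h. CARD('a) ^ m = 2 * h + 1 \<and> h \<ge> 2 * degree f" using h by (intro exI[of _ h]) auto
qed simp

text \<open>The nonresidue comes out of Stepanov's count. A prime whose symbol has power -1 has n /
  deg P odd with n even, hence even degree, so reciprocity involves no sign.\<close>

lemma exists_jacobi_minus_one: "\<exists>B. jacobi T B = -1"
proof -
  obtain m0 where m0: "m0 > 0" "\<And>m. m \<ge> m0 \<Longrightarrow> \<exists>h. CARD('a) ^ m = 2 * h + 1 \<and> h \<ge> 2 * degree f"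
    using exists_large by blast
  obtain h where h: "CARD('a) ^ m0 = 2 * h + 1" "h \<ge> 2 * degree f" using m0(2) by blast
  let ?n = "2 * m0"
  obtain P where P: "P \<in> primes_dvd ?n" "quad_char P f ^ (?n div degree P) = -1"
    using weil_count(2)[OF h] by blast
  have irr: "irreducible P" "lead_coeff P = 1" and dvd: "degree P dvd ?n"
    using P by (auto simp: primes_dvd_def)
  have "odd (?n div degree P)"
    using P(2) zero_le_even_power[of "?n div degree P" "quad_char P f"] by fastforce
  moreover have "?n = degree P * (?n div degree P)" using dvd by simp
  ultimately have "even (degree P)" by (metis dvd_triv_left even_mult_iff)
  then have "jacobi T P = quad_char P f" unfolding jacobi_reciprocity[OF irr] by simp
  moreover have "quad_char P f = -1"
    using quad_char_range[of P f] P(2) \<open>odd (?n div degree P)\<close> by (auto simp: power_0_left split: if_splits)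
  ultimately show ?thesis by auto
qed

text \<open>Multiplication by \<open>B0\<close>, which is coprime to f, permutes the residues and
  negates every symbol.\<close>

lemma sum_residues_jacobi: "(\<Sum>B\<in>{B::'a poly. degree B < degree f}. jacobi T B) = 0"
proof -
  let ?R = "{B::'a poly. degree B < degree f}"
  obtain B0 where B0: "jacobi T B0 = -1" using exists_jacobi_minus_one by auto
  have fin: "finite ?R" using card_poly_degree_less(1)[OF degree_f_pos] .
  have mod: "(B0 * B) mod f \<in> ?R" for B
    using degree_f_pos degree_mod_less[OF f_nonzero, of "B0 * B"] by fastforce
  have "inj_on (\<lambda>B. (B0 * B) mod f) ?R"
  proof (rule inj_onI)
    fix x y assume xy: "x \<in> ?R" "y \<in> ?R" "(B0 * x) mod f = (B0 * y) mod f"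
    then have "f dvd B0 * (x - y)" by (metis mod_eq_dvd_iff right_diff_distrib)
    have "f dvd x - y"
    proof (rule prod_monic_irreducibles_dvd[OF finite_T])
      fix R assume R: "R \<in> T"
      have "\<not> R dvd B0"
      proof
        assume "R dvd B0"
        then have "jacobi T B0 = 0"
          unfolding jacobi_def using finite_T R by (auto simp: quad_char_eq_0_iff)
        then show False using B0 by simp
      qed
      moreover have "R dvd B0 * (x - y)"
        using \<open>f dvd B0 * (x - y)\<close> finite_T R by (metis dvd_prodI dvd_trans)
      moreover have "prime_elem R" using T[OF R] by (simp add: field_poly_irreducible_imp_prime)
      ultimately have "R dvd x - y" by (simp add: prime_elem_dvd_mult_iff)
      then show "irreducible R \<and> lead_coeff R = 1 \<and> R dvd x - y" using T[OF R] by simp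
    qed
    moreover have "degree (x - y) < degree f" using xy by (auto intro: degree_diff_less)
    ultimately show "x = y" using dvd_imp_degree_le[of f "x - y"] by force
  qed
  then have "bij_betw (\<lambda>B. (B0 * B) mod f) ?R ?R"
    unfolding bij_betw_def using mod by (auto intro!: endo_inj_surj[OF fin])
  then have "(\<Sum>B\<in>?R. jacobi T B) = (\<Sum>B\<in>?R. jacobi T ((B0 * B) mod f))"
    by (rule sum.reindex_bij_betw[symmetric])
  also have "\<dots> = (\<Sum>B\<in>?R. - jacobi T B)"
  proof (rule sum.cong)
    fix B
    have "jacobi T ((B0 * B) mod f) = jacobi T (B0 * B)"
      by (rule jacobi_cong) (simp add: mod_eq_dvd_iff[symmetric])
    then show "jacobi T ((B0 * B) mod f) = - jacobi T B" by (simp add: jacobi_mult B0)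
  qed simp
  also have "\<dots> = - (\<Sum>B\<in>?R. jacobi T B)" by (simp add: sum_negf)
  finally show ?thesis by simp
qed

text \<open>Writing A = f C + B splits the monic polynomials of degree n into complete residue
  systems modulo f. The L-series is therefore a polynomial.\<close>

lemma coeff_sum_jacobi_eq_0:
  assumes n: "n \<ge> degree f"
  shows "coeff_sum (jacobi T) n = 0"
proof -
  let ?R = "{B::'a poly. degree B < degree f}"
  have lf: "lead_coeff f = 1" using T by (simp add: lead_coeff_prod prod.neutral)
  have degs: "degree (f * C + B) = n" "lead_coeff (f * C + B) = 1"
    if "C \<in> monics (n - degree f)" "B \<in> ?R" for B C
  proof -
    have C: "lead_coeff C = 1" "degree C = n - degree f" using that by (auto simp: monics_def)
    then have "C \<noteq> 0" by auto
    then have d: "degree (f * C) = n" using f_nonzero C n by (simp add: degree_mult_eq)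
    then show d': "degree (f * C + B) = n" using that n by (subst degree_add_eq_left) auto
    have "coeff (f * C) n = 1" using d C lf lead_coeff_mult[of f C] by simp
    then show "lead_coeff (f * C + B) = 1" using d' that n by (simp add: coeff_eq_0)
  qed
  have "coeff_sum (jacobi T) n = (\<Sum>(C::'a poly, B)\<in>monics (n - degree f) \<times> ?R. jacobi T B)"
    unfolding coeff_sum_def
  proof (rule sum.reindex_bij_witness[where S = "monics n" and T = "monics (n - degree f) \<times> ?R"
      and i = "\<lambda>(C, B). f * C + B" and j = "\<lambda>A. (A div f, A mod f)"])
    fix A :: "'a poly" assume A: "A \<in> monics n"
    then have AA: "lead_coeff A = 1" "degree A = n" by (auto simp: monics_def)
    have r: "A mod f \<in> ?R" using degree_f_pos degree_mod_less[OF f_nonzero, of A] by fastforce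
    have eq: "A = f * (A div f) + A mod f" by simp
    have dA: "degree (f * (A div f)) = n"
    proof -
      have "degree (A - A mod f) = degree A"
        using degree_add_eq_left[of "- (A mod f)" A] r AA n by simp
      then show ?thesis using AA by (simp add: minus_mod_eq_mult_div)
    qed
    then have "A div f \<noteq> 0" using degree_f_pos n by (metis degree_0 less_le_not_le mult_zero_right)
    then have "degree (A div f) = n - degree f" using dA f_nonzero by (simp add: degree_mult_eq)
    moreover have "lead_coeff (A div f) = 1"
    proof -
      have "coeff A n = coeff (f * (A div f)) n + coeff (A mod f) n"
        by (subst eq) (simp only: coeff_add)
      moreover have "coeff (A mod f) n = 0" using r n by (intro coeff_eq_0) auto
      ultimately have "lead_coeff (f * (A div f)) = 1" using AA dA by simp
      then show ?thesis using lf by (simp add: lead_coeff_mult)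
    qed
    ultimately show "(\<lambda>A. (A div f, A mod f)) A \<in> monics (n - degree f) \<times> ?R"
      using r by (simp add: monics_def)
    show "(case (A div f, A mod f) of (C, B) \<Rightarrow> f * C + B) = A" by simp
    show "(case (A div f, A mod f) of (C, B) \<Rightarrow> jacobi T B) = jacobi T A"
      by (auto intro!: jacobi_cong simp: mod_eq_dvd_iff[symmetric])
  next
    fix CB :: "'a poly \<times> 'a poly" assume CB: "CB \<in> monics (n - degree f) \<times> ?R"
    then obtain C B where CB': "CB = (C, B)" "C \<in> monics (n - degree f)" "B \<in> ?R" by auto
    show "(case CB of (C, B) \<Rightarrow> f * C + B) \<in> monics n"
      using degs[OF CB'(2,3)] CB'(1) by (simp add: monics_def)
    have "(f * C + B) div f = C" "(f * C + B) mod f = B"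
      using CB'(3) f_nonzero by (simp_all add: div_poly_less mod_poly_less)
    then show "((case CB of (C, B) \<Rightarrow> f * C + B) div f, (case CB of (C, B) \<Rightarrow> f * C + B) mod f) = CB"
      using CB'(1) by simp
  qed
  also have "\<dots> = (\<Sum>C\<in>(monics (n - degree f) :: 'a poly set). \<Sum>B\<in>?R. jacobi T B)"
    by (rule sum.cartesian_product[symmetric])
  also have "\<dots> = 0" by (simp add: sum_residues_jacobi)
  finally show ?thesis .
qed

end

section \<open>Logarithmic derivatives of polynomials\<close>

text \<open>The identity x p'/p = sum of s_k x^k over k > 0, cleared of its denominator. The value
  of \<open>s\<close> at 0 is masked because sums such as that of a^k have a nonzero one.\<close>

definition log_deriv_coeffs :: "complex poly \<Rightarrow> (nat \<Rightarrow> complex) \<Rightarrow> bool" where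
  "log_deriv_coeffs p s \<longleftrightarrow>
     fps_X * fps_deriv (fps_of_poly p) = fps_of_poly p * Abs_fps (\<lambda>k. if k = 0 then 0 else s k)"

lemma log_deriv_coeffsI:
  assumes "\<And>n. of_nat n * coeff p n = (\<Sum>k\<in>{1..n}. s k * coeff p (n - k))"
  shows "log_deriv_coeffs p s"
  unfolding log_deriv_coeffs_def
proof (rule fps_ext)
  fix n
  have "(fps_of_poly p * Abs_fps (\<lambda>k. if k = 0 then 0 else s k)) $ n
      = (\<Sum>k=0..n. (if k = 0 then 0 else s k) * coeff p (n - k))"
    by (subst mult.commute) (simp add: fps_mult_nth)
  also have "\<dots> = (\<Sum>k\<in>{1..n}. s k * coeff p (n - k))"
    by (subst sum.atLeast_Suc_atMost) auto
  also have "\<dots> = of_nat n * coeff p n" using assms by simp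
  finally show "(fps_X * fps_deriv (fps_of_poly p)) $ n =
      (fps_of_poly p * Abs_fps (\<lambda>k. if k = 0 then 0 else s k)) $ n"
    by (cases n) (simp_all add: fps_deriv_nth)
qed

lemma log_deriv_coeffs_mult:
  assumes "log_deriv_coeffs p s" "log_deriv_coeffs r t"
  shows "log_deriv_coeffs (p * r) (\<lambda>k. s k + t k)"
proof -
  have eq: "Abs_fps (\<lambda>k. if k = 0 then 0 else s k + t k) =
      Abs_fps (\<lambda>k. if k = 0 then 0 else s k) + Abs_fps (\<lambda>k. if k = 0 then 0 else t k)"
    by (rule fps_ext) simp
  have "fps_X * fps_deriv (fps_of_poly (p * r)) =
      fps_of_poly p * (fps_X * fps_deriv (fps_of_poly r)) + (fps_X * fps_deriv (fps_of_poly p)) * fps_of_poly r"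
    by (simp add: fps_of_poly_mult algebra_simps)
  also have "\<dots> = fps_of_poly (p * r) * Abs_fps (\<lambda>k. if k = 0 then 0 else s k + t k)"
    using assms unfolding eq log_deriv_coeffs_def by (simp add: fps_of_poly_mult algebra_simps)
  finally show ?thesis by (simp add: log_deriv_coeffs_def)
qed

lemma log_deriv_coeffs_unique:
  assumes "log_deriv_coeffs p s" "log_deriv_coeffs p t" "p \<noteq> 0" "k > 0"
  shows "s k = t k"
proof -
  have "fps_of_poly p * Abs_fps (\<lambda>k. if k = 0 then 0 else s k) =
      fps_of_poly p * Abs_fps (\<lambda>k. if k = 0 then 0 else t k)"
    using assms by (simp add: log_deriv_coeffs_def)
  moreover have "fps_of_poly p \<noteq> 0" using assms(3) by simp
  ultimately have "Abs_fps (\<lambda>k. if k = 0 then 0 else s k) = Abs_fps (\<lambda>k. if k = 0 then 0 else t k)"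
    by (simp only: mult_cancel_left) auto
  then have "Abs_fps (\<lambda>k. if k = 0 then 0 else s k) $ k = Abs_fps (\<lambda>k. if k = 0 then 0 else t k) $ k"
    by simp
  then show ?thesis using assms(4) by simp
qed

lemma log_deriv_coeffs_linear: "log_deriv_coeffs [:1, - a:] (\<lambda>k. - (a ^ k))"
proof (rule log_deriv_coeffsI)
  fix n
  have "(\<Sum>k\<in>{1..n}. - (a ^ k) * coeff [:1, - a:] (n - k)) = of_nat n * coeff [:1, - a:] n"
  proof (cases "n \<le> 1")
    case True
    then show ?thesis by (cases n) auto
  next
    case False
    then have "(\<Sum>k\<in>{1..n}. - (a ^ k) * coeff [:1, - a:] (n - k)) =
        (\<Sum>k\<in>{n - 1, n}. - (a ^ k) * coeff [:1, - a:] (n - k))"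
      by (intro sum.mono_neutral_right) (auto simp: coeff_pCons split: nat.split)
    also have "\<dots> = 0" using False by (cases n) auto
    finally show ?thesis using False by (auto simp: coeff_pCons split: nat.split)
  qed
  then show "of_nat n * coeff [:1, - a:] n = (\<Sum>k\<in>{1..n}. - (a ^ k) * coeff [:1, - a:] (n - k))" ..
qed

lemma log_deriv_coeffs_prod_list:
  "log_deriv_coeffs (prod_list (map (\<lambda>a. [:1, - a:]) as)) (\<lambda>k. - (\<Sum>a\<leftarrow>as. a ^ k))"
proof (induction as)
  case Nil
  show ?case by (auto intro!: log_deriv_coeffsI)
next
  case (Cons a as)
  from log_deriv_coeffs_mult[OF log_deriv_coeffs_linear[of a] Cons] show ?case by simp
qed

lemma poly_factor_reciprocal_roots:
  fixes p :: "complex poly"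
  assumes "coeff p 0 = 1"
  shows "\<exists>as. length as = degree p \<and> p = prod_list (map (\<lambda>a. [:1, - a:]) as) \<and>
    (\<forall>a\<in>set as. a \<noteq> 0 \<and> poly p (inverse a) = 0)"
  using assms
proof (induction "degree p" arbitrary: p rule: less_induct)
  case less
  show ?case
  proof (cases "degree p = 0")
    case True
    then have "p = 1" using less.prems by (auto simp: one_pCons elim: degree_eq_zeroE)
    then show ?thesis by (intro exI[of _ "[]"]) auto
  next
    case False
    then obtain z where z: "poly p z = 0"
      using alg_closed_imp_poly_has_root[of p] by auto
    have z0: "z \<noteq> 0" using z less.prems by (auto simp: poly_0_coeff_0)
    obtain r where r: "p = [:- z, 1:] * r" using z by (auto simp: poly_eq_0_iff_dvd)
    define r' where "r' = smult (- z) r"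
    have p: "p = [:1, - inverse z:] * r'" using z0 unfolding r r'_def by (simp add: field_simps)
    have r'0: "coeff r' 0 = 1" using less.prems unfolding p by (simp add: coeff_mult)
    then have "r' \<noteq> 0" by auto
    then have d: "degree p = Suc (degree r')"
      unfolding p using z0 by (subst degree_mult_eq) auto
    then obtain as where as: "length as = degree r'" "r' = prod_list (map (\<lambda>a. [:1, - a:]) as)"
      "\<And>a. a \<in> set as \<Longrightarrow> a \<noteq> 0 \<and> poly r' (inverse a) = 0"
      using less.hyps[of r'] r'0 by auto
    show ?thesis
    proof (intro exI[of _ "inverse z # as"] conjI ballI)
      show "p = prod_list (map (\<lambda>a. [:1, - a:]) (inverse z # as))" using as(2) p by simp
      fix a assume "a \<in> set (inverse z # as)"
      then show "a \<noteq> 0" "poly p (inverse a) = 0" using as(3) z z0 p by auto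
    qed (use as d in auto)
  qed
qed

text \<open>At a zero of order \<open>m\<close> the left-hand side of \<open>x p' = p \<Sum>\<^sub>k s\<^sub>k x\<^sup>k\<close> vanishes only to
  order \<open>m - 1\<close>.\<close>

lemma log_deriv_zero_free:
  fixes p :: "complex poly"
  assumes ld: "log_deriv_coeffs p s" and p0: "coeff p 0 = 1"
    and conv: "\<And>z. norm z < R \<Longrightarrow> summable (\<lambda>k. s k * z ^ k)" and z: "norm z < R"
  shows "poly p z \<noteq> 0"
proof
  assume pz: "poly p z = 0"
  let ?S = "Abs_fps (\<lambda>k. if k = 0 then 0 else s k)"
  have pne: "p \<noteq> 0" using p0 by auto
  have z0: "z \<noteq> 0" using pz p0 by (auto simp: poly_0_coeff_0)
  have R: "fps_conv_radius ?S \<ge> R"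
    unfolding fps_conv_radius_def
  proof (rule conv_radius_geI_ex)
    fix r assume r: "0 < r" "ereal r < ereal R"
    have "summable (\<lambda>k. s k * of_real r ^ k)" using r by (intro conv) simp
    then have "summable (\<lambda>k. s (Suc k) * of_real r ^ Suc k)" by (subst summable_Suc_iff)
    then have "summable (\<lambda>k. (if Suc k = 0 then 0 else s (Suc k)) * of_real r ^ Suc k)" by simp
    then have "summable (\<lambda>k. (if k = 0 then 0 else s k) * of_real r ^ k)" by (subst (asm) summable_Suc_iff)
    then show "\<exists>z. norm z = r \<and> summable (\<lambda>n. fps_nth ?S n * z ^ n)"
      using r by (intro exI[of _ "of_real r"]) auto
  qed
  have ev: "w * poly (pderiv p) w = poly p w * eval_fps ?S w" if w: "norm w < R" for w
  proof -
    have "ereal (norm w) < fps_conv_radius ?S" using w by (intro less_le_trans[OF _ R]) simp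
    then have "eval_fps (fps_of_poly p * ?S) w = poly p w * eval_fps ?S w"
      by (subst eval_fps_mult) auto
    moreover have "eval_fps (fps_X * fps_deriv (fps_of_poly p)) w = w * poly (pderiv p) w"
    proof -
      have "fps_X * fps_deriv (fps_of_poly p) = fps_of_poly ([:0, 1:] * pderiv p)"
        by (simp only: fps_of_poly_mult fps_of_poly_pderiv fps_of_poly_fps_X)
      then show ?thesis by simp
    qed
    ultimately show ?thesis using ld by (simp add: log_deriv_coeffs_def)
  qed
  define m where "m = order z p"
  have m: "m > 0" using pz pne by (simp add: m_def order_root)
  obtain H where H: "p = [:- z, 1:] ^ m * H" "\<not> [:- z, 1:] dvd H"
    using order_decomp[OF pne, of z] unfolding m_def by auto
  have Hz: "poly H z \<noteq> 0" using H(2) by (simp add: poly_eq_0_iff_dvd)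
  obtain m' where m': "m = Suc m'" using m by (cases m) auto
  have dp: "poly (pderiv p) w = (w - z) ^ m' * (of_nat m * poly H w + (w - z) * poly (pderiv H) w)" for w
    unfolding H(1) m' by (simp only: pderiv_mult pderiv_power_Suc) (simp add: pderiv_pCons algebra_simps)
  \<comment> \<open>The common factor (w - z)^(m - 1) can be cancelled only off z. Letting w tend to
    z then leaves z m H(z) = 0, a contradiction.\<close>
  have eq: "w * (of_nat m * poly H w + (w - z) * poly (pderiv H) w) = (w - z) * poly H w * eval_fps ?S w"
    if w: "norm w < R" "w \<noteq> z" for w
  proof -
    have pw: "poly p w = (w - z) ^ m' * ((w - z) * poly H w)"
      unfolding H(1) m' by (simp only: poly_mult poly_power power_Suc) simp
    have "(w - z) ^ m' * (w * (of_nat m * poly H w + (w - z) * poly (pderiv H) w)) =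
        (w - z) ^ m' * ((w - z) * poly H w * eval_fps ?S w)"
      using ev[OF w(1)] unfolding dp pw by (simp only: mult_ac)
    then show ?thesis using w(2) by simp
  qed
  have cont: "isCont (eval_fps ?S) z"
    by (rule continuous_eval_fps) (rule less_le_trans[OF _ R], use z in simp)
  have "((\<lambda>w. w * (of_nat m * poly H w + (w - z) * poly (pderiv H) w) - (w - z) * poly H w * eval_fps ?S w)
      \<longlongrightarrow> z * (of_nat m * poly H z + (z - z) * poly (pderiv H) z) - (z - z) * poly H z * eval_fps ?S z) (at z)"
    using cont unfolding isCont_def by (intro tendsto_intros) auto
  moreover have "eventually (\<lambda>w. w * (of_nat m * poly H w + (w - z) * poly (pderiv H) w) - (w - z) * poly H w * eval_fps ?S w = 0) (at z)"
  proof -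
    have "eventually (\<lambda>w. w \<in> ball 0 R - {z}) (at z)"
      using z by (intro eventually_at_in_open) auto
    then show ?thesis by eventually_elim (use eq in auto)
  qed
  ultimately have "((\<lambda>_. 0) \<longlongrightarrow> z * (of_nat m * poly H z)) (at z)"
    by (subst (asm) tendsto_cong) auto
  then have "z * (of_nat m * poly H z) = 0" by (simp add: tendsto_const_iff)
  then show False using z0 Hz m by simp
qed

section \<open>The Weil bound\<close>

lemma monic_irreducibles_eq: "monic_irreducibles n = {P \<in> primes_dvd n. degree P = n}"
  by (auto simp: monic_irreducibles_def primes_dvd_def)

lemma finite_monic_irreducibles [simp]: "finite (monic_irreducibles n)"
proof -
  have "monic_irreducibles n \<subseteq> primes_upto n"
    by (auto simp: monic_irreducibles_def primes_upto_def)
  then show ?thesis by (rule finite_subset) simp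
qed

lemma card_monic_irreducibles_le: "n * card (monic_irreducibles n :: 'a::{finite,field} poly set) \<le> CARD('a) ^ n"
proof (cases "n = 0")
  case False
  have "n * card (monic_irreducibles n :: 'a poly set) = (\<Sum>P\<in>(monic_irreducibles n :: 'a poly set). degree P)"
    by (simp add: monic_irreducibles_def)
  also have "\<dots> \<le> (\<Sum>P\<in>(primes_dvd n :: 'a poly set). degree P)"
    using False by (intro sum_mono2) (auto simp: monic_irreducibles_eq)
  also have "\<dots> = CARD('a) ^ n" using False by (simp add: sum_degree_primes_dvd)
  finally show ?thesis .
qed simp

lemma sum_powers_le: "q \<ge> 2 \<Longrightarrow> (\<Sum>d\<in>{1..n}. q ^ d) \<le> 2 * (q::nat) ^ n"
proof (induction n)
  case (Suc n)
  have "2 * q ^ n \<le> q * q ^ n" using Suc.prems by (intro mult_right_mono) auto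
  moreover have "(\<Sum>d\<in>{1..Suc n}. q ^ d) = (\<Sum>d\<in>{1..n}. q ^ d) + q * q ^ n" by simp
  moreover have "(\<Sum>d\<in>{1..n}. q ^ d) \<le> 2 * q ^ n" using Suc by simp
  ultimately show ?case by (simp only: power_Suc)
qed simp

lemma sum_degree_proper_le:
  assumes n: "n > 0"
  shows "(\<Sum>P\<in>{P\<in>(primes_dvd n :: 'a::{finite,field} poly set). degree P \<noteq> n}. degree P) \<le> 2 * CARD('a) ^ (n div 2)"
proof -
  let ?A = "{P\<in>(primes_dvd n :: 'a poly set). degree P \<noteq> n}"
  have "?A \<subseteq> (\<Union>d\<in>{1..n div 2}. monic_irreducibles d :: 'a poly set)"
  proof
    fix P assume P: "P \<in> ?A"
    then have irr: "irreducible P" "lead_coeff P = 1" and dvd: "degree P dvd n" and ne: "degree P \<noteq> n"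
      by (auto simp: primes_dvd_def)
    obtain k where k: "n = degree P * k" using dvd by auto
    have "k \<noteq> 0" "k \<noteq> 1" using k n ne by auto
    then have "degree P * 2 \<le> degree P * k" by (intro mult_left_mono) auto
    then have "degree P * 2 \<le> n" using k by metis
    then have "degree P \<le> n div 2" by linarith
    moreover have "degree P > 0" using irr by (simp add: irreducible_degree_pos)
    ultimately show "P \<in> (\<Union>d\<in>{1..n div 2}. monic_irreducibles d :: 'a poly set)"
      using irr by (auto simp: monic_irreducibles_def)
  qed
  then have "(\<Sum>P\<in>?A. degree P) \<le> (\<Sum>P\<in>(\<Union>d\<in>{1..n div 2}. monic_irreducibles d :: 'a poly set). degree P)"
    by (intro sum_mono2) auto
  also have "\<dots> = (\<Sum>d\<in>{1..n div 2}. \<Sum>P\<in>(monic_irreducibles d :: 'a poly set). degree P)"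
    by (rule sum.UNION_disjoint, simp, simp, auto simp: monic_irreducibles_def)
  also have "\<dots> \<le> (\<Sum>d\<in>{1..n div 2}. CARD('a) ^ d)"
  proof (rule sum_mono)
    fix d
    have "(\<Sum>P\<in>(monic_irreducibles d :: 'a poly set). degree P) = d * card (monic_irreducibles d :: 'a poly set)"
      by (simp add: monic_irreducibles_def)
    then show "(\<Sum>P\<in>(monic_irreducibles d :: 'a poly set). degree P) \<le> CARD('a) ^ d"
      using card_monic_irreducibles_le by metis
  qed
  also have "\<dots> \<le> 2 * CARD('a) ^ (n div 2)" by (rule sum_powers_le) (rule card_field_ge2)
  finally show ?thesis .
qed

lemma power_half_le_sqrt: "real CARD('a::{finite,field}) ^ (n div 2) \<le> sqrt (real CARD('a)) ^ n"
proof -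
  have "real CARD('a) ^ (n div 2) = sqrt (real CARD('a)) ^ (2 * (n div 2))"
    by (simp add: power_mult)
  also have "\<dots> \<le> sqrt (real CARD('a)) ^ n"
    using card_field_ge2[where 'a='a] by (intro power_increasing) auto
  finally show ?thesis .
qed

lemma abs_le_1: "c \<in> {-1, 0, 1::int} \<Longrightarrow> \<bar>c\<bar> \<le> 1"
  by auto

text \<open>Primes whose degree is a proper divisor of n have degree at most n/2; their total degree
  is of order q^(n/2), the size of the error in the Weil bound, so passing to primes of degree
  exactly n costs nothing essential.\<close>

lemma prime_power_sum_approx:
  fixes \<psi> :: "'a::{finite,field} poly \<Rightarrow> int"
  assumes n: "n > 0" and \<psi>: "\<And>A. \<psi> A \<in> {-1, 0, 1}"
  shows "\<bar>real_of_int (prime_power_sum \<psi> n) - real n * (\<Sum>P\<in>monic_irreducibles n. real_of_int (\<psi> P))\<bar>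
    \<le> 2 * sqrt (real CARD('a)) ^ n"
proof -
  let ?A = "{P\<in>(primes_dvd n :: 'a poly set). degree P \<noteq> n}"
  let ?g = "\<lambda>P. int (degree P) * \<psi> P ^ (n div degree P)"
  have "primes_dvd n = monic_irreducibles n \<union> ?A" by (auto simp: monic_irreducibles_eq)
  then have "prime_power_sum \<psi> n = sum ?g (monic_irreducibles n \<union> ?A)"
    by (simp add: prime_power_sum_def)
  also have "\<dots> = sum ?g (monic_irreducibles n) + sum ?g ?A"
    using n by (intro sum.union_disjoint) (auto simp: monic_irreducibles_eq)
  also have "sum ?g (monic_irreducibles n) = int n * (\<Sum>P\<in>monic_irreducibles n. \<psi> P)"
    unfolding sum_distrib_left using n by (intro sum.cong) (auto simp: monic_irreducibles_def)
  finally have eq: "prime_power_sum \<psi> n = int n * (\<Sum>P\<in>monic_irreducibles n. \<psi> P) + sum ?g ?A" .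
  have "\<bar>sum ?g ?A\<bar> \<le> (\<Sum>P\<in>?A. \<bar>?g P\<bar>)" by (rule sum_abs)
  also have "\<dots> \<le> (\<Sum>P\<in>?A. int (degree P))"
  proof (rule sum_mono)
    fix P
    have "\<psi> P ^ (n div degree P) \<in> {-1, 0, 1}" by (rule power_range[OF \<psi>])
    then have "\<bar>\<psi> P ^ (n div degree P)\<bar> \<le> 1" by (rule abs_le_1)
    then have "int (degree P) * \<bar>\<psi> P ^ (n div degree P)\<bar> \<le> int (degree P) * 1" by (intro mult_left_mono) auto
    then show "\<bar>?g P\<bar> \<le> int (degree P)" by (simp add: abs_mult)
  qed
  also have "\<dots> \<le> int (2 * CARD('a) ^ (n div 2))"
    using sum_degree_proper_le[OF n, where 'a='a] by (simp only: of_nat_sum[symmetric] of_nat_le_iff)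
  finally have "\<bar>sum ?g ?A\<bar> \<le> int (2 * CARD('a) ^ (n div 2))" .
  then have "\<bar>real_of_int (sum ?g ?A)\<bar> \<le> real (2 * CARD('a) ^ (n div 2))" by linarith
  also have "\<dots> \<le> 2 * sqrt (real CARD('a)) ^ n" using power_half_le_sqrt[where 'a='a, of n] by simp
  finally have "\<bar>real_of_int (sum ?g ?A)\<bar> \<le> 2 * sqrt (real CARD('a)) ^ n" .
  then show ?thesis unfolding eq by simp
qed

lemma card_monic_irreducibles_ge:
  assumes "n > 0"
  shows "real CARD('a::{finite,field}) ^ n - 2 * sqrt (real CARD('a)) ^ n
    \<le> real n * real (card (monic_irreducibles n :: 'a poly set))"
proof -
  have "prime_power_sum (\<lambda>_::'a poly. 1) n = int (CARD('a) ^ n)"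
    unfolding prime_power_sum_def by (simp flip: of_nat_sum sum_degree_primes_dvd[OF assms, where 'a='a])
  then show ?thesis using prime_power_sum_approx[OF assms, of "\<lambda>_::'a poly. 1"] by simp
qed

section \<open>The L-polynomial, its zeros and its logarithm\<close>

context prime_set
begin

definition L_poly :: "complex poly" where
  "L_poly = (\<Sum>k<degree f. monom (of_int (coeff_sum (jacobi T) k)) k)"

lemma coeff_L_poly: "coeff L_poly k = of_int (coeff_sum (jacobi T) k)"
  using coeff_sum_jacobi_eq_0[of k] by (simp add: L_poly_def coeff_sum_def[symmetric] Polynomial.coeff_sum)

lemma degree_L_poly: "degree L_poly < degree f"
  using degree_f_pos coeff_sum_jacobi_eq_0 by (intro degree_lessI) (auto simp: coeff_L_poly)

lemma coeff_L_poly_0: "coeff L_poly 0 = 1"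
  by (simp add: coeff_L_poly coeff_sum_def monics_0 jacobi_1)

lemma log_deriv_L_poly: "log_deriv_coeffs L_poly (\<lambda>k. of_int (prime_power_sum (jacobi T) k))"
proof (rule log_deriv_coeffsI)
  fix n
  have "int n * coeff_sum (jacobi T) n = (\<Sum>k\<in>{1..n}. prime_power_sum (jacobi T) k * coeff_sum (jacobi T) (n - k))"
    by (rule coeff_sum_recurrence) (simp_all add: jacobi_mult jacobi_1)
  then have "complex_of_int (int n * coeff_sum (jacobi T) n) =
      of_int (\<Sum>k\<in>{1..n}. prime_power_sum (jacobi T) k * coeff_sum (jacobi T) (n - k))" by (rule arg_cong)
  then show "of_nat n * coeff L_poly n =
      (\<Sum>k\<in>{1..n}. of_int (prime_power_sum (jacobi T) k) * coeff L_poly (n - k))"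
    by (simp add: coeff_L_poly)
qed

text \<open>The bound on the power sums is known for even exponents only; these are the logarithmic
  derivative of \<open>L(u) L(-u)\<close>.\<close>

lemma L_poly_zero_free:
  assumes z: "norm z * sqrt (real CARD('a)) < 1"
  shows "poly L_poly z \<noteq> 0"
proof -
  let ?S = "prime_power_sum (jacobi T)" and ?r = "sqrt (real CARD('a))"
  have r: "?r > 0" by simp
  define L' where "L' = pcompose L_poly [:0, -1:]"
  have cL': "coeff L' k = (-1) ^ k * coeff L_poly k" for k
    unfolding L'_def by (rule coeff_pcompose_linear)
  have "log_deriv_coeffs L' (\<lambda>k. (-1) ^ k * of_int (?S k))"
  proof (rule log_deriv_coeffsI)
    fix n
    have "of_nat n * coeff L_poly n = (\<Sum>k\<in>{1..n}. of_int (?S k) * coeff L_poly (n - k))"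
      using coeff_sum_recurrence[of "jacobi T" n, OF jacobi_mult jacobi_1, THEN arg_cong, of complex_of_int]
      by (simp add: coeff_L_poly)
    then have "of_nat n * coeff L' n = (\<Sum>k\<in>{1..n}. (-1) ^ n * (of_int (?S k) * coeff L_poly (n - k)))"
      unfolding cL' by (simp add: sum_distrib_left[symmetric] mult.left_commute)
    also have "\<dots> = (\<Sum>k\<in>{1..n}. (-1) ^ k * of_int (?S k) * coeff L' (n - k))"
    proof (rule sum.cong)
      fix k assume "k \<in> {1..n}"
      then have "(-1::complex) ^ n = (-1) ^ k * (-1) ^ (n - k)" by (simp flip: power_add)
      then show "(-1) ^ n * (of_int (?S k) * coeff L_poly (n - k)) = (-1) ^ k * of_int (?S k) * coeff L' (n - k)"
        by (simp add: cL' mult_ac)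
    qed simp
    finally show "of_nat n * coeff L' n = (\<Sum>k\<in>{1..n}. (-1) ^ k * of_int (?S k) * coeff L' (n - k))" .
  qed
  from log_deriv_coeffs_mult[OF log_deriv_L_poly this]
  have ld: "log_deriv_coeffs (L_poly * L') (\<lambda>k. of_int (?S k) + (-1) ^ k * of_int (?S k))" .
  have "poly (L_poly * L') z \<noteq> 0"
  proof (rule log_deriv_zero_free[OF ld, where R = "1 / ?r"])
    show "coeff (L_poly * L') 0 = 1" by (simp add: coeff_mult cL' coeff_L_poly_0)
    show "norm z < 1 / ?r" using z r by (simp add: field_simps)
    fix w :: complex assume w: "norm w < 1 / ?r"
    then have w': "norm w * ?r < 1" using r by (simp add: field_simps)
    \<comment> \<open>The count requires q^m to be large compared with deg f, so the comparison with
      a geometric series starts only at k = 2 \<open>m0\<close>.\<close>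
    obtain m0 where m0: "\<And>m. m \<ge> m0 \<Longrightarrow> \<exists>h. CARD('a) ^ m = 2 * h + 1 \<and> h \<ge> 2 * degree f" "m0 > 0"
      using exists_large by blast
    have "summable (\<lambda>k. 6 * real (degree f) * (norm w * ?r) ^ k)"
      using w' by (intro summable_mult summable_geometric) auto
    then show "summable (\<lambda>k. (of_int (?S k) + (-1) ^ k * of_int (?S k)) * w ^ k)"
    proof (rule summable_comparison_test'[where N = "2 * m0"])
      fix k assume k: "k \<ge> 2 * m0"
      show "norm ((of_int (?S k) + (-1) ^ k * of_int (?S k)) * w ^ k) \<le> 6 * real (degree f) * (norm w * ?r) ^ k"
      proof (cases "even k")
        case True
        then obtain m where m: "k = 2 * m" by auto
        have mm: "m \<ge> m0" using k m by simp
        then obtain h where h: "CARD('a) ^ m = 2 * h + 1" "h \<ge> 2 * degree f" using m0 by blast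
        have "?S k = prime_power_sum (\<lambda>P. quad_char P f) (2 * m)"
          using mm m0(2) unfolding m by (intro prime_power_sum_jacobi) auto
        then have "\<bar>?S k\<bar> \<le> 3 * int (degree f) * int (CARD('a) ^ m)"
          using weil_count(1)[OF h] by simp
        then have "real_of_int \<bar>?S k\<bar> \<le> of_int (3 * int (degree f) * int (CARD('a) ^ m))"
          by (simp only: of_int_le_iff)
        then have "\<bar>real_of_int (?S k)\<bar> \<le> 3 * real (degree f) * ?r ^ k"
          by (simp add: m power_mult)
        then have "norm (complex_of_int (?S k)) \<le> 3 * real (degree f) * ?r ^ k" by simp
        then have "2 * (norm (complex_of_int (?S k)) * norm w ^ k) \<le> 2 * (3 * real (degree f) * ?r ^ k * norm w ^ k)"
          by (intro mult_left_mono mult_right_mono) auto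
        moreover have "norm ((of_int (?S k) + (-1) ^ k * of_int (?S k)) * w ^ k) = 2 * (norm (complex_of_int (?S k)) * norm w ^ k)"
          using True by (simp add: norm_mult norm_power mult_2[symmetric] del: norm_of_int)
        ultimately show ?thesis by (simp add: power_mult_distrib mult_ac)
      next
        case False
        then show ?thesis using r by simp
      qed
    qed
  qed
  then show ?thesis by simp
qed

lemma reciprocal_roots:
  "\<exists>as. length as < degree f \<and> (\<forall>a\<in>set as. norm a \<le> sqrt (real CARD('a))) \<and>
    L_poly = prod_list (map (\<lambda>a. [:1, - a:]) as) \<and>
    (\<forall>k>0. of_int (prime_power_sum (jacobi T) k) = - (\<Sum>a\<leftarrow>as. a ^ k))"
proof -
  obtain as where as: "length as = degree L_poly" "L_poly = prod_list (map (\<lambda>a. [:1, - a:]) as)"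
    "\<And>a. a \<in> set as \<Longrightarrow> a \<noteq> 0 \<and> poly L_poly (inverse a) = 0"
    using poly_factor_reciprocal_roots[OF coeff_L_poly_0] by blast
  have bd: "norm a \<le> sqrt (real CARD('a))" if a: "a \<in> set as" for a
  proof (rule ccontr)
    assume "\<not> norm a \<le> sqrt (real CARD('a))"
    then have "sqrt (real CARD('a)) / norm a < 1" using as(3)[OF a] by simp
    then have "norm (inverse a) * sqrt (real CARD('a)) < 1"
      by (simp add: norm_inverse divide_inverse mult.commute)
    then show False using L_poly_zero_free as(3)[OF a] by blast
  qed
  have "L_poly \<noteq> 0" using coeff_L_poly_0 by auto
  then have pw: "of_int (prime_power_sum (jacobi T) k) = - (\<Sum>a\<leftarrow>as. a ^ k)" if "k > 0" for k
    using log_deriv_coeffs_unique[OF log_deriv_L_poly _ _ that] log_deriv_coeffs_prod_list[of as]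
    by (simp add: as(2))
  show ?thesis using bd as(2) pw degree_L_poly as(1) by (intro exI[of _ as]) auto
qed

text \<open>The crude estimate served only to confine the reciprocal roots to a disc of radius sqrt
  q. There are fewer than deg f of them, and the power sum is minus the sum of their k-th powers,
  now for odd k as well.\<close>

theorem weil_bound:
  assumes "k > 0"
  shows "\<bar>real_of_int (prime_power_sum (jacobi T) k)\<bar> \<le> (real (degree f) - 1) * sqrt (real CARD('a)) ^ k"
proof -
  obtain as where as: "length as < degree f" "\<And>a. a \<in> set as \<Longrightarrow> norm a \<le> sqrt (real CARD('a))"
    "L_poly = prod_list (map (\<lambda>a. [:1, - a:]) as)"
    "\<And>k. k > 0 \<Longrightarrow> of_int (prime_power_sum (jacobi T) k) = - (\<Sum>a\<leftarrow>as. a ^ k)"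
    using reciprocal_roots by blast
  have le: "norm (\<Sum>a\<leftarrow>bs. a ^ k) \<le> real (length bs) * sqrt (real CARD('a)) ^ k" if "set bs \<subseteq> set as" for bs
    using that
  proof (induction bs)
    case (Cons b bs)
    have "norm b ^ k \<le> sqrt (real CARD('a)) ^ k" using Cons.prems as(2)[of b] by (intro power_mono) auto
    then have "norm (b ^ k + (\<Sum>a\<leftarrow>bs. a ^ k)) \<le> sqrt (real CARD('a)) ^ k + real (length bs) * sqrt (real CARD('a)) ^ k"
      using Cons by (intro norm_triangle_le add_mono) (auto simp: norm_power)
    then show ?case by (simp add: algebra_simps)
  qed simp
  have "\<bar>real_of_int (prime_power_sum (jacobi T) k)\<bar> = norm (complex_of_int (prime_power_sum (jacobi T) k))"
    by simp
  also have "\<dots> \<le> real (length as) * sqrt (real CARD('a)) ^ k"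
    unfolding as(4)[OF assms] norm_minus_cancel by (rule le) simp
  also have "\<dots> \<le> (real (degree f) - 1) * sqrt (real CARD('a)) ^ k"
    using as(1) by (intro mult_right_mono) auto
  finally show ?thesis .
qed

text \<open>All primes of the sum have the same degree, so the reciprocity sign is constant and can
  be taken out.\<close>

theorem sum_quad_char_primes_bound:
  assumes n: "n > 0"
  shows "real n * \<bar>\<Sum>P\<in>monic_irreducibles n. real_of_int (quad_char P f)\<bar> \<le> (real (degree f) + 1) * sqrt (real CARD('a)) ^ n"
proof -
  let ?s = "(-1) ^ ((CARD('a) - 1) div 2 * n * degree f) :: real"
  have "(\<Sum>P\<in>monic_irreducibles n. real_of_int (jacobi T P)) = (\<Sum>P\<in>monic_irreducibles n. ?s * real_of_int (quad_char P f))"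
    by (rule sum.cong) (auto simp: monic_irreducibles_def jacobi_reciprocity)
  also have "\<dots> = ?s * (\<Sum>P\<in>monic_irreducibles n. real_of_int (quad_char P f))"
    by (simp add: sum_distrib_left)
  finally have "\<bar>\<Sum>P\<in>monic_irreducibles n. real_of_int (quad_char P f)\<bar> = \<bar>\<Sum>P\<in>monic_irreducibles n. real_of_int (jacobi T P)\<bar>"
    by (simp add: abs_mult power_abs)
  moreover have "\<bar>real n * (\<Sum>P\<in>monic_irreducibles n. real_of_int (jacobi T P))\<bar> \<le> (real (degree f) + 1) * sqrt (real CARD('a)) ^ n"

  proof -
    have "(real (degree f) + 1) * sqrt (real CARD('a)) ^ n =
        (real (degree f) - 1) * sqrt (real CARD('a)) ^ n + 2 * sqrt (real CARD('a)) ^ n"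
      by (simp add: algebra_simps)
    then show ?thesis
      using weil_bound[OF n] prime_power_sum_approx[OF n, of "jacobi T", OF jacobi_range] by linarith
  qed
  ultimately show ?thesis by (simp add: abs_mult)
qed

text \<open>The logarithms of the linear factors are complex and their sum \<Lambda> could be any
  logarithm of L(u). But \<Lambda> is also the sum of a series with real terms, hence real, so L(u)
  = exp \<Lambda> is positive and \<Lambda> is its real logarithm.\<close>

theorem ln_L_poly_sums:
  assumes u: "\<bar>u\<bar> * sqrt (real CARD('a)) < 1"
  shows "(\<Sum>k<degree f. real_of_int (coeff_sum (jacobi T) k) * u ^ k) > 0"
    and "(\<lambda>k. real_of_int (prime_power_sum (jacobi T) k) * u ^ k / real k) sums
      ln (\<Sum>k<degree f. real_of_int (coeff_sum (jacobi T) k) * u ^ k)"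
proof -
  let ?L = "\<Sum>k<degree f. real_of_int (coeff_sum (jacobi T) k) * u ^ k"
  let ?r = "sqrt (real CARD('a))"
  obtain as where as: "length as < degree f" "\<And>a. a \<in> set as \<Longrightarrow> norm a \<le> ?r"
    "L_poly = prod_list (map (\<lambda>a. [:1, - a:]) as)"
    "\<And>k. k > 0 \<Longrightarrow> of_int (prime_power_sum (jacobi T) k) = - (\<Sum>a\<leftarrow>as. a ^ k)"
    using reciprocal_roots by blast
  have small: "norm (a * of_real u) < 1" if "a \<in> set as" for a
  proof -
    have "norm (a * of_real u) \<le> ?r * \<bar>u\<bar>" unfolding norm_mult using as(2)[OF that] by (intro mult_mono) auto
    then show ?thesis using u by (simp add: mult.commute)
  qed
  have exp: "exp (\<Sum>a\<leftarrow>bs. Ln (1 - a * of_real u)) = poly (prod_list (map (\<lambda>a. [:1, - a:]) bs)) (of_real u)"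
    if "set bs \<subseteq> set as" for bs
    using that
  proof (induction bs)
    case (Cons b bs)
    then have "norm (b * of_real u) < 1" using small by simp
    then have "1 - b * of_real u \<noteq> 0" by auto
    then show ?case using Cons by (simp add: exp_add algebra_simps)
  qed simp
  have sums: "(\<lambda>k. - (\<Sum>a\<leftarrow>bs. a ^ k) * of_real u ^ k / of_nat k) sums (\<Sum>a\<leftarrow>bs. Ln (1 - a * of_real u))"
    if "set bs \<subseteq> set as" for bs
    using that
  proof (induction bs)
    case (Cons b bs)
    have "(\<lambda>k. (- 1) ^ Suc k / of_nat k * (- (b * of_real u)) ^ k) sums ln (1 + - (b * of_real u))"
      using small[of b] Cons.prems by (intro Ln_series) simp
    moreover have "(\<lambda>k. (- 1) ^ Suc k / of_nat k * (- (b * of_real u)) ^ k) = (\<lambda>k. - (b ^ k) * of_real u ^ k / of_nat k)"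
    proof
      fix k
      have "(- (b * of_real u)) ^ k = (-1) ^ k * (b * of_real u) ^ k" by (rule power_minus)
      then have "(- 1) ^ Suc k / of_nat k * (- (b * of_real u)) ^ k =
          ((- 1) ^ Suc k * (-1) ^ k) * (b * of_real u) ^ k / of_nat k" by (simp only: times_divide_eq_left mult.assoc)
      also have "(-1::complex) ^ Suc k * (-1) ^ k = -1" by (simp flip: power_mult_distrib)
      finally show "(- 1) ^ Suc k / of_nat k * (- (b * of_real u)) ^ k = - (b ^ k) * of_real u ^ k / of_nat k"
        by (simp add: power_mult_distrib)
    qed
    ultimately have "(\<lambda>k. - (b ^ k) * of_real u ^ k / of_nat k) sums Ln (1 - b * of_real u)"
      by (simp only: add_uminus_conv_diff)
    from sums_add[OF this Cons.IH] Cons.prems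
    show ?case by (simp add: algebra_simps add_divide_distrib diff_divide_distrib)
  qed simp
  define \<Lambda> where "\<Lambda> = (\<Sum>a\<leftarrow>as. Ln (1 - a * of_real u))"
  let ?t = "\<lambda>k. real_of_int (prime_power_sum (jacobi T) k) * u ^ k / real k"
  have "(\<lambda>k. complex_of_real (?t k)) sums \<Lambda>"
  proof -
    have "complex_of_real (?t k) = - (\<Sum>a\<leftarrow>as. a ^ k) * of_real u ^ k / of_nat k" for k
      using as(4)[of k] by (cases "k = 0") auto
    then show ?thesis using sums[of as] by (simp add: \<Lambda>_def)
  qed
  then have re: "?t sums Re \<Lambda>" and im: "(\<lambda>k. 0::real) sums Im \<Lambda>"
    using sums_Re sums_Im by fastforce+
  have "Im \<Lambda> = 0" using im sums_unique2[OF im sums_zero] by simp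
  then have \<Lambda>: "\<Lambda> = of_real (Re \<Lambda>)" by (simp add: complex_eq_iff)
  have "complex_of_real ?L = poly L_poly (of_real u)"
    unfolding L_poly_def by (simp add: poly_sum poly_monom)
  also have "\<dots> = exp \<Lambda>" using exp[of as] as(3) by (simp add: \<Lambda>_def)
  also have "\<dots> = of_real (exp (Re \<Lambda>))" by (subst \<Lambda>) (simp add: exp_of_real)
  finally have L: "?L = exp (Re \<Lambda>)" by (simp only: of_real_eq_iff)
  show "?L > 0" by (simp add: L)
  show "?t sums ln ?L" using re by (simp add: L)
qed

end

section \<open>The L-function on the real line\<close>

text \<open>There are q^n monic polynomials of degree n, so for q |w| < 1 the sum converges
  absolutely and may be regrouped by degree.\<close>

lemma has_sum_monics:
  fixes a :: "'a::{finite,field} poly \<Rightarrow> 'b::{real_normed_field, banach}"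
  assumes a: "\<And>A. norm (a A) \<le> 1" and w: "real CARD('a) * norm w < 1"
  shows "((\<lambda>A. a A * w ^ degree A) has_sum (\<Sum>n. (\<Sum>A\<in>monics n. a A) * w ^ n)) {A. lead_coeff A = 1}"
proof -
  let ?g = "\<lambda>(n::nat, A). a A * w ^ n"
  let ?S = "Sigma UNIV (\<lambda>n. monics n :: 'a poly set)"
  have bound: "(\<Sum>A\<in>monics n. norm (a A * w ^ n)) \<le> (real CARD('a) * norm w) ^ n" for n
  proof -
    have "(\<Sum>A\<in>monics n. norm (a A * w ^ n)) \<le> (\<Sum>A\<in>(monics n :: 'a poly set). 1 * norm w ^ n)"
      unfolding norm_mult norm_power using a by (intro sum_mono mult_right_mono) auto
    also have "\<dots> = (real CARD('a) * norm w) ^ n" by (simp add: card_monics power_mult_distrib)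
    finally show ?thesis .
  qed
  have geo: "summable (\<lambda>n. (real CARD('a) * norm w) ^ n)"
    using w by (intro summable_geometric) simp
  have summ: "summable (\<lambda>n. \<Sum>A\<in>monics n. norm (a A * w ^ n))"
    by (rule summable_comparison_test'[OF geo, of 0]) (use bound in \<open>simp add: sum_nonneg\<close>)
  have "(\<lambda>x. norm (?g x)) summable_on ?S"
    unfolding Infinite_Sum.abs_summable_on_Sigma_iff
  proof (intro conjI ballI)
    show "(\<lambda>x. norm (\<Sum>\<^sub>\<infinity>y\<in>monics x. norm (?g (x, y)))) summable_on UNIV"
      using summ by (intro norm_summable_imp_summable_on) (simp add: sum_nonneg)
  qed simp
  then have summable: "?g summable_on ?S" by (rule abs_summable_summable)
  have "norm ((\<Sum>A\<in>monics n. a A) * w ^ n) \<le> (real CARD('a) * norm w) ^ n" for n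
  proof -
    have "norm ((\<Sum>A\<in>monics n. a A) * w ^ n) \<le> (\<Sum>A\<in>monics n. norm (a A * w ^ n))"
      unfolding sum_distrib_right by (rule norm_sum)
    then show ?thesis using bound by (rule order_trans)
  qed
  then have "summable (\<lambda>n. norm ((\<Sum>A\<in>monics n. a A) * w ^ n))"
    by (intro summable_comparison_test'[OF geo, of 0]) simp
  then have outer: "((\<lambda>n. (\<Sum>A\<in>monics n. a A) * w ^ n) has_sum (\<Sum>n. (\<Sum>A\<in>monics n. a A) * w ^ n)) UNIV"
    by (intro norm_summable_imp_has_sum) (auto dest: summable_norm_cancel intro: summable_sums)
  have "(?g has_sum (\<Sum>n. (\<Sum>A\<in>monics n. a A) * w ^ n)) ?S"
  proof (rule has_sum_SigmaI[OF _ outer summable])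
    fix n :: nat
    show "((\<lambda>A. ?g (n, A)) has_sum (\<Sum>A\<in>monics n. a A) * w ^ n) (monics n)"
      unfolding sum_distrib_right by (auto intro: has_sum_finite)
  qed
  moreover have "((\<lambda>A. a A * w ^ degree A) has_sum s) {A. lead_coeff A = 1} \<longleftrightarrow> (?g has_sum s) ?S" for s
    by (rule has_sum_reindex_bij_witness[where i = snd and j = "\<lambda>A. (degree A, A)"]) (auto simp: monics_def)
  ultimately show ?thesis by blast
qed

lemma pnorm_powr:
  "pnorm (A::'a::{finite,field} poly) powr (-s) = (real CARD('a) powr (-s)) ^ degree A"
  by (simp add: pnorm_def powr_powr powr_power mult.commute flip: powr_realpow)

lemma zeta_poly_eq:
  assumes s: "s > 1"
  shows "zeta_poly TYPE('a::{finite,field}) s = 1 / (1 - real CARD('a) powr (1 - s))"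
proof -
  let ?q = "real CARD('a)"
  have q: "?q > 1" using card_field_ge2[where 'a='a] by simp
  have w: "?q * norm (?q powr (-s)) < 1"
  proof -
    have "?q * ?q powr (-s) = ?q powr (1 - s)" using q by (simp add: powr_diff powr_minus divide_inverse)
    also have "\<dots> < ?q powr 0" using q s by (intro powr_less_mono) auto
    finally show ?thesis using q by simp
  qed
  have "zeta_poly TYPE('a) s = (\<Sum>n. (\<Sum>A\<in>(monics n :: 'a poly set). 1) * (?q powr (-s)) ^ n)"
    using infsumI[OF has_sum_monics[of "\<lambda>_. 1", OF _ w]] by (simp add: zeta_poly_def pnorm_powr)
  also have "\<dots> = (\<Sum>n. (?q powr (1 - s)) ^ n)"
    using q by (simp add: card_monics powr_diff powr_minus divide_inverse power_mult_distrib)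
  also have "\<dots> = 1 / (1 - ?q powr (1 - s))"
    using q powr_less_mono[of "1 - s" 0 ?q] s by (intro suminf_geometric) simp
  finally show ?thesis .
qed

lemma prime_set_singleton:
  fixes P :: "'a::{finite,field} poly"
  assumes "odd CARD('a)" "P \<in> monic_irreducibles N"
  shows "prime_set {P}"
  using assms by unfold_locales (auto simp: monic_irreducibles_def)

lemma jacobi_singleton: "jacobi {P} = quad_char P"
  by (rule ext) (simp add: jacobi_def)

text \<open>The Dirichlet series is a polynomial in q^(-s), and this polynomial is entire. The
  identity theorem gives the uniqueness that the definite description in \<open>quad_L\<close> asks
  for.\<close>

lemma quad_L_eq:
  fixes P :: "'a::{finite,field} poly"
  assumes odd: "odd CARD('a)" and P: "P \<in> monic_irreducibles N"
  shows "quad_L P s = (\<Sum>k<N. of_int (coeff_sum (quad_char P) k) * (exp (- s * of_real (ln (real CARD('a))))) ^ k)"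
proof -
  interpret prime_set "{P}" by (rule prime_set_singleton[OF odd P])
  let ?q = "real CARD('a)"
  let ?w = "\<lambda>s::complex. exp (- s * of_real (ln ?q))"
  define F where "F = (\<lambda>s. \<Sum>k<N. of_int (coeff_sum (quad_char P) k) * ?w s ^ k)"
  have q: "?q > 1" using card_field_ge2[where 'a='a] by simp
  have N: "degree P = N" using P by (simp add: monic_irreducibles_def)
  have hol: "F holomorphic_on UNIV" unfolding F_def by (intro holomorphic_intros)
  have series: "F s = (\<Sum>\<^sub>\<infinity>A\<in>{A. lead_coeff A = 1}. of_int (quad_char P A) * of_real (pnorm A) powr (-s))"
    if s: "Re s > 1" for s
  proof -
    have nw: "norm (?w s) = ?q powr (- Re s)" using q by (simp add: powr_def)
    have "?q * ?q powr (- Re s) = ?q powr (1 - Re s)" using q by (simp add: powr_diff powr_minus divide_inverse)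
    also have "\<dots> < ?q powr 0" using q s by (intro powr_less_mono) auto
    finally have w: "?q * norm (?w s) < 1" using q nw by simp
    have le: "norm (complex_of_int (quad_char P A)) \<le> 1" for A
    proof -
      have "\<bar>quad_char P A\<bar> \<le> 1" by (rule abs_le_1[OF quad_char_range])
      then have "\<bar>real_of_int (quad_char P A)\<bar> \<le> 1" by linarith
      then show ?thesis by simp
    qed
    have pw: "complex_of_real (pnorm A) powr (-s) = ?w s ^ degree A" for A :: "'a poly"
    proof -
      have "pnorm A > 0" using q by (simp add: pnorm_def)
      moreover have "ln (pnorm A) = real (degree A) * ln ?q" using q by (simp add: pnorm_def ln_realpow)
      ultimately show ?thesis
        by (simp add: powr_def Ln_of_real exp_of_nat_mult[symmetric] mult_ac)
    qed
    have "(\<Sum>\<^sub>\<infinity>A\<in>{A. lead_coeff A = 1}. of_int (quad_char P A) * of_real (pnorm A) powr (-s)) =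
        (\<Sum>n. (\<Sum>A\<in>monics n. of_int (quad_char P A)) * ?w s ^ n)"
      using infsumI[OF has_sum_monics[of "\<lambda>A. of_int (quad_char P A)", OF le w]] by (simp add: pw)
    also have "\<dots> = (\<Sum>n. of_int (coeff_sum (quad_char P) n) * ?w s ^ n)"
      by (simp add: coeff_sum_def)
    also have "\<dots> = F s"
      unfolding F_def using coeff_sum_jacobi_eq_0 N
      by (intro suminf_finite) (auto simp: jacobi_singleton)
    finally show ?thesis ..
  qed
  have "quad_L P = F"
    unfolding quad_L_def
  proof (rule the_equality)
    show "F holomorphic_on UNIV \<and> (\<forall>s. Re s > 1 \<longrightarrow>
           F s = (\<Sum>\<^sub>\<infinity>A\<in>{A. lead_coeff A = 1}. of_int (quad_char P A) * of_real (pnorm A) powr (-s)))"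
      using hol series by blast
    fix g assume g: "g holomorphic_on UNIV \<and> (\<forall>s. Re s > 1 \<longrightarrow>
           g s = (\<Sum>\<^sub>\<infinity>A\<in>{A. lead_coeff A = 1}. of_int (quad_char P A) * of_real (pnorm A) powr (-s)))"
    show "g = F"
    proof
      fix z
      show "g z = F z"
      proof (rule analytic_continuation_open[where s = "{s. Re s > 1}" and s' = UNIV and f = g and g = F])
        show "open {s. Re s > 1}" by (rule open_halfspace_Re_gt)
        show "{s. Re s > 1} \<noteq> {}" by (auto intro!: exI[of _ 2])
        show "g w = F w" if "w \<in> {s. Re s > 1}" for w using g series that by simp
      qed (use g hol in auto)
    qed
  qed
  then show ?thesis by (simp add: F_def)
qed

section \<open>A truncated lower bound for the logarithm\<close>

definition L_real :: "real \<Rightarrow> 'a::{finite,field} poly \<Rightarrow> real" where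
  "L_real \<sigma> P = (\<Sum>k<degree P. real_of_int (coeff_sum (quad_char P) k) * (real CARD('a) powr (-\<sigma>)) ^ k)"

lemma ln_quad_L_eq:
  fixes P :: "'a::{finite,field} poly"
  assumes odd: "odd CARD('a)" and P: "P \<in> monic_irreducibles N"
  shows "ln_quad_L \<sigma> P = ln (L_real \<sigma> P)"
proof -
  have "exp (- complex_of_real \<sigma> * of_real (ln (real CARD('a)))) = of_real (real CARD('a) powr (-\<sigma>))"
    by (simp add: powr_def exp_of_real[symmetric])
  then have "quad_L P (of_real \<sigma>) = of_real (L_real \<sigma> P)"
    using P unfolding quad_L_eq[OF assms] L_real_def monic_irreducibles_def by simp
  then show ?thesis by (simp add: ln_quad_L_def)
qed

text \<open>In \<open>\<Sum>\<^sub>k \<chi>\<^sub>P(R)\<^sup>k u\<^bsup>k deg R\<^esup>/k\<close> the terms with even \<open>k\<close> are nonnegative and may be dropped from a lower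
  bound; those with odd \<open>k\<close> add up to this weight times \<open>\<chi>\<^sub>P(R)\<close>.\<close>

definition prime_weight :: "real \<Rightarrow> nat \<Rightarrow> nat \<Rightarrow> real" where
  "prime_weight u Y d = (\<Sum>k\<in>{k\<in>{1..Y}. d dvd k \<and> odd (k div d)}. real d / real k * u ^ k)"

text \<open>The lower bound is the term k = d, which carries the main term. The crude upper bound
  only ever multiplies an exponentially small error.\<close>

lemma prime_weight_bounds:
  assumes u_bounds: "0 < u" "u < 1" and "d > 0" "d \<le> Y"
  shows "u ^ d \<le> prime_weight u Y d" "prime_weight u Y d \<le> real Y"
proof -
  have nonneg: "0 \<le> real d / real k * u ^ k" for k using u_bounds by simp
  have "(\<Sum>k\<in>{d}. real d / real k * u ^ k) \<le> prime_weight u Y d"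
    unfolding prime_weight_def using assms nonneg by (intro sum_mono2) auto
  then show "u ^ d \<le> prime_weight u Y d" using assms by simp
  have "prime_weight u Y d \<le> (\<Sum>k\<in>{k\<in>{1..Y}. d dvd k \<and> odd (k div d)}. 1)"
    unfolding prime_weight_def
  proof (rule sum_mono)
    fix k assume k: "k \<in> {k\<in>{1..Y}. d dvd k \<and> odd (k div d)}"
    then have "d \<le> k" by (auto dest: dvd_imp_le)
    then have "real d / real k \<le> 1" using k by simp
    moreover have "u ^ k \<le> 1" using u_bounds by (intro power_le_one) auto
    ultimately have "real d / real k * u ^ k \<le> 1 * 1" using u_bounds by (intro mult_mono) auto
    then show "real d / real k * u ^ k \<le> 1" by simp
  qed
  also have "\<dots> \<le> (\<Sum>k\<in>{1..Y}. 1)" by (intro sum_mono2) auto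
  finally show "prime_weight u Y d \<le> real Y" by simp
qed

lemma card_powr_bounds:
  fixes \<sigma> :: real
  assumes \<sigma>: "\<sigma> > 1 / 2"
  defines "q \<equiv> real CARD('a::{finite,field})"
  shows "0 < q powr (-\<sigma>)" "q powr (-\<sigma>) < 1" "q powr (-\<sigma>) * sqrt q < 1"
proof -
  have q: "q > 1" using card_field_ge2[where 'a='a] by (simp add: q_def)
  show "0 < q powr (-\<sigma>)" using q by simp
  show "q powr (-\<sigma>) < 1" using q \<sigma> powr_less_mono[of "-\<sigma>" 0 q] by simp
  have "q powr (-\<sigma>) * sqrt q = q powr (1 / 2 - \<sigma>)"
    using q by (simp add: powr_half_sqrt[symmetric] powr_add[symmetric] algebra_simps)
  also have "\<dots> < q powr 0" using q \<sigma> by (intro powr_less_mono) auto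
  finally show "q powr (-\<sigma>) * sqrt q < 1" using q by simp
qed

context
  fixes P :: "'a::{finite,field} poly" and N :: nat and \<sigma> u :: real
  assumes odd: "odd CARD('a)" and P: "P \<in> monic_irreducibles N" and \<sigma>: "\<sigma> > 1 / 2"
  defines "u \<equiv> real CARD('a) powr (-\<sigma>)"
begin

lemma u_bounds: "0 < u" "u < 1" "u * sqrt (real CARD('a)) < 1"
  unfolding u_def by (rule card_powr_bounds[OF \<sigma>])+

lemma ln_quad_L_sums:
  "L_real \<sigma> P > 0"
  "(\<lambda>k. real_of_int (prime_power_sum (quad_char P) k) * u ^ k / real k) sums ln_quad_L \<sigma> P"
proof -
  interpret prime_set "{P}" by (rule prime_set_singleton[OF odd P])
  have "\<bar>u\<bar> * sqrt (real CARD('a)) < 1" using u_bounds by simp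
  from ln_L_poly_sums[OF this]
  show "L_real \<sigma> P > 0"
    "(\<lambda>k. real_of_int (prime_power_sum (quad_char P) k) * u ^ k / real k) sums ln_quad_L \<sigma> P"
    unfolding ln_quad_L_eq[OF odd P] by (simp_all add: L_real_def jacobi_singleton u_def)
qed

text \<open>A trivial bound from counting monic polynomials is enough: it costs the proportion of
  large values only a factor N ln q, which disappears in the o(1) of the exponent.\<close>

lemma ln_quad_L_le: "ln_quad_L \<sigma> P \<le> real N * ln (real CARD('a))"
proof -
  let ?q = "real CARD('a)"
  have q: "?q \<ge> 2" using card_field_ge2[where 'a='a] by simp
  have N: "degree P = N" using P by (simp add: monic_irreducibles_def)
  have "L_real \<sigma> P \<le> (\<Sum>k<N. ?q ^ k)"
    unfolding L_real_def N
  proof (rule sum_mono)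
    fix k
    have "coeff_sum (quad_char P) k \<le> (\<Sum>A\<in>(monics k :: 'a poly set). 1)"
      unfolding coeff_sum_def
    proof (rule sum_mono)
      fix A
      show "quad_char P A \<le> 1" using abs_le_1[OF quad_char_range[of P A]] by linarith
    qed
    then have "real_of_int (coeff_sum (quad_char P) k) \<le> real_of_int (int (CARD('a) ^ k))"
      unfolding of_int_le_iff by (simp add: card_monics)
    then have c: "real_of_int (coeff_sum (quad_char P) k) \<le> ?q ^ k" by simp
    have "0 < u ^ k" "u ^ k \<le> 1" using u_bounds by (auto intro: power_le_one)
    have "real_of_int (coeff_sum (quad_char P) k) * u ^ k \<le> ?q ^ k * u ^ k"
      using c \<open>0 < u ^ k\<close> by (intro mult_right_mono) auto
    also have "\<dots> \<le> ?q ^ k * 1" using \<open>u ^ k \<le> 1\<close> q by (intro mult_left_mono) auto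
    finally show "real_of_int (coeff_sum (quad_char P) k) * (?q powr (-\<sigma>)) ^ k \<le> ?q ^ k"
      by (simp add: u_def)
  qed
  also have "(\<Sum>k<N. ?q ^ k) \<le> ?q ^ N"
  proof (induction N)
    case (Suc N)
    have "2 * ?q ^ N \<le> ?q * ?q ^ N" using q by (intro mult_right_mono) auto
    then show ?case using Suc unfolding sum.lessThan_Suc power_Suc by linarith
  qed simp
  finally have "ln (L_real \<sigma> P) \<le> ln (?q ^ N)" using ln_quad_L_sums(1) by (intro ln_mono) auto
  then show ?thesis using q by (simp add: ln_quad_L_eq[OF odd P] ln_realpow)
qed

text \<open>Beyond Y the Weil bound makes the series geometric with ratio u sqrt q, which is below 1
  because \<sigma> > 1/2. With Y proportional to N the tail becomes exponentially small.\<close>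

lemma ln_quad_L_ge:
  "ln_quad_L \<sigma> P \<ge> (\<Sum>R\<in>primes_upto Y. prime_weight u Y (degree R) * real_of_int (quad_char P R))
     - real N * (u * sqrt (real CARD('a))) ^ Suc Y / (1 - u * sqrt (real CARD('a)))"
proof -
  interpret prime_set "{P}" by (rule prime_set_singleton[OF odd P])
  let ?r = "u * sqrt (real CARD('a))"
  let ?\<chi> = "quad_char P"
  let ?t = "\<lambda>k. real_of_int (prime_power_sum ?\<chi> k) * u ^ k / real k"
  have N: "degree P = N" using P by (simp add: monic_irreducibles_def)
  have r: "0 \<le> ?r" "?r < 1" using u_bounds by auto
  have tb: "\<bar>?t k\<bar> \<le> real N * ?r ^ k" if k: "k > 0" for k
  proof -
    have "\<bar>real_of_int (prime_power_sum ?\<chi> k)\<bar> \<le> (real N - 1) * sqrt (real CARD('a)) ^ k"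
      using weil_bound[OF k] N by (simp add: jacobi_singleton)
    also have "\<dots> \<le> real N * sqrt (real CARD('a)) ^ k" by (intro mult_right_mono) auto
    finally have "\<bar>real_of_int (prime_power_sum ?\<chi> k)\<bar> * u ^ k \<le> real N * sqrt (real CARD('a)) ^ k * u ^ k"
      using u_bounds by (intro mult_right_mono) auto
    then have "\<bar>real_of_int (prime_power_sum ?\<chi> k) * u ^ k\<bar> \<le> real N * ?r ^ k"
      using u_bounds by (simp add: abs_mult power_mult_distrib mult_ac)
    moreover have "\<bar>?t k\<bar> \<le> \<bar>real_of_int (prime_power_sum ?\<chi> k) * u ^ k\<bar>"
      unfolding abs_divide using k by (intro divide_le_eq_1 [THEN iffD2] | simp add: divide_le_eq mult_le_cancel_left1)+
    ultimately show ?thesis by linarith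
  qed
  have sm: "summable ?t" and val: "ln_quad_L \<sigma> P = suminf ?t"
    using ln_quad_L_sums(2) by (auto simp: sums_iff)
  have "ln_quad_L \<sigma> P = (\<Sum>k. ?t (k + Suc Y)) + (\<Sum>k<Suc Y. ?t k)"
    unfolding val using sm by (rule suminf_split_initial_segment)
  moreover have "(\<Sum>k. ?t (k + Suc Y)) \<ge> - (real N * ?r ^ Suc Y / (1 - ?r))"
  proof -
    have geo: "(\<lambda>k. real N * ?r ^ Suc Y * ?r ^ k) sums (real N * ?r ^ Suc Y * (1 / (1 - ?r)))"
      using r by (intro sums_mult geometric_sums) simp
    have "\<bar>?t (k + Suc Y)\<bar> \<le> real N * ?r ^ Suc Y * ?r ^ k" for k
      using tb[of "k + Suc Y"] by (simp add: power_add mult_ac)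
    then have "norm (\<Sum>k. ?t (k + Suc Y)) \<le> (\<Sum>k. real N * ?r ^ Suc Y * ?r ^ k)"
      using geo by (intro norm_suminf_le) (auto simp: sums_iff)
    then show ?thesis using geo by (simp add: sums_iff)
  qed
  moreover have "(\<Sum>k<Suc Y. ?t k) \<ge> (\<Sum>R\<in>primes_upto Y. prime_weight u Y (degree R) * real_of_int (?\<chi> R))"
  proof -
    \<comment> \<open>The term k = 0 is a quotient by 0 and hence 0.\<close>
    have "(\<Sum>k<Suc Y. ?t k) = (\<Sum>k\<in>{1..Y}. ?t k)"
      by (rule sum.mono_neutral_right) (auto simp: Suc_le_eq)
    also have "\<dots> = (\<Sum>k\<in>{1..Y}. \<Sum>R\<in>primes_upto Y. if degree R dvd k
        then real (degree R) / real k * u ^ k * real_of_int (?\<chi> R ^ (k div degree R)) else 0)"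
    proof (rule sum.cong)
      fix k assume k: "k \<in> {1..Y}"
      have sub: "primes_dvd k = {R\<in>primes_upto Y. degree R dvd k}"
        using k by (auto simp: primes_dvd_def primes_upto_def dest: dvd_imp_le)
      have "?t k = (\<Sum>R\<in>primes_dvd k. real (degree R) / real k * u ^ k * real_of_int (?\<chi> R ^ (k div degree R)))"
        unfolding prime_power_sum_def
        by (simp add: sum_distrib_left sum_distrib_right sum_divide_distrib mult_ac)
      also have "\<dots> = (\<Sum>R\<in>primes_upto Y. if degree R dvd k
        then real (degree R) / real k * u ^ k * real_of_int (?\<chi> R ^ (k div degree R)) else 0)"
        unfolding sub by (rule sum.inter_filter) simp
      finally show "?t k = \<dots>" .
    qed simp
    also have "\<dots> = (\<Sum>R\<in>primes_upto Y. \<Sum>k\<in>{1..Y}. if degree R dvd k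
        then real (degree R) / real k * u ^ k * real_of_int (?\<chi> R ^ (k div degree R)) else 0)"
      by (rule sum.swap)
    also have "\<dots> \<ge> (\<Sum>R\<in>primes_upto Y. prime_weight u Y (degree R) * real_of_int (?\<chi> R))"
    proof (rule sum_mono)
      fix R :: "'a poly"
      have "prime_weight u Y (degree R) * real_of_int (?\<chi> R) = (\<Sum>k\<in>{1..Y}. if degree R dvd k \<and> odd (k div degree R)
          then real (degree R) / real k * u ^ k * real_of_int (?\<chi> R) else 0)"
        unfolding prime_weight_def sum_distrib_right by (rule sum.inter_filter) simp
      also have "\<dots> \<le> (\<Sum>k\<in>{1..Y}. if degree R dvd k
        then real (degree R) / real k * u ^ k * real_of_int (?\<chi> R ^ (k div degree R)) else 0)"
      proof (rule sum_mono)
        fix k assume k: "k \<in> {1..Y}"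
        show "(if degree R dvd k \<and> odd (k div degree R) then real (degree R) / real k * u ^ k * real_of_int (?\<chi> R) else 0)
           \<le> (if degree R dvd k then real (degree R) / real k * u ^ k * real_of_int (?\<chi> R ^ (k div degree R)) else 0)"
        proof (cases "odd (k div degree R)")
          case True
          then have "?\<chi> R ^ (k div degree R) = ?\<chi> R ^ 1"
            using quad_char_range[of P R] by (intro power_same_parity) (auto elim: oddE)
          then show ?thesis using True by simp
        next
          case False
          then have "0 \<le> ?\<chi> R ^ (k div degree R)" by (simp add: zero_le_even_power)
          then have "0 \<le> real_of_int (?\<chi> R ^ (k div degree R))" by (simp only: of_int_0_le_iff)
          then have "0 \<le> real (degree R) / real k * u ^ k * real_of_int (?\<chi> R ^ (k div degree R))"
            using u_bounds by (intro mult_nonneg_nonneg) auto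
          then show ?thesis using False by simp
        qed
      qed
      finally show "prime_weight u Y (degree R) * real_of_int (?\<chi> R) \<le> \<dots>" .
    qed
    finally show ?thesis .
  qed
  ultimately show ?thesis by linarith
qed

end

section \<open>The resonator\<close>

definition resonator :: "real \<Rightarrow> 'a::{finite,field} poly set \<Rightarrow> 'a poly \<Rightarrow> real" where
  "resonator c A P = (\<Prod>Q\<in>A. 1 + c * real_of_int (quad_char P Q))"

lemma abs_quad_char_le: "\<bar>real_of_int (quad_char P A)\<bar> \<le> 1"
  using abs_le_1[OF quad_char_range[of P A]] by linarith

lemma resonator_bounds:
  assumes "0 \<le> c" "c \<le> 1"
  shows "0 \<le> resonator c A P" "resonator c A P \<le> (1 + c) ^ card A"
proof -
  have le: "\<bar>c * real_of_int (quad_char P Q)\<bar> \<le> c" for Q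
    using mult_left_mono[OF abs_quad_char_le assms(1), of P Q] assms by (simp add: abs_mult)
  have nn: "0 \<le> 1 + c * real_of_int (quad_char P Q)" "1 + c * real_of_int (quad_char P Q) \<le> 1 + c" for Q
    using le[of Q] assms by linarith+
  show "0 \<le> resonator c A P" unfolding resonator_def by (rule prod_nonneg) (rule nn)
  have "resonator c A P \<le> (\<Prod>Q\<in>A. 1 + c)" unfolding resonator_def by (rule prod_mono) (use nn in blast)
  then show "resonator c A P \<le> (1 + c) ^ card A" by simp
qed

lemma resonator_expand:
  fixes P :: "'a::{finite,field} poly"
  assumes "odd CARD('a)" "irreducible P" "finite A"
  shows "resonator c A P = (\<Sum>T\<in>Pow A. c ^ card T * real_of_int (quad_char P (\<Prod>T)))"
proof -
  have "resonator c A P = (\<Prod>Q\<in>A. c * real_of_int (quad_char P Q) + 1)"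
    by (simp add: resonator_def add.commute)
  also have "\<dots> = (\<Sum>T\<in>Pow A. (\<Prod>Q\<in>T. c * real_of_int (quad_char P Q)) * (\<Prod>Q\<in>A - T. 1))"
    by (rule prod_add) (rule assms)
  also have "\<dots> = (\<Sum>T\<in>Pow A. c ^ card T * real_of_int (quad_char P (\<Prod>T)))"
  proof (rule sum.cong)
    fix T
    have qp: "quad_char P (\<Prod>T) = (\<Prod>Q\<in>T. quad_char P Q)" by (rule quad_char_prod[OF assms(1,2)])
    then show "(\<Prod>Q\<in>T. c * real_of_int (quad_char P Q)) * (\<Prod>Q\<in>A - T. 1) =
        c ^ card T * real_of_int (quad_char P (\<Prod>T))"
      by (simp only: qp prod.distrib prod_constant of_int_prod prod.neutral_const mult_1_right power_one)
  qed simp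
  finally show ?thesis .
qed

lemma sum_power_card_Pow: "finite A \<Longrightarrow> (\<Sum>T\<in>Pow A. (c::real) ^ card T) = (1 + c) ^ card A"
  using prod_add[of A "\<lambda>_. c" "\<lambda>_. 1"] by (simp add: add.commute)

text \<open>\<open>B\<close> stands for the Weil bound. The products range over subsets of
  \<open>insert R S\<close> because the resonator over \<open>S\<close> is tested against single
  primes \<open>R\<close>, in \<open>S\<close> or not; Y < N ensures that no modulus P divides such
  an \<open>R\<close>.\<close>

locale resonance =
  fixes S :: "'a::{finite,field} poly set" and N Y :: nat and c B :: real
  assumes odd: "odd CARD('a)" and S: "S \<subseteq> primes_upto Y" and YN: "Y < N"
    and c: "0 \<le> c" "c \<le> 1" and B: "0 \<le> B"
    and char_sum: "\<And>T R. R \<in> primes_upto Y \<Longrightarrow> T \<subseteq> insert R S \<Longrightarrow> T \<noteq> {} \<Longrightarrow>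
      \<bar>\<Sum>P\<in>monic_irreducibles N. real_of_int (quad_char P (\<Prod>T))\<bar> \<le> B"
begin

lemma finite_S: "finite S"
  using S finite_primes_upto finite_subset by blast

lemma irr: "P \<in> monic_irreducibles N \<Longrightarrow> irreducible P"
  by (simp add: monic_irreducibles_def)

text \<open>In the expanded product the empty set gives the main term. Every other set costs at most
  \<open>B\<close>, with weights that add up to at most (1 + c)^|A|.\<close>

lemma sum_resonator:
  assumes A: "A \<subseteq> S"
  shows "\<bar>(\<Sum>P\<in>monic_irreducibles N. resonator c A P) - real (card (monic_irreducibles N :: 'a poly set))\<bar> \<le> (1 + c) ^ card A * B"
proof -
  let ?V = "\<lambda>T::'a poly set. \<Sum>P\<in>monic_irreducibles N. real_of_int (quad_char P (\<Prod>T))"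
  have fin: "finite A" using A finite_S finite_subset by blast
  have "(\<Sum>P\<in>monic_irreducibles N. resonator c A P) =
      (\<Sum>P\<in>monic_irreducibles N. \<Sum>T\<in>Pow A. c ^ card T * real_of_int (quad_char P (\<Prod>T)))"
    by (rule sum.cong[OF refl]) (rule resonator_expand[OF odd irr fin])
  also have "\<dots> = (\<Sum>T\<in>Pow A. c ^ card T * ?V T)"
    by (subst sum.swap) (simp add: sum_distrib_left)
  also have "\<dots> = c ^ card ({} :: 'a poly set) * ?V {} + (\<Sum>T\<in>Pow A - {{}}. c ^ card T * ?V T)"
    using fin by (intro sum.remove) auto
  also have "c ^ card ({} :: 'a poly set) * ?V {} = real (card (monic_irreducibles N :: 'a poly set))"
    using quad_char_1[OF odd irr] by simp
  finally have "(\<Sum>P\<in>monic_irreducibles N. resonator c A P) - real (card (monic_irreducibles N :: 'a poly set)) = (\<Sum>T\<in>Pow A - {{}}. c ^ card T * ?V T)"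
    by simp
  also have "\<bar>\<dots>\<bar> \<le> (\<Sum>T\<in>Pow A - {{}}. \<bar>c ^ card T * ?V T\<bar>)" by (rule sum_abs)
  also have "\<dots> \<le> (\<Sum>T\<in>Pow A - {{}}. c ^ card T * B)"
  proof (rule sum_mono)
    fix T assume T: "T \<in> Pow A - {{}}"
    then obtain R where "R \<in> T" by auto
    then have "\<bar>?V T\<bar> \<le> B" using T A S by (intro char_sum[of R]) auto
    then show "\<bar>c ^ card T * ?V T\<bar> \<le> c ^ card T * B"
      using c by (simp add: abs_mult mult_left_mono)
  qed
  also have "\<dots> \<le> (\<Sum>T\<in>Pow A. c ^ card T * B)"
    using fin c B by (intro sum_mono2) auto
  also have "\<dots> = (1 + c) ^ card A * B"
    using fin by (simp add: sum_distrib_right[symmetric] sum_power_card_Pow)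
  finally show ?thesis .
qed

text \<open>As \<open>R\<close> lies outside \<open>A\<close>, each set of primes in the expansion
  contains \<open>R\<close> exactly once: all products are squarefree and nonconstant, and there is
  no main term.\<close>

lemma sum_resonator_char:
  assumes A: "A \<subseteq> S" and R: "R \<in> primes_upto Y" "R \<notin> A"
  shows "\<bar>\<Sum>P\<in>monic_irreducibles N. resonator c A P * real_of_int (quad_char P R)\<bar> \<le> (1 + c) ^ card A * B"
proof -
  let ?V = "\<lambda>T::'a poly set. \<Sum>P\<in>monic_irreducibles N. real_of_int (quad_char P (\<Prod>T))"
  have fin: "finite A" using A finite_S finite_subset by blast
  have "(\<Sum>P\<in>monic_irreducibles N. resonator c A P * real_of_int (quad_char P R)) =
      (\<Sum>P\<in>monic_irreducibles N. \<Sum>T\<in>Pow A. c ^ card T * real_of_int (quad_char P (\<Prod>(insert R T))))"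
  proof (rule sum.cong)
    fix P :: "'a poly" assume P: "P \<in> monic_irreducibles N"
    have "resonator c A P * real_of_int (quad_char P R) =
        (\<Sum>T\<in>Pow A. c ^ card T * real_of_int (quad_char P (\<Prod>T)) * real_of_int (quad_char P R))"
      using resonator_expand[OF odd irr[OF P] fin, of c] by (simp add: sum_distrib_right)
    also have "\<dots> = (\<Sum>T\<in>Pow A. c ^ card T * real_of_int (quad_char P (\<Prod>(insert R T))))"
    proof (rule sum.cong)
      fix T assume T: "T \<in> Pow A"
      then have "finite T" "R \<notin> T" using fin R finite_subset by auto
      then show "c ^ card T * real_of_int (quad_char P (\<Prod>T)) * real_of_int (quad_char P R) =
          c ^ card T * real_of_int (quad_char P (\<Prod>(insert R T)))"
        by (simp add: quad_char_mult[OF odd irr[OF P]] mult_ac)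
    qed simp
    finally show "resonator c A P * real_of_int (quad_char P R) = \<dots>" .
  qed simp
  also have "\<dots> = (\<Sum>T\<in>Pow A. c ^ card T * ?V (insert R T))"
    by (subst sum.swap) (simp add: sum_distrib_left)
  also have "\<bar>\<dots>\<bar> \<le> (\<Sum>T\<in>Pow A. \<bar>c ^ card T * ?V (insert R T)\<bar>)" by (rule sum_abs)
  also have "\<dots> \<le> (\<Sum>T\<in>Pow A. c ^ card T * B)"
  proof (rule sum_mono)
    fix T assume T: "T \<in> Pow A"
    then have "\<bar>?V (insert R T)\<bar> \<le> B" using A R by (intro char_sum[of R]) auto
    then show "\<bar>c ^ card T * ?V (insert R T)\<bar> \<le> c ^ card T * B"
      using c by (simp add: abs_mult mult_left_mono)
  qed
  also have "\<dots> = (1 + c) ^ card A * B"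
    using fin by (simp add: sum_distrib_right[symmetric] sum_power_card_Pow)
  finally show ?thesis .
qed

text \<open>For \<open>R\<close> in \<open>S\<close> the symbol squares to 1, so (1 + c \<chi>)
  \<chi> = \<chi> + c, and both parts are known for S without \<open>R\<close>. Their errors (1 +
  c)^(|S| - 1) B and c (1 + c)^(|S| - 1) B add up exactly.\<close>

lemma sum_resonator_char_ge:
  assumes R: "R \<in> primes_upto Y"
  shows "(\<Sum>P\<in>monic_irreducibles N. resonator c S P * real_of_int (quad_char P R)) \<ge>
    (if R \<in> S then c * real (card (monic_irreducibles N :: 'a poly set)) else 0) - (1 + c) ^ card S * B"
proof (cases "R \<in> S")
  case False
  then show ?thesis using sum_resonator_char[OF subset_refl R False] by simp
next
  case True
  let ?A = "S - {R}"
  have cS: "card S = Suc (card ?A)" by (rule card_Suc_Diff1[OF finite_S True, symmetric])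
  have eq: "resonator c S P * real_of_int (quad_char P R) =
      resonator c ?A P * real_of_int (quad_char P R) + c * resonator c ?A P"
    if P: "P \<in> monic_irreducibles N" for P
  proof -
    have "\<not> P dvd R"
    proof
      assume "P dvd R"
      moreover have "R \<noteq> 0" using R by (auto simp: primes_upto_def)
      ultimately have "degree P \<le> degree R" by (rule dvd_imp_degree_le)
      then show False using P R YN by (simp add: monic_irreducibles_def primes_upto_def)
    qed
    then have "quad_char P R * quad_char P R = 1" by (simp add: quad_char_def)
    then have sq: "real_of_int (quad_char P R) * real_of_int (quad_char P R) = 1"
      by (simp flip: of_int_mult)
    have "resonator c S P = (1 + c * real_of_int (quad_char P R)) * resonator c ?A P"
      unfolding resonator_def using True finite_S by (intro prod.remove) auto
    then have "resonator c S P * real_of_int (quad_char P R) =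
       resonator c ?A P * (real_of_int (quad_char P R) + c * (real_of_int (quad_char P R) * real_of_int (quad_char P R)))"
      by (simp add: algebra_simps)
    then show ?thesis unfolding sq by (simp add: algebra_simps)
  qed
  have "(\<Sum>P\<in>monic_irreducibles N. resonator c S P * real_of_int (quad_char P R)) =
      (\<Sum>P\<in>monic_irreducibles N. resonator c ?A P * real_of_int (quad_char P R)) +
      c * (\<Sum>P\<in>monic_irreducibles N. resonator c ?A P)"
    using eq by (simp add: sum.distrib sum_distrib_left)
  moreover have "(\<Sum>P\<in>monic_irreducibles N. resonator c ?A P * real_of_int (quad_char P R)) \<ge> - ((1 + c) ^ card ?A * B)"
    using sum_resonator_char[of ?A R] R by force
  moreover have "c * (\<Sum>P\<in>monic_irreducibles N. resonator c ?A P) \<ge> c * (real (card (monic_irreducibles N :: 'a poly set)) - (1 + c) ^ card ?A * B)"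
    using sum_resonator[of ?A] c by (intro mult_left_mono) auto
  moreover have "(1 + c) ^ card S * B = (1 + c) ^ card ?A * B + c * ((1 + c) ^ card ?A * B)"
    by (simp add: cS algebra_simps)
  ultimately show ?thesis using True by (simp add: right_diff_distrib)
qed

lemma card_primes_upto_le: "card (primes_upto Y :: 'a poly set) \<le> 2 * CARD('a) ^ Y"
proof -
  have "primes_upto Y = (\<Union>d\<in>{1..Y}. monic_irreducibles d :: 'a poly set)"
    by (auto simp: primes_upto_def monic_irreducibles_def Suc_le_eq irreducible_degree_pos)
  then have "card (primes_upto Y :: 'a poly set) \<le> (\<Sum>d\<in>{1..Y}. card (monic_irreducibles d :: 'a poly set))"
    using card_UN_le[of "{1..Y}" "\<lambda>d. monic_irreducibles d :: 'a poly set"] by simp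
  also have "\<dots> \<le> (\<Sum>d\<in>{1..Y}. CARD('a) ^ d)"
  proof (rule sum_mono)
    fix d assume "d \<in> {1..Y}"
    then have "1 * card (monic_irreducibles d :: 'a poly set) \<le> d * card (monic_irreducibles d :: 'a poly set)"
      by (intro mult_right_mono) auto
    then show "card (monic_irreducibles d :: 'a poly set) \<le> CARD('a) ^ d"
      using card_monic_irreducibles_le[of d, where 'a='a] by linarith
  qed
  also have "\<dots> \<le> 2 * CARD('a) ^ Y" by (rule sum_powers_le) (rule card_field_ge2)
  finally show ?thesis .
qed

text \<open>The weighted sum of ln L is estimated twice. From above, values below \<tau> count as
  \<tau> and the others by the largest weight and the trivial bound. From below, the truncated
  formula is used, in which primes of degree up to Y outside \<open>S\<close> contribute errors
  only.\<close>

theorem resonance_bound: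
  fixes \<sigma> \<tau> :: real
  assumes \<sigma>: "\<sigma> > 1 / 2" and \<tau>: "\<tau> \<ge> 0"
  defines "u \<equiv> real CARD('a) powr (-\<sigma>)"
  defines "tail \<equiv> real N * (u * sqrt (real CARD('a))) ^ Suc Y / (1 - u * sqrt (real CARD('a)))"
  shows "real (card {P\<in>monic_irreducibles N :: 'a poly set. ln_quad_L \<sigma> P \<ge> \<tau>})
      * ((1 + c) ^ card S * (real N * ln (real CARD('a)))) \<ge>
    c * real (card (monic_irreducibles N :: 'a poly set)) * (\<Sum>R\<in>S. u ^ degree R) - 2 * real Y * real CARD('a) ^ Y * ((1 + c) ^ card S * B)
      - (tail + \<tau>) * (real (card (monic_irreducibles N :: 'a poly set)) + (1 + c) ^ card S * B)"
proof -
  let ?I = "monic_irreducibles N :: 'a poly set"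
  let ?U = "primes_upto Y :: 'a poly set"
  let ?W = "resonator c S" and ?C = "(1 + c) ^ card S" and ?q = "real CARD('a)"
  let ?G = "{P\<in>?I. ln_quad_L \<sigma> P \<ge> \<tau>}"
  let ?w = "\<lambda>R::'a poly. prime_weight u Y (degree R)"
  let ?E0 = "\<Sum>P\<in>?I. ?W P"
  have q: "?q > 1" using card_field_ge2[where 'a='a] by simp
  have u: "0 < u" "u < 1" "u * sqrt ?q < 1"
    unfolding u_def by (rule card_powr_bounds[OF \<sigma>])+
  have W: "0 \<le> ?W P" "?W P \<le> ?C" for P by (rule resonator_bounds[OF c])+
  have tail: "tail \<ge> 0" using u by (simp add: tail_def)
  have CB: "0 \<le> ?C * B" using c B by simp
  have E0: "?E0 \<le> real (card (monic_irreducibles N :: 'a poly set)) + ?C * B" using sum_resonator[OF subset_refl] by linarith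
  have upper: "(\<Sum>P\<in>?I. ?W P * ln_quad_L \<sigma> P) \<le> \<tau> * ?E0 + real (card ?G) * (?C * (real N * ln ?q))"
  proof -
    have "(\<Sum>P\<in>?I. ?W P * ln_quad_L \<sigma> P) \<le> (\<Sum>P\<in>?I. \<tau> * ?W P + (if ln_quad_L \<sigma> P \<ge> \<tau> then ?C * (real N * ln ?q) else 0))"
    proof (rule sum_mono)
      fix P assume P: "P \<in> ?I"
      show "?W P * ln_quad_L \<sigma> P \<le> \<tau> * ?W P + (if ln_quad_L \<sigma> P \<ge> \<tau> then ?C * (real N * ln ?q) else 0)"
      proof (cases "ln_quad_L \<sigma> P \<ge> \<tau>")
        case True
        have "?W P * ln_quad_L \<sigma> P \<le> ?W P * (real N * ln ?q)"
          using ln_quad_L_le[OF odd P \<sigma>] W by (intro mult_left_mono)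
        also have "\<dots> \<le> ?C * (real N * ln ?q)" using W q by (intro mult_right_mono) auto
        finally show ?thesis using True W \<tau> by (simp add: add_increasing)
      next
        case False
        then have "?W P * ln_quad_L \<sigma> P \<le> ?W P * \<tau>" using W by (intro mult_left_mono) auto
        then show ?thesis using False by (simp add: mult.commute)
      qed
    qed
    also have "\<dots> = \<tau> * ?E0 + real (card ?G) * (?C * (real N * ln ?q))"
      by (simp add: sum.distrib sum_distrib_left sum.inter_filter[symmetric])
    finally show ?thesis .
  qed
  have lower: "(\<Sum>P\<in>?I. ?W P * ln_quad_L \<sigma> P) \<ge>
      (\<Sum>R\<in>?U. ?w R * (\<Sum>P\<in>?I. ?W P * real_of_int (quad_char P R))) - tail * ?E0"
  proof -
    have "(\<Sum>R\<in>?U. ?w R * (\<Sum>P\<in>?I. ?W P * real_of_int (quad_char P R))) - tail * ?E0 =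
        (\<Sum>P\<in>?I. ?W P * ((\<Sum>R\<in>?U. ?w R * real_of_int (quad_char P R)) - tail))"
      unfolding right_diff_distrib sum_subtractf sum_distrib_left
      by (subst sum.swap) (simp add: mult_ac)
    also have "\<dots> \<le> (\<Sum>P\<in>?I. ?W P * ln_quad_L \<sigma> P)"
      using ln_quad_L_ge[OF odd _ \<sigma>, of _ N Y] W unfolding tail_def u_def
      by (intro sum_mono mult_left_mono) auto
    finally show ?thesis .
  qed
  have w: "u ^ degree R \<le> ?w R" "?w R \<le> real Y" if "R \<in> primes_upto Y" for R :: "'a poly"
    using that u by (auto simp: primes_upto_def irreducible_degree_pos intro!: prime_weight_bounds)
  have w0: "0 \<le> ?w R" if "R \<in> primes_upto Y" for R :: "'a poly"
    using w(1)[OF that] u by (meson less_le_trans order.strict_implies_order zero_less_power)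
  have "(\<Sum>R\<in>?U. ?w R * (\<Sum>P\<in>?I. ?W P * real_of_int (quad_char P R))) \<ge>
      (\<Sum>R\<in>?U. ?w R * ((if R \<in> S then c * real (card (monic_irreducibles N :: 'a poly set)) else 0) - ?C * B))"
    using sum_resonator_char_ge w0 by (intro sum_mono mult_left_mono) auto
  also have "(\<Sum>R\<in>?U. ?w R * ((if R \<in> S then c * real (card (monic_irreducibles N :: 'a poly set)) else 0) - ?C * B)) =
      (\<Sum>R\<in>S. ?w R * (c * real (card (monic_irreducibles N :: 'a poly set)))) - (\<Sum>R\<in>?U. ?w R) * (?C * B)"
  proof -
    have "(\<Sum>R\<in>S. ?w R * (c * real (card (monic_irreducibles N :: 'a poly set)))) = (\<Sum>R\<in>?U. if R \<in> S then ?w R * (c * real (card (monic_irreducibles N :: 'a poly set))) else 0)"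
      using S by (subst sum.inter_restrict[symmetric]) (auto simp: Int_absorb1)
    then show ?thesis
      by (simp add: right_diff_distrib sum_subtractf sum_distrib_right if_distrib[of "\<lambda>x. _ * x"] cong: if_cong)
  qed
  finally have main: "(\<Sum>R\<in>?U. ?w R * (\<Sum>P\<in>?I. ?W P * real_of_int (quad_char P R))) \<ge>
      (\<Sum>R\<in>S. ?w R * (c * real (card (monic_irreducibles N :: 'a poly set)))) - (\<Sum>R\<in>?U. ?w R) * (?C * B)" .
  have m1: "(\<Sum>R\<in>S. ?w R * (c * real (card (monic_irreducibles N :: 'a poly set)))) \<ge> c * real (card (monic_irreducibles N :: 'a poly set)) * (\<Sum>R\<in>S. u ^ degree R)"
    unfolding sum_distrib_left using S w c by (intro sum_mono) (auto simp: mult.commute intro!: mult_right_mono)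
  have m2: "(\<Sum>R\<in>?U. ?w R) * (?C * B) \<le> 2 * real Y * ?q ^ Y * (?C * B)"
  proof (rule mult_right_mono[OF _ CB])
    have "(\<Sum>R\<in>?U. ?w R) \<le> (\<Sum>R\<in>(primes_upto Y :: 'a poly set). real Y)"
      using w by (intro sum_mono) auto
    also have "\<dots> = real (card (primes_upto Y :: 'a poly set)) * real Y" by simp
    also have "\<dots> \<le> real (2 * CARD('a) ^ Y) * real Y"
      using card_primes_upto_le by (intro mult_right_mono) (simp_all only: of_nat_le_iff of_nat_0_le_iff)
    finally show "(\<Sum>R\<in>?U. ?w R) \<le> 2 * real Y * ?q ^ Y" by (simp add: mult_ac)
  qed
  have m3: "(tail + \<tau>) * ?E0 \<le> (tail + \<tau>) * (real (card (monic_irreducibles N :: 'a poly set)) + ?C * B)"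
    using E0 tail \<tau> by (intro mult_left_mono) auto
  have "(tail + \<tau>) * ?E0 = tail * ?E0 + \<tau> * ?E0" by (rule distrib_right)
  then show ?thesis using upper lower main m1 m2 m3 by linarith
qed

end

text \<open>The product of the primes in a subset of \<open>insert R S\<close> has degree at most
  the total degree of \<open>S\<close> plus Y; this gives the factor in front of sqrt(q)^N.\<close>

lemma resonance_construct:
  fixes S :: "'a::{finite,field} poly set"
  assumes odd: "odd CARD('a)" and S: "S \<subseteq> primes_upto Y" and YN: "Y < N" and c: "0 \<le> c" "c \<le> 1"
  shows "resonance S N Y c ((real (\<Sum>R\<in>S. degree R) + real Y + 1) * sqrt (real CARD('a)) ^ N / real N)"
proof
  let ?B = "(real (\<Sum>R\<in>S. degree R) + real Y + 1) * sqrt (real CARD('a)) ^ N / real N"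
  show "0 \<le> ?B" by (intro divide_nonneg_nonneg mult_nonneg_nonneg add_nonneg_nonneg of_nat_0_le_iff) auto
  fix T and R :: "'a poly" assume R: "R \<in> primes_upto Y" and sub: "T \<subseteq> insert R S" "T \<noteq> {}"
  have finS: "finite S" using S finite_primes_upto finite_subset by blast
  have fin: "finite T" using sub finS finite_subset by blast
  have irr: "irreducible Q \<and> lead_coeff Q = 1" if "Q \<in> T" for Q
    using that sub R S by (auto simp: primes_upto_def)
  interpret prime_set T
    by unfold_locales (use odd fin sub irr in auto)
  have "degree (\<Prod>T) = (\<Sum>Q\<in>T. degree Q)" by (rule degree_f)
  also have "\<dots> \<le> (\<Sum>Q\<in>insert R S. degree Q)" using sub finS by (intro sum_mono2) auto
  also have "\<dots> \<le> (\<Sum>R\<in>S. degree R) + Y"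
    using R finS by (cases "R \<in> S") (auto simp: primes_upto_def insert_absorb)
  finally have "real (degree (\<Prod>T)) \<le> real ((\<Sum>R\<in>S. degree R) + Y)" by (simp only: of_nat_le_iff)
  then have "(real (degree (\<Prod>T)) + 1) * sqrt (real CARD('a)) ^ N \<le>
      (real (\<Sum>R\<in>S. degree R) + real Y + 1) * sqrt (real CARD('a)) ^ N"
    by (intro mult_right_mono) auto
  then have "real N * \<bar>\<Sum>P\<in>monic_irreducibles N. real_of_int (quad_char P (\<Prod>T))\<bar> \<le>
      (real (\<Sum>R\<in>S. degree R) + real Y + 1) * sqrt (real CARD('a)) ^ N"
    using sum_quad_char_primes_bound[of N] YN by linarith
  then show "\<bar>\<Sum>P\<in>monic_irreducibles N. real_of_int (quad_char P (\<Prod>T))\<bar> \<le> ?B"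
    using YN by (simp add: field_simps)
qed (use assms in auto)

section \<open>Primes of small degree\<close>

lemma sum_primes_upto_by_degree:
  fixes g :: "nat \<Rightarrow> real"
  shows "(\<Sum>R\<in>(primes_upto y :: 'a::{finite,field} poly set). g (degree R)) =
    (\<Sum>d\<in>{1..y}. real (card (monic_irreducibles d :: 'a poly set)) * g d)"
proof -
  have "primes_upto y = (\<Union>d\<in>{1..y}. monic_irreducibles d :: 'a poly set)"
    by (auto simp: primes_upto_def monic_irreducibles_def Suc_le_eq irreducible_degree_pos)
  then have "(\<Sum>R\<in>(primes_upto y :: 'a poly set). g (degree R)) =
      (\<Sum>d\<in>{1..y}. \<Sum>R\<in>(monic_irreducibles d :: 'a poly set). g (degree R))"
    by (simp only:) (rule sum.UNION_disjoint, simp, simp, auto simp: monic_irreducibles_def)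
  also have "\<dots> = (\<Sum>d\<in>{1..y}. real (card (monic_irreducibles d :: 'a poly set)) * g d)"
    by (rule sum.cong) (simp_all add: monic_irreducibles_def)
  finally show ?thesis .
qed

lemma card_primes_upto_eq:
  "real (card (primes_upto y :: 'a::{finite,field} poly set)) =
    (\<Sum>d\<in>{1..y}. real (card (monic_irreducibles d :: 'a poly set)))"
  using sum_primes_upto_by_degree[of "\<lambda>_. 1" y, where 'a='a] by simp

lemma card_monic_irreducibles_le':
  "d > 0 \<Longrightarrow> real (card (monic_irreducibles d :: 'a::{finite,field} poly set)) \<le> real CARD('a) ^ d / real d"
  using card_monic_irreducibles_le[of d, where 'a='a]
  by (simp add: pos_le_divide_eq mult.commute flip: of_nat_power of_nat_mult)

lemma card_monic_irreducibles_ge':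
  assumes "\<eta> > 0"
  shows "\<forall>\<^sub>F d in sequentially. real (card (monic_irreducibles d :: 'a::{finite,field} poly set)) \<ge>
    (1 - \<eta>) * real CARD('a) ^ d / real d"
proof -
  let ?r = "sqrt (real CARD('a))"
  have r: "?r > 1" using card_field_ge2[where 'a='a] by simp
  have "(\<lambda>d. 2 * (1 / ?r) ^ d) \<longlonglongrightarrow> 2 * 0"
    using r by (intro tendsto_mult_left LIMSEQ_power_zero) simp
  then have "\<forall>\<^sub>F d in sequentially. 2 * (1 / ?r) ^ d < \<eta>"
    using assms by (intro order_tendstoD(2)[of _ "2 * 0"]) auto
  then show ?thesis using eventually_gt_at_top[of 0]
  proof eventually_elim
    case (elim d)
    have "2 * ?r ^ d = 2 * (1 / ?r) ^ d * (?r ^ d * ?r ^ d)"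
      using r by (simp add: power_divide)
    also have "?r ^ d * ?r ^ d = real CARD('a) ^ d" by (simp flip: power_mult_distrib)
    finally have "2 * ?r ^ d \<le> \<eta> * real CARD('a) ^ d"
      using elim(1) by (simp add: mult_right_mono)
    then have "(1 - \<eta>) * real CARD('a) ^ d \<le> real d * real (card (monic_irreducibles d :: 'a poly set))"
      using card_monic_irreducibles_ge[OF elim(2), where 'a='a] by (simp add: algebra_simps)
    then show ?case using elim(2) by (simp add: pos_divide_le_eq mult.commute)
  qed
qed

text \<open>The terms with \<open>d\<close> close to \<open>y\<close> already give the geometric series
  \<open>\<Sum>\<^sub>j q\<^bsup>-j(1-\<sigma>)\<^esup>\<close>.\<close>

lemma prime_sum_lower:
  fixes \<sigma> \<eta> :: real
  assumes \<sigma>: "\<sigma> < 1" and \<eta>: "0 < \<eta>" "\<eta> < 1"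
  defines "q \<equiv> real CARD('a::{finite,field})"
  shows "\<forall>\<^sub>F y in sequentially. (\<Sum>R\<in>(primes_upto y :: 'a poly set). (q powr (-\<sigma>)) ^ degree R) \<ge>
    (1 - \<eta>) * (1 / (1 - q powr (\<sigma> - 1))) * (q powr (1 - \<sigma>)) ^ y / real y"
proof -
  define x where "x = q powr (1 - \<sigma>)"
  define u where "u = q powr (-\<sigma>)"
  \<comment> \<open>One factor \<theta> is spent on cutting the geometric series to J terms, another
    on the number of primes of each degree; \<theta>^2 \<ge> 1 - \<eta>.\<close>
  define \<theta> where "\<theta> = 1 - \<eta> / 2"
  have q: "q > 1" using card_field_ge2[where 'a='a] by (simp add: q_def)
  have qu: "q * u = x" using q by (simp add: x_def u_def powr_diff powr_minus divide_inverse)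
  have x: "x > 1" unfolding x_def using q \<sigma> by simp
  have xi: "q powr (\<sigma> - 1) = 1 / x" using q by (simp add: x_def powr_diff)
  have u: "u > 0" using q by (simp add: u_def)
  have \<theta>: "0 < \<theta>" "\<theta> < 1" "\<theta> * \<theta> \<ge> 1 - \<eta>" using \<eta> by (auto simp: \<theta>_def algebra_simps)
  let ?Z = "1 / (1 - 1 / x)"
  have Z: "?Z > 0" using x by simp
  have "(\<lambda>n. \<Sum>j<n. (1 / x) ^ j) \<longlonglongrightarrow> ?Z"
    using geometric_sums[of "1 / x"] x by (simp add: sums_def)
  moreover have "\<theta> * ?Z < 1 * ?Z" using \<theta> Z by (intro mult_strict_right_mono) auto
  ultimately have "\<forall>\<^sub>F n in sequentially. (\<Sum>j<n. (1 / x) ^ j) > \<theta> * ?Z"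
    by (intro order_tendstoD(1)[where y = ?Z]) simp_all
  then obtain J where J: "(\<Sum>j<J. (1 / x) ^ j) > \<theta> * ?Z"
    by (auto simp: eventually_at_top_linorder)
  obtain d0 where d0: "\<And>d. d \<ge> d0 \<Longrightarrow> real (card (monic_irreducibles d :: 'a poly set)) \<ge> \<theta> * q ^ d / real d"
    using card_monic_irreducibles_ge'[of "\<eta> / 2", where 'a='a] \<eta>
    unfolding eventually_at_top_linorder \<theta>_def q_def by auto
  show ?thesis
    using eventually_ge_at_top[of "J + d0 + 1"]
  proof eventually_elim
    case (elim y)
    have "(1 - \<eta>) * ?Z * x ^ y / real y \<le> (\<theta> * \<theta>) * ?Z * x ^ y / real y"
      using \<theta> Z x by (intro divide_right_mono mult_right_mono) auto
    also have "\<dots> = \<theta> * x ^ y / real y * (\<theta> * ?Z)" by (simp add: mult_ac)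
    also have "\<dots> \<le> \<theta> * x ^ y / real y * (\<Sum>j<J. (1 / x) ^ j)"
      using J \<theta> x by (intro mult_left_mono) auto
    also have "\<dots> = (\<Sum>j<J. \<theta> * x ^ y / real y * (1 / x) ^ j)" by (rule sum_distrib_left)
    also have "\<dots> \<le> (\<Sum>j<J. real (card (monic_irreducibles (y - j) :: 'a poly set)) * u ^ (y - j))"
    proof (rule sum_mono)
      fix j assume j: "j \<in> {..<J}"
      have yj: "y - j \<ge> d0" "y - j > 0" "y - j \<le> y" using elim j by auto
      have "\<theta> * x ^ y / real y * (1 / x) ^ j = \<theta> * x ^ (y - j) / real y"
        using x j elim by (simp add: power_divide power_diff)
      also have "\<dots> \<le> \<theta> * x ^ (y - j) / real (y - j)"
        using yj \<theta> x by (intro divide_left_mono) auto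
      also have "\<dots> = \<theta> * q ^ (y - j) / real (y - j) * u ^ (y - j)"
        by (simp add: qu[symmetric] power_mult_distrib)
      also have "\<dots> \<le> real (card (monic_irreducibles (y - j) :: 'a poly set)) * u ^ (y - j)"
        using d0[OF yj(1)] u by (intro mult_right_mono) auto
      finally show "\<theta> * x ^ y / real y * (1 / x) ^ j \<le> \<dots>" .
    qed
    also have "\<dots> = (\<Sum>d\<in>(\<lambda>j. y - j) ` {..<J}. real (card (monic_irreducibles d :: 'a poly set)) * u ^ d)"
      using elim by (subst sum.reindex) (auto intro!: inj_onI)
    also have "\<dots> \<le> (\<Sum>d\<in>{1..y}. real (card (monic_irreducibles d :: 'a poly set)) * u ^ d)"
      using elim u by (intro sum_mono2) auto
    also have "\<dots> = (\<Sum>R\<in>(primes_upto y :: 'a poly set). u ^ degree R)"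
      by (rule sum_primes_upto_by_degree[symmetric])
    finally show ?case unfolding xi x_def[symmetric] u_def[symmetric] .
  qed
qed

text \<open>By induction the sum stays below C + \<theta> Z q^y/y with Z = q/(q - 1) and \<theta>
  strictly between 1 and 1 + \<eta>; the constant C is finally absorbed by the gap between \<theta>
  and 1 + \<eta>.\<close>

lemma sum_power_over_le:
  fixes q \<eta> :: real
  assumes q: "q > 1" and \<eta>: "\<eta> > 0"
  shows "\<forall>\<^sub>F y in sequentially. (\<Sum>d\<in>{1..y}. q ^ d / real d) \<le> (1 + \<eta>) * (q / (q - 1)) * q ^ y / real y"
proof -
  define \<theta> where "\<theta> = 1 + \<eta> / 2"
  have \<theta>: "\<theta> > 1" "\<theta> < 1 + \<eta>" using \<eta> by (auto simp: \<theta>_def)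
  define Z where "Z = q / (q - 1)"
  have Z: "Z > 0" "Z * (q - 1) = q" using q by (auto simp: Z_def)
  \<comment> \<open>From here on \<theta> Z q^y/y grows in each step by at least the new term q^(y +
    1)/(y + 1); using Z (q - 1) = q, that requirement reduces to this bound on y.\<close>
  obtain y1 where y1: "y1 \<ge> 1" "real y1 \<ge> \<theta> / ((\<theta> - 1) * (q - 1))"
    using real_arch_simple[of "max 1 (\<theta> / ((\<theta> - 1) * (q - 1)))"] by auto
  define C where "C = (\<Sum>d\<in>{1..y1}. q ^ d / real d)"
  have bound: "(\<Sum>d\<in>{1..y}. q ^ d / real d) \<le> C + \<theta> * Z * q ^ y / real y" if "y \<ge> y1" for y
    using that
  proof (induction y rule: dec_induct)
    case base
    show ?case using \<theta> Z q by (simp add: C_def)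
  next
    case (step y)
    have y: "real y > 0" "real y \<ge> \<theta> / ((\<theta> - 1) * (q - 1))" using step y1 by auto
    have "\<theta> \<le> real y * ((\<theta> - 1) * (q - 1))"
      using y(2) \<theta> q by (subst (asm) pos_divide_le_eq) auto
    have "\<theta> * Z * (real y + 1) + q * real y \<le> \<theta> * Z * q * real y"
    proof -
      have "Z * \<theta> \<le> Z * (real y * ((\<theta> - 1) * (q - 1)))"
        using \<open>\<theta> \<le> _\<close> Z by (intro mult_left_mono) auto
      also have "\<dots> = real y * (\<theta> - 1) * (Z * (q - 1))" by simp
      also have "\<dots> = real y * (\<theta> - 1) * q" by (simp only: Z)
      finally have 1: "Z * \<theta> \<le> real y * (\<theta> - 1) * q" .
      have "\<theta> * Z * q * real y = \<theta> * real y * (Z * (q - 1)) + \<theta> * Z * real y" by (simp add: algebra_simps)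
      also have "\<dots> = \<theta> * real y * q + \<theta> * Z * real y" by (simp only: Z)
      finally show ?thesis using 1 by (simp add: algebra_simps)
    qed
    then have "(\<theta> * Z * (real y + 1) + q * real y) * (q ^ y / (real y * (real y + 1))) \<le>
        (\<theta> * Z * q * real y) * (q ^ y / (real y * (real y + 1)))"
      using y q by (intro mult_right_mono) auto
    moreover have "(\<theta> * Z * r + q * real y) * (q ^ y / (real y * r)) = \<theta> * Z * q ^ y / real y + q ^ Suc y / r"
      "(\<theta> * Z * q * real y) * (q ^ y / (real y * r)) = \<theta> * Z * q ^ Suc y / r" if "r > 0" for r
      using y that by (simp_all add: field_simps)
    ultimately have "\<theta> * Z * q ^ y / real y + q ^ Suc y / (real y + 1) \<le> \<theta> * Z * q ^ Suc y / (real y + 1)"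
      by simp
    then show ?case using step.IH by (simp add: add.commute)
  qed
  have "\<forall>\<^sub>F y in sequentially. C \<le> (1 + \<eta> - \<theta>) * Z * (q ^ y / real y)"
  proof -
    have "filterlim (\<lambda>y::nat. q ^ y / real y) at_top sequentially" using q by real_asymp
    then have "filterlim (\<lambda>y::nat. (1 + \<eta> - \<theta>) * Z * (q ^ y / real y)) at_top sequentially"
      using \<theta> Z by (intro filterlim_tendsto_pos_mult_at_top[OF tendsto_const]) auto
    then show ?thesis by (simp add: filterlim_at_top)
  qed
  then show ?thesis
    using eventually_ge_at_top[of y1]
  proof eventually_elim
    case (elim y)
    have "C + \<theta> * Z * q ^ y / real y \<le> (1 + \<eta>) * Z * q ^ y / real y"
      using elim(1) by (simp add: algebra_simps add_divide_distrib diff_divide_distrib)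
    then show ?case using bound[OF elim(2)] unfolding Z_def by linarith
  qed
qed

section \<open>The number of primes up to a given degree and the cutoff\<close>

lemma card_primes_upto_upper:
  assumes "\<eta> > 0"
  shows "\<forall>\<^sub>F y in sequentially. real (card (primes_upto y :: 'a::{finite,field} poly set)) \<le>
    (1 + \<eta>) * (real CARD('a) / (real CARD('a) - 1)) * real CARD('a) ^ y / real y"
proof -
  have q: "real CARD('a) > 1" using card_field_ge2[where 'a='a] by simp
  show ?thesis using sum_power_over_le[OF q assms]
  proof eventually_elim
    case (elim y)
    have "real (card (primes_upto y :: 'a poly set)) \<le> (\<Sum>d\<in>{1..y}. real CARD('a) ^ d / real d)"
      unfolding card_primes_upto_eq using card_monic_irreducibles_le'[where 'a='a] by (intro sum_mono) auto
    then show ?case using elim by linarith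
  qed
qed

lemma card_primes_upto_lower:
  "\<forall>\<^sub>F y in sequentially. real CARD('a) ^ y / (2 * real y) \<le> real (card (primes_upto y :: 'a::{finite,field} poly set))"
  using card_monic_irreducibles_ge'[of "1 / 2", where 'a='a]
proof (rule eventually_mono[OF eventually_conj[OF _ eventually_gt_at_top[of 0]]])
  fix y assume y: "real (card (monic_irreducibles y :: 'a poly set)) \<ge> (1 - 1 / 2) * real CARD('a) ^ y / real y \<and> 0 < y"
  have "card (monic_irreducibles y :: 'a poly set) \<le> card (primes_upto y :: 'a poly set)"
    by (rule card_mono[OF finite_primes_upto]) (auto simp: monic_irreducibles_def primes_upto_def)
  then show "real CARD('a) ^ y / (2 * real y) \<le> real (card (primes_upto y :: 'a poly set))" using y by simp
qed simp

lemma card_primes_upto_mono: "y \<le> y' \<Longrightarrow> card (primes_upto y :: 'a::{finite,field} poly set) \<le> card (primes_upto y' :: 'a poly set)"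
  by (rule card_mono[OF finite_primes_upto]) (auto simp: primes_upto_def)

text \<open>The first inequality limits the largest value of the resonator. The second, at y + 1, is
  the only lower bound for q^y; passing from y + 1 to y loses a factor q, which reappears in
  \<open>beta0\<close>.\<close>

lemma exists_cutoff:
  assumes K: "K > 0"
  shows "\<exists>y::nat \<Rightarrow> nat. \<forall>N. real (card (primes_upto (y N) :: 'a::{finite,field} poly set)) \<le> K * real N \<and>
    K * real N < real (card (primes_upto (Suc (y N)) :: 'a poly set))"
proof (rule choice, rule allI)
  fix N :: nat
  let ?a = "\<lambda>y. real (card (primes_upto y :: 'a poly set))"
  have q: "real CARD('a) > 1" using card_field_ge2[where 'a='a] by simp
  have "filterlim (\<lambda>y::nat. real CARD('a) ^ y / (2 * real y)) at_top sequentially" using q by real_asymp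
  then have "\<forall>\<^sub>F y in sequentially. real CARD('a) ^ y / (2 * real y) > K * real N"
    by (simp add: filterlim_at_top_dense)
  then have "\<forall>\<^sub>F y in sequentially. ?a y > K * real N"
    using card_primes_upto_lower[where 'a='a] by eventually_elim linarith
  then obtain y0 where y0: "?a y0 > K * real N" by (auto simp: eventually_at_top_linorder)
  define z where "z = (LEAST y. ?a y > K * real N)"
  have z: "?a z > K * real N" unfolding z_def by (rule LeastI[of _ y0]) (rule y0)
  have "primes_upto 0 = ({} :: 'a poly set)" by (auto simp: primes_upto_def dest: irreducible_degree_pos)
  have "z \<noteq> 0"
  proof
    assume "z = 0"
    then have "K * real N < 0" using z \<open>primes_upto 0 = {}\<close> by simp
    then show False using K by (simp add: mult_less_0_iff)
  qed
  then obtain y where y: "z = Suc y" by (cases z) auto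
  then have "\<not> ?a y > K * real N" using not_less_Least[of y "\<lambda>y. ?a y > K * real N"] unfolding z_def[symmetric] by simp
  then show "\<exists>y. ?a y \<le> K * real N \<and> K * real N < ?a (Suc y)" using z y by (intro exI[of _ y]) (simp add: not_less)
qed

context
  fixes y :: "nat \<Rightarrow> nat" and K :: real and q :: real
  assumes K: "K > 0" and q_def: "q = real CARD('a::{finite,field})"
    and y: "\<And>N. real (card (primes_upto (y N) :: 'a poly set)) \<le> K * real N"
      "\<And>N. K * real N < real (card (primes_upto (Suc (y N)) :: 'a poly set))"
begin

lemma q_gt1: "q > 1"
  using card_field_ge2[where 'a='a] by (simp add: q_def)

lemma cutoff_at_top: "filterlim y at_top sequentially"
  unfolding filterlim_at_top
proof
  fix Z :: nat
  have "\<forall>\<^sub>F N in sequentially. real N \<ge> real (card (primes_upto Z :: 'a poly set)) / K"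
    using filterlim_real_sequentially by (simp add: filterlim_at_top)
  then show "\<forall>\<^sub>F N in sequentially. Z \<le> y N"
  proof eventually_elim
    case (elim N)
    then have "real (card (primes_upto Z :: 'a poly set)) \<le> K * real N" using K by (simp add: pos_divide_le_eq mult.commute)
    also have "\<dots> < real (card (primes_upto (Suc (y N)) :: 'a poly set))" by (rule y)
    finally have "card (primes_upto Z :: 'a poly set) < card (primes_upto (Suc (y N)) :: 'a poly set)" by simp
    then have "\<not> Suc (y N) \<le> Z" using card_primes_upto_mono[of "Suc (y N)" Z, where 'a='a] by linarith
    then show ?case by simp
  qed
qed

text \<open>The primes of degree y alone give q^y \<le> 2 y K N. The factor 2 y K is at most exp(s
  y), and s is chosen so that ln q - s = ln q/(1 + \<eta>).\<close>

lemma cutoff_le_log: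
  assumes \<eta>: "\<eta> > 0"
  shows "\<forall>\<^sub>F N in sequentially. real (y N) \<le> (1 + \<eta>) * log q (real N)"
proof -
  define s where "s = \<eta> / (1 + \<eta>) * ln q"
  have s: "s > 0" using \<eta> q_gt1 by (simp add: s_def)
  have "\<forall>\<^sub>F Y::nat in sequentially. 2 * real Y * K \<le> exp (s * real Y)" using s K by real_asymp
  then have "\<forall>\<^sub>F N in sequentially. 2 * real (y N) * K \<le> exp (s * real (y N))"
    by (rule eventually_compose_filterlim[OF _ cutoff_at_top])
  moreover have "\<forall>\<^sub>F N in sequentially. q ^ y N / (2 * real (y N)) \<le> real (card (primes_upto (y N) :: 'a poly set))"
    using eventually_compose_filterlim[OF card_primes_upto_lower cutoff_at_top] by (simp add: q_def)
  moreover have "\<forall>\<^sub>F N in sequentially. y N > 0"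
    using eventually_compose_filterlim[OF eventually_gt_at_top[of 0] cutoff_at_top] .
  ultimately show ?thesis using eventually_gt_at_top[of 0]
  proof eventually_elim
    case (elim N)
    have "q ^ y N / (2 * real (y N)) \<le> K * real N" using elim(2) y(1)[of N] by linarith
    then have "q ^ y N \<le> (2 * real (y N) * K) * real N" using elim(3) by (simp add: pos_divide_le_eq mult_ac)
    also have "\<dots> \<le> exp (s * real (y N)) * real N" using elim(1) by (intro mult_right_mono) auto
    finally have "exp (ln q * real (y N)) \<le> exp (s * real (y N)) * real N"
      using q_gt1 by (simp add: exp_of_nat2_mult)
    then have "exp (ln q * real (y N)) / exp (s * real (y N)) \<le> real N"
      by (simp add: pos_divide_le_eq mult.commute)
    then have "exp (ln q * real (y N) - s * real (y N)) \<le> real N" by (simp add: exp_diff)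
    then have "ln q * real (y N) - s * real (y N) \<le> ln (real N)"
      using elim(4) by (subst (asm) ln_ge_iff[symmetric]) auto
    moreover have "ln q * real (y N) - s * real (y N) = real (y N) * ln q / (1 + \<eta>)"
      using \<eta> by (simp add: s_def field_simps)
    ultimately have "real (y N) * ln q \<le> (1 + \<eta>) * ln (real N)" using \<eta> by (simp add: pos_divide_le_eq mult.commute)
    then show ?case using q_gt1 by (simp add: log_def pos_le_divide_eq)
  qed
qed

text \<open>The sum is about q^(y (1 - \<sigma>))/y = (q^y/y)^(1 - \<sigma>) y^(-\<sigma>). The
  first factor is bounded below by the choice of y, the second by y being at most about log N; this
  is the shape N^(1 - \<sigma>) (log N)^(-\<sigma>).\<close>

lemma cutoff_sum_lower:
  fixes \<sigma> \<omega> :: real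
  assumes \<sigma>: "0 < \<sigma>" "\<sigma> < 1" and \<omega>: "0 < \<omega>" "\<omega> < 1"
  shows "\<forall>\<^sub>F N in sequentially. (\<Sum>R\<in>(primes_upto (y N) :: 'a poly set). (q powr (-\<sigma>)) ^ degree R) \<ge>
    \<omega> * (1 / (1 - q powr (\<sigma> - 1))) * (K * (q - 1) / (q * q)) powr (1 - \<sigma>)
      * (real N powr (1 - \<sigma>) * log q (real N) powr (-\<sigma>))"
proof -
  \<comment> \<open>Solves \<omega> = (1 - \<eta>)/(1 + \<eta>): the sum over primes loses 1 -
    \<eta>, and the losses (1 + \<eta>)^(-(1 - \<sigma>)) and (1 + \<eta>)^(-\<sigma>) multiply to
    1/(1 + \<eta>).\<close>
  define \<eta> where "\<eta> = (1 - \<omega>) / (1 + \<omega>)"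
  have \<eta>: "0 < \<eta>" "\<eta> < 1" using \<omega> by (auto simp: \<eta>_def field_simps)
  have \<omega>_eq: "\<omega> = (1 - \<eta>) / (1 + \<eta>)" using \<omega> by (simp add: \<eta>_def field_simps)
  let ?Z = "1 / (1 - q powr (\<sigma> - 1))"
  have Z: "?Z > 0" using q_gt1 \<sigma> powr_less_mono[of "\<sigma> - 1" 0 q] by simp
  have 1: "\<forall>\<^sub>F N in sequentially. (\<Sum>R\<in>(primes_upto (y N) :: 'a poly set). (q powr (-\<sigma>)) ^ degree R) \<ge>
      (1 - \<eta>) * ?Z * (q powr (1 - \<sigma>)) ^ y N / real (y N)"
    using eventually_compose_filterlim[OF prime_sum_lower[OF \<sigma>(2) \<eta>, where 'a='a] cutoff_at_top]
    by (simp add: q_def)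
  have 2: "\<forall>\<^sub>F N in sequentially. real (card (primes_upto (Suc (y N)) :: 'a poly set)) \<le>
      (1 + \<eta>) * (q / (q - 1)) * q ^ Suc (y N) / real (Suc (y N))"
    using eventually_compose_filterlim[OF card_primes_upto_upper[OF \<eta>(1), where 'a='a]
        filterlim_compose[OF filterlim_Suc cutoff_at_top]] by (simp add: q_def)
  have 3: "\<forall>\<^sub>F N in sequentially. y N > 0"
    using eventually_compose_filterlim[OF eventually_gt_at_top[of 0] cutoff_at_top] .
  show ?thesis
    using 1 2 3 cutoff_le_log[OF \<eta>(1)] eventually_gt_at_top[of 1]
  proof eventually_elim
    case (elim N)
    define Y where "Y = real (y N)"
    have Y: "Y > 0" using elim by (simp add: Y_def)
    have lg: "log q (real N) > 0" using q_gt1 elim by simp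
    have "K * real N \<le> (1 + \<eta>) * (q / (q - 1)) * q ^ Suc (y N) / real (Suc (y N))"
      using elim(2) y(2)[of N] by linarith
    also have "\<dots> \<le> (1 + \<eta>) * (q / (q - 1)) * q ^ Suc (y N) / Y"
      using Y \<eta> q_gt1 by (intro divide_left_mono) (auto simp: Y_def)
    also have "\<dots> = (1 + \<eta>) * (q * q / (q - 1)) * (q ^ y N / Y)" by simp
    finally have "K * real N / ((1 + \<eta>) * (q * q / (q - 1))) \<le> q ^ y N / Y"
      using \<eta> q_gt1 by (subst pos_divide_le_eq) (simp_all only: mult.commute, simp)
    moreover have "K * real N / ((1 + \<eta>) * (q * q / (q - 1))) = K * (q - 1) / (q * q) * real N / (1 + \<eta>)"
      using \<eta> q_gt1 by (simp add: field_simps)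
    ultimately have base: "K * (q - 1) / (q * q) * real N / (1 + \<eta>) \<le> q ^ y N / Y" by simp
    have "\<omega> * ?Z * (K * (q - 1) / (q * q)) powr (1 - \<sigma>) * (real N powr (1 - \<sigma>) * log q (real N) powr (-\<sigma>))
        = (1 - \<eta>) * ?Z * ((K * (q - 1) / (q * q) * real N / (1 + \<eta>)) powr (1 - \<sigma>) * ((1 + \<eta>) * log q (real N)) powr (-\<sigma>))"
    proof -
      have "(1 + \<eta>) powr (1 - \<sigma>) * (1 + \<eta>) powr \<sigma> = 1 + \<eta>" using \<eta> by (simp flip: powr_add)
      then have "1 / (1 + \<eta>) = (1 / (1 + \<eta>) powr (1 - \<sigma>)) * (1 + \<eta>) powr (-\<sigma>)"
        using \<eta> by (simp add: powr_minus field_simps)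
      moreover have "(K * (q - 1) / (q * q) * real N / (1 + \<eta>)) powr (1 - \<sigma>) =
          (K * (q - 1) / (q * q)) powr (1 - \<sigma>) * real N powr (1 - \<sigma>) * (1 / (1 + \<eta>) powr (1 - \<sigma>))"
      proof -
        have pw: "(k * real N / (1 + \<eta>)) powr (1 - \<sigma>) =
            k powr (1 - \<sigma>) * real N powr (1 - \<sigma>) * (1 / (1 + \<eta>) powr (1 - \<sigma>))" if "k > 0" for k
          using that \<eta> by (simp add: powr_divide powr_mult)
        show ?thesis by (rule pw) (use K q_gt1 in simp)
      qed
      moreover have "((1 + \<eta>) * log q (real N)) powr (-\<sigma>) = (1 + \<eta>) powr (-\<sigma>) * log q (real N) powr (-\<sigma>)"
        using \<eta> lg by (subst powr_mult) auto
      ultimately show ?thesis unfolding \<omega>_eq divide_inverse[of "1 - \<eta>"]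
        by (simp add: inverse_eq_divide mult_ac)
    qed
    also have "\<dots> \<le> (1 - \<eta>) * ?Z * ((q ^ y N / Y) powr (1 - \<sigma>) * Y powr (-\<sigma>))"
    proof (intro mult_left_mono mult_mono)
      show "(K * (q - 1) / (q * q) * real N / (1 + \<eta>)) powr (1 - \<sigma>) \<le> (q ^ y N / Y) powr (1 - \<sigma>)"
        using base \<sigma> K q_gt1 \<eta> by (intro powr_mono2) auto
      show "((1 + \<eta>) * log q (real N)) powr (-\<sigma>) \<le> Y powr (-\<sigma>)"
        using elim(4) Y \<sigma> unfolding Y_def by (intro powr_mono2') auto
    qed (use Z \<eta> in auto)
    also have "(q ^ y N / Y) powr (1 - \<sigma>) * Y powr (-\<sigma>) = (q powr (1 - \<sigma>)) ^ y N / Y"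
    proof -
      have A: "(q ^ y N / Y) powr (1 - \<sigma>) = (q powr (1 - \<sigma>)) ^ y N / Y powr (1 - \<sigma>)"
        using q_gt1 Y by (simp add: powr_divide powr_power powr_realpow[symmetric] powr_powr mult.commute)
      have YY: "Y powr (1 - \<sigma>) * Y powr \<sigma> = Y" using Y by (simp flip: powr_add)
      have "(q ^ y N / Y) powr (1 - \<sigma>) * Y powr (-\<sigma>) =
          (q powr (1 - \<sigma>)) ^ y N / Y powr (1 - \<sigma>) * inverse (Y powr \<sigma>)"
        by (simp only: A powr_minus)
      also have "\<dots> = (q powr (1 - \<sigma>)) ^ y N / (Y powr (1 - \<sigma>) * Y powr \<sigma>)"
        by (simp only: divide_inverse inverse_mult_distrib mult.assoc)
      finally show ?thesis by (simp only: YY)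
    qed
    finally show ?case using elim(1) by (simp add: Y_def mult_ac)
  qed
qed

end

section \<open>Large values\<close>

text \<open>This c makes the largest factor 1 + c of the resonator the ratio inside \<alpha>, while
  c exceeds b by the factor 2/(1 + b^2). That factor is the slack of the whole argument.\<close>

lemma resonator_constants:
  fixes b :: real
  assumes "0 < b" "b < 1"
  defines "c \<equiv> 2 * b / (1 + b\<^sup>2)"
  shows "0 < c" "c < 1" "1 + c = (1 + b)\<^sup>2 / (1 + b\<^sup>2)" "1 < 2 / (1 + b\<^sup>2)" "c = b * (2 / (1 + b\<^sup>2))"
proof -
  have p: "1 + b\<^sup>2 > 0" by (simp add: add_pos_nonneg)
  show "0 < c" using assms p by (simp add: c_def)
  have "(1 - b)\<^sup>2 > 0" using assms by simp
  then have "2 * b < 1 + b\<^sup>2" by (simp add: power2_eq_square algebra_simps)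
  then show "c < 1" using p by (simp add: c_def)
  show "1 + c = (1 + b)\<^sup>2 / (1 + b\<^sup>2)" using p by (simp add: c_def power2_eq_square field_simps)
  have "b * b < 1 * 1" using assms by (intro mult_strict_mono) auto
  then show "1 < 2 / (1 + b\<^sup>2)" using p by (simp add: power2_eq_square)
  show "c = b * (2 / (1 + b\<^sup>2))" by (simp add: c_def)
qed

lemma alpha_eq:
  fixes b :: real
  assumes b: "0 < b" "b < 1"
  defines "q \<equiv> real CARD('a::{finite,field})"
  shows "alpha TYPE('a) b = 2 * (q / (q - 1)) / ln q * ln (1 + 2 * b / (1 + b\<^sup>2))"
    and "alpha TYPE('a) b > 0"
proof -
  have q: "q > 1" using card_field_ge2[where 'a='a] by (simp add: q_def)
  have "zeta_poly TYPE('a) 2 = 1 / (1 - q powr (-1))" by (simp add: zeta_poly_eq q_def)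
  also have "\<dots> = q / (q - 1)" using q by (simp add: powr_minus field_simps)
  finally show eq: "alpha TYPE('a) b = 2 * (q / (q - 1)) / ln q * ln (1 + 2 * b / (1 + b\<^sup>2))"
    using resonator_constants(3)[OF b] by (simp add: alpha_def q_def)
  show "alpha TYPE('a) b > 0"
    unfolding eq using q resonator_constants(1)[OF b] by simp
qed

text \<open>The parameter \<theta> measures how much of the slack 2/(1 + b^2) is used: \<theta> = 1
  gives the bound for \<Phi>, and some \<theta> > 1 gives the first assertion.\<close>

theorem large_values_proportion:
  fixes \<sigma> b \<xi> \<theta> :: real
  assumes odd: "odd CARD('a::{finite,field})" and \<sigma>: "1 / 2 < \<sigma>" "\<sigma> < 1" and b: "0 < b" "b < 1"
    and \<xi>: "0 < \<xi>" "\<xi> < 1 / alpha TYPE('a) b" and \<theta>: "0 < \<theta>" "\<theta> < 2 / (1 + b\<^sup>2)"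
  defines "q \<equiv> real CARD('a)"
  shows "\<forall>\<^sub>F N in sequentially.
    real (card {P \<in> monic_irreducibles N :: 'a poly set. ln_quad_L \<sigma> P \<ge> \<theta> * tau TYPE('a) \<sigma> b \<xi> N})
      / real (card (monic_irreducibles N :: 'a poly set)) \<ge>
    exp (- (1 / 2) * (1 - \<xi> * alpha TYPE('a) b) * ln q * real N) / (real N * ln q)"
proof -
  define \<alpha> where "\<alpha> = alpha TYPE('a) b"
  define l where "l = ln q"
  define c where "c = 2 * b / (1 + b\<^sup>2)"
  define \<Lambda> where "\<Lambda> = ln (1 + c)"
  define \<delta> where "\<delta> = \<xi> * \<alpha> / 2"
  \<comment> \<open>The value for which (1 + c)^(K N) = q^((1/2 - \<delta>)N). Times q^(N/2) from
    the Weil bound, this still leaves a saving q^(-\<delta>N) over q^N.\<close>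
  define K where "K = (1 - 2 * \<delta>) * l / (2 * \<Lambda>)"
  define Zs where "Zs = 1 / (1 - q powr (\<sigma> - 1))"
  define t where "t = Zs * (K * (q - 1) / (q * q)) powr (1 - \<sigma>)"
  define g where "g = (\<lambda>N::nat. real N powr (1 - \<sigma>) * log q (real N) powr (-\<sigma>))"
  define u where "u = q powr (-\<sigma>)"
  define \<rho> where "\<rho> = u * sqrt q"
  define s where "s = - ln \<rho> * (\<delta> / 2)"
  have q: "q > 1" using card_field_ge2[where 'a='a] by (simp add: q_def)
  have qe: "q = real CARD('a)" by (simp add: q_def)
  have \<sigma>0: "0 < \<sigma>" using \<sigma> by simp
  have l: "l > 0" using q by (simp add: l_def)
  have c: "0 < c" "c < 1" using resonator_constants(1,2)[OF b] unfolding c_def by auto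
  have \<Lambda>: "\<Lambda> > 0" using c by (simp add: \<Lambda>_def)
  have \<alpha>: "\<alpha> > 0" "\<alpha> = 2 * (q / (q - 1)) / l * \<Lambda>"
    using alpha_eq[OF b, where 'a='a] by (auto simp: \<alpha>_def q_def l_def \<Lambda>_def c_def)
  have \<delta>: "0 < \<delta>" "2 * \<delta> < 1" using \<xi> \<alpha>(1) by (auto simp: \<delta>_def \<alpha>_def[symmetric] pos_less_divide_eq)
  have K: "K > 0" using \<delta> l \<Lambda> by (simp add: K_def)
  \<comment> \<open>The denominator is \<open>beta0\<close>; its power 1 - \<sigma> is how
    \<beta>_q(b)^(\<sigma> - 1) enters \<tau>.\<close>
  have Kc: "K * (q - 1) / (q * q) = (1 - 2 * \<delta>) / (q * \<alpha>)"
    using q l \<Lambda> unfolding K_def \<alpha>(2) by (simp add: field_simps)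
  have Zs: "Zs > 0" using q \<sigma> powr_less_mono[of "\<sigma> - 1" 0 q] by (simp add: Zs_def)
  have t: "t > 0" using Zs K q by (simp add: t_def)
  have tau: "tau TYPE('a) \<sigma> b \<xi> N = b * t * g N" for N
  proof -
    have "beta TYPE('a) \<sigma> b = b * Zs * (q * \<alpha>) powr (\<sigma> - 1)"
      using \<sigma> by (simp add: beta_def beta0_def zeta_poly_eq Zs_def q_def \<alpha>_def)
    moreover have "(K * (q - 1) / (q * q)) powr (1 - \<sigma>) = (1 - 2 * \<delta>) powr (1 - \<sigma>) * (q * \<alpha>) powr (\<sigma> - 1)"
    proof -
      have "(K * (q - 1) / (q * q)) powr (1 - \<sigma>) = (1 - 2 * \<delta>) powr (1 - \<sigma>) / (q * \<alpha>) powr (1 - \<sigma>)"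
        unfolding Kc by (rule powr_divide)
      also have "\<dots> = (1 - 2 * \<delta>) powr (1 - \<sigma>) * (q * \<alpha>) powr (- (1 - \<sigma>))"
        by (simp only: powr_minus divide_inverse)
      finally show ?thesis by simp
    qed
    moreover have "1 - \<xi> * \<alpha> = 1 - 2 * \<delta>" by (simp add: \<delta>_def)
    ultimately show ?thesis by (simp add: tau_def t_def g_def \<alpha>_def[symmetric] q_def[symmetric] mult_ac)
  qed
  have \<rho>: "0 < \<rho>" "\<rho> < 1"
    using q card_powr_bounds(1,3)[OF \<sigma>(1), where 'a='a] by (simp_all add: \<rho>_def u_def q_def)
  have s: "s > 0" using \<rho> \<delta> by (simp add: s_def mult_neg_pos)
  obtain y where y: "\<And>N. real (card (primes_upto (y N) :: 'a poly set)) \<le> K * real N"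
    "\<And>N. K * real N < real (card (primes_upto (Suc (y N)) :: 'a poly set))"
    using exists_cutoff[OF K, where 'a='a] by blast
  \<comment> \<open>About \<delta>N/2, so that the q^Y primes cost only half of the saving
    q^(-\<delta>N), while \<rho>^Y is still exponentially small and Y exceeds the logarithmic cutoff
    \<open>y N\<close>.\<close>
  define Y where "Y = (\<lambda>N::nat. nat \<lfloor>\<delta> / 2 * real N\<rfloor>)"
  \<comment> \<open>The midpoint between \<theta> (1 + b^2)/2 and 1: the part \<omega> of the sum
    over primes still leaves a positive surplus \<open>\<kappa>\<close> over \<theta>.\<close>
  define \<omega> where "\<omega> = (\<theta> * (1 + b\<^sup>2) / 2 + 1) / 2"
  have p: "1 + b\<^sup>2 > 0" by (simp add: add_pos_nonneg)
  have \<omega>0: "\<theta> * (1 + b\<^sup>2) / 2 < 1" using \<theta>(2) p by (simp add: pos_less_divide_eq)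
  have "0 < \<theta> * (1 + b\<^sup>2) / 2" using \<theta>(1) p by simp
  then have \<omega>: "0 < \<omega>" "\<omega> < 1" "\<theta> * (1 + b\<^sup>2) / 2 < \<omega>" using \<omega>0 by (auto simp: \<omega>_def)
  define \<kappa> where "\<kappa> = \<omega> * (2 / (1 + b\<^sup>2)) - \<theta>"
  have \<kappa>: "\<kappa> > 0"
  proof -
    have "\<theta> = \<theta> * (1 + b\<^sup>2) / 2 * (2 / (1 + b\<^sup>2))" using p by simp
    also have "\<dots> < \<omega> * (2 / (1 + b\<^sup>2))" using \<omega>(3) p by (intro mult_strict_right_mono) auto
    finally show ?thesis by (simp add: \<kappa>_def)
  qed
  \<comment> \<open>\<open>e\<close> bounds the error of a weighted character sum relative to the
    number of primes of degree N. \<open>err\<close> collects, on the same scale, the primes up to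
    degree Y, the tail of the series, and \<tau> times \<open>e\<close>.\<close>
  define e where "e = (\<lambda>N::nat. 2 * (K * (real N)\<^sup>2 + real N + 1) * exp (- (\<delta> * l) * real N))"
  define err where "err = (\<lambda>N::nat. 4 * real N * (K * (real N)\<^sup>2 + real N + 1) * exp (- (\<delta> / 2 * l) * real N)
      + 2 * (real N * exp (- s * real N) / (1 - \<rho>)) + \<theta> * b * t * (real N * e N))"
  have dl: "\<delta> * l > 0" "\<delta> / 2 * l > 0" using \<delta> l by auto
  have lim1: "(\<lambda>N::nat. 4 * real N * (K * (real N)\<^sup>2 + real N + 1) * exp (- a * real N)) \<longlonglongrightarrow> 0" if "a > 0" for a
    using that K by real_asymp
  have lim2: "(\<lambda>N::nat. 2 * (real N * exp (- s * real N) / (1 - \<rho>))) \<longlonglongrightarrow> 0"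
    using s \<rho> by real_asymp
  have lime: "e \<longlonglongrightarrow> 0"
  proof -
    have "(\<lambda>N::nat. 2 * (K * (real N)\<^sup>2 + real N + 1) * exp (- a * real N)) \<longlonglongrightarrow> 0" if "a > 0" for a
      using that K by real_asymp
    from this[OF dl(1)] show ?thesis by (simp add: e_def)
  qed
  have lim3: "(\<lambda>N. real N * e N) \<longlonglongrightarrow> 0"
  proof -
    have "(\<lambda>N::nat. real N * (2 * (K * (real N)\<^sup>2 + real N + 1) * exp (- a * real N))) \<longlonglongrightarrow> 0" if "a > 0" for a
      using that K by real_asymp
    from this[OF dl(1)] show ?thesis by (simp add: e_def)
  qed
  have "err \<longlonglongrightarrow> 0 + 0 + \<theta> * b * t * 0"
    unfolding err_def by (intro tendsto_add tendsto_mult_left lim1[OF dl(2)] lim2 lim3)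
  then have ev_err: "\<forall>\<^sub>F N in sequentially. err N < 1"
    by (intro order_tendstoD(2)[of _ "0 + 0 + \<theta> * b * t * 0"]) auto
  have ev_e: "\<forall>\<^sub>F N in sequentially. e N < 1" by (rule order_tendstoD(2)[OF lime]) simp
  have g_eq: "g = (\<lambda>N. real N powr (1 - \<sigma>) * (ln (real N) / l) powr (-\<sigma>))"
    by (simp add: g_def log_def l_def)
  \<comment> \<open>With \<open>err\<close> below 1, a surplus of 2 leaves at least the full number
    of primes for the large values to account for.\<close>
  have ev_g: "\<forall>\<^sub>F N in sequentially. 2 \<le> \<kappa> * b * t * g N"
  proof -
    have "filterlim g at_top sequentially" unfolding g_eq using l \<sigma> by real_asymp
    then have "filterlim (\<lambda>N. \<kappa> * b * t * g N) at_top sequentially"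
      using \<kappa> b t by (intro filterlim_tendsto_pos_mult_at_top[OF tendsto_const]) auto
    then show ?thesis by (simp add: filterlim_at_top)
  qed
  have ev_gN: "\<forall>\<^sub>F N in sequentially. g N \<le> real N"
    unfolding g_eq using l \<sigma> by real_asymp
  have ev_y: "\<forall>\<^sub>F N in sequentially. real (y N) \<le> (1 + 1) * log q (real N)"
    by (rule cutoff_le_log[OF K qe y]) simp
  have ev_Y: "\<forall>\<^sub>F N::nat in sequentially. 2 * (ln (real N) / l) \<le> \<delta> / 2 * real N - 1"
    using \<delta> l by real_asymp
  have ev_\<pi>: "\<forall>\<^sub>F N in sequentially. real (card (monic_irreducibles N :: 'a poly set)) \<ge> (1 - 1 / 2) * q ^ N / real N"
    unfolding q_def by (rule card_monic_irreducibles_ge') simp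
  have ev_M: "\<forall>\<^sub>F N in sequentially. (\<Sum>R\<in>(primes_upto (y N) :: 'a poly set). u ^ degree R) \<ge> \<omega> * t * g N"
    using cutoff_sum_lower[OF K qe y \<sigma>0 \<sigma>(2) \<omega>(1,2)] by (simp add: u_def t_def Zs_def g_def mult.assoc)
  show ?thesis
    using ev_err ev_e ev_g ev_gN ev_y ev_Y ev_\<pi> ev_M eventually_gt_at_top[of 0]
  proof eventually_elim
    case (elim N)
    let ?S = "primes_upto (y N) :: 'a poly set"
    let ?I = "monic_irreducibles N :: 'a poly set"
    let ?\<tau> = "\<theta> * tau TYPE('a) \<sigma> b \<xi> N"
    let ?G = "{P \<in> ?I. ln_quad_L \<sigma> P \<ge> ?\<tau>}"
    define \<pi>' where "\<pi>' = real (card ?I)"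
    define C where "C = (1 + c) ^ card ?S"
    define B where "B = (real (\<Sum>R\<in>?S. degree R) + real (Y N) + 1) * sqrt (real CARD('a)) ^ N / real N"
    define M where "M = (\<Sum>R\<in>?S. u ^ degree R)"
    define tl where "tl = real N * \<rho> ^ Suc (Y N) / (1 - \<rho>)"
    have N: "real N > 0" using elim by simp
    have Yr: "real (Y N) \<le> \<delta> / 2 * real N" "\<delta> / 2 * real N < real (Y N) + 1"
      using \<delta> N by (auto simp: Y_def) linarith+
    have yY: "y N \<le> Y N"
    proof -
      have "real (y N) \<le> real (Y N)" using elim(5,6) Yr by (simp add: log_def l_def)
      then show ?thesis by simp
    qed
    have "\<delta> / 2 * real N < 1 * real N" using \<delta> N by (intro mult_strict_right_mono) auto
    then have YN: "Y N < N" using Yr by linarith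
    have yN: "y N \<le> N" using yY YN by simp
    have sub: "?S \<subseteq> primes_upto (Y N)" using yY by (auto simp: primes_upto_def)
    interpret resonance ?S N "Y N" c B
      unfolding B_def by (rule resonance_construct[OF odd sub YN]) (use c in auto)
    have g0: "g N \<ge> 0" by (simp add: g_def)
    have \<tau>0: "?\<tau> \<ge> 0" using \<theta> b t g0 by (simp add: tau)
    have main: "real (card ?G) * (C * (real N * l)) \<ge>
      c * \<pi>' * M - 2 * real (Y N) * q ^ Y N * (C * B) - (tl + ?\<tau>) * (\<pi>' + C * B)"
      using resonance_bound[OF \<sigma>(1) \<tau>0]
      by (simp add: C_def \<pi>'_def M_def u_def q_def l_def tl_def \<rho>_def)
    have q_exp: "q ^ k = exp (l * real k)" for k
      using q by (simp add: l_def exp_of_nat2_mult)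
    have sq_exp: "sqrt q ^ N = exp (l / 2 * real N)"
    proof -
      have "sqrt q = exp (l / 2)" using q by (simp add: l_def powr_half_sqrt[symmetric] powr_def)
      then show ?thesis using exp_of_nat_mult[of N "l / 2"] by (simp add: mult.commute)
    qed
    have C_le: "C \<le> exp ((1 / 2 - \<delta>) * l * real N)"
    proof -
      have "C = exp (\<Lambda> * real (card ?S))"
        using c by (simp add: C_def \<Lambda>_def exp_of_nat2_mult)
      also have "\<dots> \<le> exp (\<Lambda> * (K * real N))" using y(1)[of N] \<Lambda> by simp
      also have "\<Lambda> * (K * real N) = (1 / 2 - \<delta>) * l * real N" using \<Lambda> by (simp add: K_def field_simps)
      finally show ?thesis .
    qed
    have C0: "C > 0" using c by (simp add: C_def)
    have DS: "real (\<Sum>R\<in>?S. degree R) \<le> K * (real N)\<^sup>2"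
    proof -
      have "(\<Sum>R\<in>?S. degree R) \<le> (\<Sum>R\<in>?S. N)" using yN by (intro sum_mono) (auto simp: primes_upto_def)
      then have "(\<Sum>R\<in>?S. degree R) \<le> card ?S * N" by simp
      then have "real (\<Sum>R\<in>?S. degree R) \<le> real (card ?S) * real N" by (metis of_nat_le_iff of_nat_mult)
      also have "\<dots> \<le> K * real N * real N" using y(1)[of N] by (intro mult_right_mono) auto
      finally show ?thesis by (simp add: power2_eq_square)
    qed
    have \<pi>: "\<pi>' \<ge> exp (l * real N) / (2 * real N)" using elim(7) by (simp add: \<pi>'_def q_exp)
    then have \<pi>0: "\<pi>' > 0" using N by (smt (verit) divide_pos_pos exp_gt_zero)
    have CB: "C * B \<le> e N * \<pi>'"
    proof -
      let ?n = "K * (real N)\<^sup>2 + real N + 1"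
      have n: "?n > 0" using K by (simp add: add_nonneg_pos)
      have "B \<le> ?n * exp (l / 2 * real N) / real N"
        unfolding B_def q_def[symmetric] sq_exp using DS YN
        by (intro divide_right_mono mult_right_mono) auto
      then have "C * B \<le> exp ((1 / 2 - \<delta>) * l * real N) * (?n * exp (l / 2 * real N) / real N)"
        using C_le C0 resonance_axioms unfolding resonance_def by (intro mult_mono) auto
      also have "\<dots> = 2 * ?n * (exp ((1 / 2 - \<delta>) * l * real N) * exp (l / 2 * real N)) / (2 * real N)"
        using N by (simp add: field_simps)
      also have "exp ((1 / 2 - \<delta>) * l * real N) * exp (l / 2 * real N) = exp (- (\<delta> * l) * real N) * exp (l * real N)"
        by (simp add: exp_add[symmetric] algebra_simps)
      also have "2 * ?n * (exp (- (\<delta> * l) * real N) * exp (l * real N)) / (2 * real N) = e N * (exp (l * real N) / (2 * real N))"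
        by (simp add: e_def mult_ac)
      also have "\<dots> \<le> e N * \<pi>'" using \<pi> n by (intro mult_left_mono) (auto simp: e_def)
      finally show ?thesis .
    qed
    have e0: "e N \<ge> 0" using K by (simp add: e_def)
    have tl: "0 \<le> tl" "tl \<le> real N * exp (- s * real N) / (1 - \<rho>)"
    proof -
      show "0 \<le> tl" using \<rho> by (simp add: tl_def)
      have "\<rho> ^ Suc (Y N) = exp (ln \<rho> * (real (Y N) + 1))"
        using \<rho> exp_of_nat2_mult[of "ln \<rho>" "Suc (Y N)"] by (simp add: add.commute)
      also have "\<dots> \<le> exp (ln \<rho> * (\<delta> / 2 * real N))"
        using Yr(2) \<rho> by (simp add: mult_left_mono_neg)
      finally have "\<rho> ^ Suc (Y N) \<le> exp (- s * real N)" by (simp add: s_def mult.assoc)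
      then show "tl \<le> real N * exp (- s * real N) / (1 - \<rho>)"
        unfolding tl_def using \<rho> by (intro divide_right_mono mult_left_mono) auto
    qed
    have qY: "2 * real (Y N) * q ^ Y N * (C * B) \<le> (4 * real N * (K * (real N)\<^sup>2 + real N + 1) * exp (- (\<delta> / 2 * l) * real N)) * \<pi>'"
    proof -
      have "q ^ Y N \<le> exp (\<delta> / 2 * l * real N)"
        unfolding q_exp using mult_left_mono[OF Yr(1), of l] l by (simp add: mult_ac)
      then have "2 * real (Y N) * q ^ Y N * (C * B) \<le> 2 * real N * exp (\<delta> / 2 * l * real N) * (e N * \<pi>')"
      proof (intro mult_mono[OF _ CB])
        show "2 * real (Y N) * q ^ Y N \<le> 2 * real N * exp (\<delta> / 2 * l * real N)"
          using \<open>q ^ Y N \<le> _\<close> YN q by (intro mult_mono) auto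
        show "0 \<le> C * B" using C0 resonance_axioms unfolding resonance_def by (intro mult_nonneg_nonneg) auto
      qed auto
      also have "\<dots> = (4 * real N * (K * (real N)\<^sup>2 + real N + 1) * (exp (\<delta> / 2 * l * real N) * exp (- (\<delta> * l) * real N))) * \<pi>'"
        by (simp add: e_def mult_ac)
      also have "exp (\<delta> / 2 * l * real N) * exp (- (\<delta> * l) * real N) = exp (- (\<delta> / 2 * l) * real N)"
        by (simp add: exp_add[symmetric] algebra_simps)
      finally show ?thesis .
    qed
    have "(tl + ?\<tau>) * (\<pi>' + C * B) \<le> (tl + ?\<tau>) * (\<pi>' + e N * \<pi>')"
      using CB tl(1) \<tau>0 by (intro mult_left_mono) auto
    also have "\<dots> = (tl * (1 + e N) + ?\<tau> * e N + ?\<tau>) * \<pi>'" by (simp add: algebra_simps)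
    finally have m3: "(tl + ?\<tau>) * (\<pi>' + C * B) \<le> (tl * (1 + e N) + ?\<tau> * e N + ?\<tau>) * \<pi>'" .
    have b1: "tl * (1 + e N) \<le> 2 * (real N * exp (- s * real N) / (1 - \<rho>))"
    proof -
      have "tl * (1 + e N) \<le> tl * 2" using elim(2) tl(1) by (intro mult_left_mono) auto
      then show ?thesis using tl(2) by linarith
    qed
    have b2: "?\<tau> * e N \<le> \<theta> * b * t * (real N * e N)"
    proof -
      have "g N * e N \<le> real N * e N" using elim(4) e0 by (intro mult_right_mono) auto
      then have "\<theta> * b * t * (g N * e N) \<le> \<theta> * b * t * (real N * e N)"
        using \<theta> b t by (intro mult_left_mono) auto
      then show ?thesis by (simp add: tau mult_ac)
    qed
    have cM: "c * M \<ge> ?\<tau> + \<kappa> * b * t * g N"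
    proof -
      have "?\<tau> + \<kappa> * b * t * g N = c * (\<omega> * t * g N)"
        using resonator_constants(5)[OF b] by (simp add: tau \<kappa>_def c_def algebra_simps)
      also have "\<dots> \<le> c * M" using elim(8) c unfolding M_def by (intro mult_left_mono) auto
      finally show ?thesis .
    qed
    have "\<pi>' \<le> (\<kappa> * b * t * g N - err N) * \<pi>'"
      using elim(1,3) \<pi>0 by simp
    also have "\<dots> \<le> (c * M - ?\<tau> - err N) * \<pi>'" using cM \<pi>0 by (intro mult_right_mono) auto
    also have "\<dots> \<le> c * \<pi>' * M - (4 * real N * (K * (real N)\<^sup>2 + real N + 1) * exp (- (\<delta> / 2 * l) * real N)) * \<pi>'
        - (tl * (1 + e N) + ?\<tau> * e N + ?\<tau>) * \<pi>'"
    proof -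
      have "(tl * (1 + e N) + ?\<tau> * e N) * \<pi>' \<le>
          (2 * (real N * exp (- s * real N) / (1 - \<rho>)) + \<theta> * b * t * (real N * e N)) * \<pi>'"
        using b1 b2 \<pi>0 by (intro mult_right_mono add_mono) auto
      then show ?thesis by (simp add: err_def algebra_simps)
    qed
    also have "\<dots> \<le> c * \<pi>' * M - 2 * real (Y N) * q ^ Y N * (C * B) - (tl + ?\<tau>) * (\<pi>' + C * B)"
      using qY m3 by linarith
    also have "\<dots> \<le> real (card ?G) * (C * (real N * l))" by (rule main)
    also have "\<dots> \<le> real (card ?G) * (exp ((1 / 2 - \<delta>) * l * real N) * (real N * l))"
      using C_le l by (intro mult_left_mono mult_right_mono) auto
    finally have "1 / (exp ((1 / 2 - \<delta>) * l * real N) * (real N * l)) \<le> real (card ?G) / \<pi>'"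
      using \<pi>0 l N by (simp add: pos_divide_le_eq pos_le_divide_eq)
    moreover have "1 / (exp ((1 / 2 - \<delta>) * l * real N) * (real N * l)) =
        exp (- (1 / 2) * (1 - \<xi> * alpha TYPE('a) b) * ln q * real N) / (real N * ln q)"
    proof -
      have "- (1 / 2) * (1 - \<xi> * alpha TYPE('a) b) * ln q * real N = - ((1 / 2 - \<delta>) * l * real N)"
        by (simp add: \<delta>_def \<alpha>_def l_def algebra_simps)
      then show ?thesis by (simp only: exp_minus l_def[symmetric]) (simp add: field_simps)
    qed
    ultimately show ?case by (simp add: \<pi>'_def)
  qed
qed

theorem theorem1p5:
  fixes \<sigma> b :: real
  assumes "odd CARD('a::{finite,field})"
    and "1/2 < \<sigma>" "\<sigma> < 1" and "0 < b" "b < 1"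
  shows
    "(\<exists>\<epsilon> :: nat \<Rightarrow> real. \<epsilon> \<longlonglongrightarrow> 0 \<and>
       (\<forall>\<^sub>F N in sequentially. \<exists>P \<in> monic_irreducibles N :: 'a poly set.
          ln_quad_L \<sigma> P \<ge> (beta TYPE('a) \<sigma> b + \<epsilon> N) *
            (log (real CARD('a)) (pnorm P) powr (1 - \<sigma>)
              / log (real CARD('a)) (log (real CARD('a)) (pnorm P)) powr \<sigma>)))
     \<and>
     (\<forall>\<xi>. 0 < \<xi> \<and> \<xi> < 1 / alpha TYPE('a) b \<longrightarrow>
       (\<exists>\<epsilon> :: nat \<Rightarrow> real. \<epsilon> \<longlonglongrightarrow> 0 \<and>
         (\<forall>\<^sub>F N in sequentially.
            Phi TYPE('a) \<sigma> b \<xi> N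
              \<ge> (real CARD('a) ^ N) powr (- (1/2) * (1 - \<xi> * alpha TYPE('a) b) + \<epsilon> N))))"
proof (intro conjI allI impI)
  let ?q = "real CARD('a)" and ?\<alpha> = "alpha TYPE('a) b"
  have q: "?q > 1" using card_field_ge2[where 'a='a] by simp
  have \<alpha>: "?\<alpha> > 0" by (rule alpha_eq(2)[OF assms(4,5)])
  define \<theta> where "\<theta> = (1 + 2 / (1 + b\<^sup>2)) / 2"
  have \<theta>: "1 < \<theta>" "\<theta> < 2 / (1 + b\<^sup>2)" using resonator_constants(4)[OF assms(4,5)] by (auto simp: \<theta>_def)
  \<comment> \<open>Chosen so that \<theta> r^(1 - \<sigma>) = 1. With 1 - \<xi>\<alpha> = r, the
    threshold \<theta>\<tau> is then exactly \<beta>_q(\<sigma>, b) N^(1 - \<sigma>) (log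
    N)^(-\<sigma>).\<close>
  define r where "r = \<theta> powr (- (1 / (1 - \<sigma>)))"
  define \<xi> where "\<xi> = (1 - r) / ?\<alpha>"
  have r: "0 < r" "r < 1"
  proof -
    show "0 < r" using \<theta> by (simp add: r_def)
    have "r < \<theta> powr 0" unfolding r_def using \<theta> assms(3) by (intro powr_less_mono) auto
    then show "r < 1" using \<theta> by simp
  qed
  have \<xi>: "0 < \<xi>" "\<xi> < 1 / ?\<alpha>" using r \<alpha> by (auto simp: \<xi>_def divide_strict_right_mono)
  have "r powr (1 - \<sigma>) = \<theta> powr (-1)" using assms(3) by (simp add: r_def powr_powr)
  then have \<theta>r: "\<theta> * r powr (1 - \<sigma>) = 1" using \<theta> by (simp add: powr_minus)
  have \<theta>tau: "\<theta> * tau TYPE('a) \<sigma> b \<xi> N =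
      beta TYPE('a) \<sigma> b * (real N powr (1 - \<sigma>) * log ?q (real N) powr (-\<sigma>))" for N
  proof -
    have "1 - \<xi> * ?\<alpha> = r" using \<alpha> by (simp add: \<xi>_def)
    then have "\<theta> * tau TYPE('a) \<sigma> b \<xi> N = (\<theta> * r powr (1 - \<sigma>)) *
        (beta TYPE('a) \<sigma> b * (real N powr (1 - \<sigma>) * log ?q (real N) powr (-\<sigma>)))"
      by (simp add: tau_def mult_ac)
    then show ?thesis unfolding \<theta>r by simp
  qed
  have "0 < \<theta>" using \<theta>(1) by simp
  from large_values_proportion[OF assms \<xi> this \<theta>(2)]
  have ev: "\<forall>\<^sub>F N in sequentially. \<exists>P \<in> monic_irreducibles N :: 'a poly set.
      ln_quad_L \<sigma> P \<ge> \<theta> * tau TYPE('a) \<sigma> b \<xi> N"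
    using eventually_gt_at_top[of 0]
  proof eventually_elim
    case (elim N)
    have "exp (- (1 / 2) * (1 - \<xi> * ?\<alpha>) * ln ?q * real N) / (real N * ln ?q) > 0"
      using elim(2) q by simp
    then have "real (card {P \<in> monic_irreducibles N :: 'a poly set. ln_quad_L \<sigma> P \<ge> \<theta> * tau TYPE('a) \<sigma> b \<xi> N})
      / real (card (monic_irreducibles N :: 'a poly set)) > 0"
      using elim(1) by linarith
    then have "{P \<in> monic_irreducibles N :: 'a poly set. ln_quad_L \<sigma> P \<ge> \<theta> * tau TYPE('a) \<sigma> b \<xi> N} \<noteq> {}"
      by (metis card.empty div_0 less_irrefl of_nat_0)
    then show ?case by blast
  qed
  show "\<exists>\<epsilon> :: nat \<Rightarrow> real. \<epsilon> \<longlonglongrightarrow> 0 \<and>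
       (\<forall>\<^sub>F N in sequentially. \<exists>P \<in> monic_irreducibles N :: 'a poly set.
          ln_quad_L \<sigma> P \<ge> (beta TYPE('a) \<sigma> b + \<epsilon> N) *
            (log ?q (pnorm P) powr (1 - \<sigma>) / log ?q (log ?q (pnorm P)) powr \<sigma>))"
  \<comment> \<open>The slack has already removed every loss, so the error term can be taken to be
    0.\<close>
  proof (intro exI[of _ "\<lambda>_. 0"] conjI tendsto_const)
    show "\<forall>\<^sub>F N in sequentially. \<exists>P \<in> monic_irreducibles N :: 'a poly set.
          ln_quad_L \<sigma> P \<ge> (beta TYPE('a) \<sigma> b + 0) *
            (log ?q (pnorm P) powr (1 - \<sigma>) / log ?q (log ?q (pnorm P)) powr \<sigma>)"
      using ev
    proof eventually_elim
      case (elim N)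
      then obtain P where P: "P \<in> (monic_irreducibles N :: 'a poly set)"
        "ln_quad_L \<sigma> P \<ge> \<theta> * tau TYPE('a) \<sigma> b \<xi> N" by blast
      have "log ?q (pnorm P) = real N"
        using P(1) q by (simp add: pnorm_def monic_irreducibles_def log_nat_power)
      then show ?case
        using P by (intro bexI[of _ P]) (simp_all add: \<theta>tau powr_minus divide_inverse)
    qed
  qed
next
  let ?q = "real CARD('a)" and ?\<alpha> = "alpha TYPE('a) b"
  fix \<xi> :: real assume \<xi>: "0 < \<xi> \<and> \<xi> < 1 / ?\<alpha>"
  have q: "?q > 1" using card_field_ge2[where 'a='a] by simp
  have l: "ln ?q > 0" using q by simp
  \<comment> \<open>Chosen so that q^(N \<epsilon>) = 1/(N ln q), the factor lost through the
    trivial bound for ln L.\<close>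
  define \<epsilon> where "\<epsilon> = (\<lambda>N::nat. - ln (real N * ln ?q) / (ln ?q * real N))"
  have "\<epsilon> \<longlonglongrightarrow> 0"
  proof -
    have "(\<lambda>N::nat. - ln (real N * l) / (l * real N)) \<longlonglongrightarrow> 0" if "l > 0" for l :: real
      using that by real_asymp
    from this[OF l] show ?thesis by (simp add: \<epsilon>_def)
  qed
  moreover have "\<forall>\<^sub>F N in sequentially. Phi TYPE('a) \<sigma> b \<xi> N
      \<ge> (?q ^ N) powr (- (1/2) * (1 - \<xi> * ?\<alpha>) + \<epsilon> N)"
    using large_values_proportion[OF assms conjunct1[OF \<xi>] conjunct2[OF \<xi>] zero_less_one
        resonator_constants(4)[OF assms(4,5)]] eventually_gt_at_top[of 0]
  proof eventually_elim
    case (elim N)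
    have N: "real N > 0" using elim by simp
    have "(?q ^ N) powr (- (1/2) * (1 - \<xi> * ?\<alpha>) + \<epsilon> N) =
        exp ((- (1/2) * (1 - \<xi> * ?\<alpha>) + \<epsilon> N) * (real N * ln ?q))"
      using q by (simp add: powr_def ln_realpow)
    also have "(- (1/2) * (1 - \<xi> * ?\<alpha>) + \<epsilon> N) * (real N * ln ?q) =
        - (1/2) * (1 - \<xi> * ?\<alpha>) * ln ?q * real N - ln (real N * ln ?q)"
    proof -
      have "\<epsilon> N * (real N * ln ?q) = - ln (real N * ln ?q)" using N l by (simp add: \<epsilon>_def)
      then show ?thesis by (simp only: distrib_right) (simp add: mult_ac)
    qed
    also have "exp \<dots> = exp (- (1/2) * (1 - \<xi> * ?\<alpha>) * ln ?q * real N) / (real N * ln ?q)"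
      using N l by (simp add: exp_diff)
    finally show ?case using elim(1) by (simp add: Phi_def)
  qed
  ultimately show "\<exists>\<epsilon> :: nat \<Rightarrow> real. \<epsilon> \<longlonglongrightarrow> 0 \<and>
         (\<forall>\<^sub>F N in sequentially. Phi TYPE('a) \<sigma> b \<xi> N
              \<ge> (?q ^ N) powr (- (1/2) * (1 - \<xi> * ?\<alpha>) + \<epsilon> N))"
    by blast
qed

end
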